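(* The assignment $\mathrm{Fr}$ on objects, $(E,A,\{C_\alpha\}_{\alpha\in A})\mapsto(\mathrm{Fib}_E(!),A,\{L_E(!)(C_\alpha)\}_{\alpha\in A})$, extends to a $2$-functor $\mathrm{Fr}:\mathrm{LS}\to\mathrm{RLS}$, and the maps $L_E(!)$ (that is, the morphisms of limit sketches $(L_E(!),\mathrm{id}_A)$) assemble into a $2$-natural transformation $\eta:1_{\mathrm{LS}}\Rightarrow U\,\mathrm{Fr}$, where $U:\mathrm{RLS}\to\mathrm{LS}$ is the forgetful (inclusion) $2$-functor.
   Context: **Limit sketches.** A cone $C=(x,I,\phi,\delta)$ in a category $E$ consists of an object $x$ of $E$ (the vertex), a small category $I$, a functor $\phi:I\to E$, and a natural transformation $\delta:*_x\Rightarrow\phi$, where $*_x:I\to E$ is the constant functor at $x$. A functor $F:E\to E'$ sends it to the cone $F(C)=(F(x),I,F\circ\phi,F\delta)$. A limit sketch $(E,A,\{C_\alpha\}_{\alpha\in A})$ is a small category $E$ with a set of cones $C_\alpha=(x_\alpha,I_\alpha,\phi_\alpha,\delta_\alpha)$ in $E$ indexed by a set $A$. A morphism $(E,A,\{C_\alpha\})\to(E',B,\{C'_\beta\})$ is a pair $(F,f)$ of a functor $F:E\to E'$ and a function $f:A\to B$ such that $F(C_\alpha)=C'_{f(\alpha)}$ for all $\alpha\in A$. A 2-morphism $(F,f)\Rightarrow(G,g)$ is a natural transformation $F\Rightarrow G$. This gives the $2$-category $\mathrm{LS}$. $\mathrm{RLS}\subseteq\mathrm{LS}$ is the full sub-$2$-category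 on the realized limit sketches, i.e. those in which every specified cone is a limit cone. **Orthogonality.** For morphisms $f:x\to y$, $g:a\to b$ of a category, $f\downarrow g$ means that every commutative square with left side $f$ and right side $g$ has a unique diagonal filler $y\to a$. For a class $H$ of morphisms, $H^{\downarrow}=\{f\mid h\downarrow f\ \forall h\in H\}$ and $H^{\uparrow}=\{f\mid f\downarrow h\ \forall h\in H\}$. **The object $\mathrm{Fib}_E(!)$.** $\mathbf{Cat}$ is the category of small categories, and $E/\mathbf{Cat}$ is the coslice category. Fix a limit sketch $(E,A,\{C_\alpha\}_{\alpha\in A})$ with cones $C_\alpha=(x_\alpha,I_\alpha,\phi_\alpha,\delta_\alpha)$. For $y$ an object of $E$ and $\alpha\in A$, let $i_{y,\alpha}:E\to E[y;\alpha]$ with $\gamma:i_{y,\alpha}\circ *_y\Rightarrow i_{y,\alpha}\circ\phi_\alpha$ (where $*_y:I_\alpha\to E$) be the initial triple $(D,F,\psi)$ consisting of a small category $D$, a functor $F:E\to D$ and a natural transformation $\psi:F\circ *_y\Rightarrow F\circ\phi_\alpha$ (morphisms $(D,F,\psi)\to(D',F',\psi')$ being functors $H:D\to D'$ with $HF=F'$, $H\psi=\psi'$). Let $r_{y,\alpha}:E[y;\alpha]\to E[y;\alpha]'$ be obtained by freely adjoining a morphism $f_{y,\alpha}:y\to x_\alpha$ subject to $(\delta_\alpha)_i\circ f_{y,\alpha}=\gamma_i$ for every object $i$ of $I_\alpha$. Let $\Xi_E$ be the set of all $r_{y,\alpha}$, regarded as morphisms $(E[y;\alpha],i_{y,\alpha})\to(E[y;\alpha]',r_{y,\alpha}\circ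 i_{y,\alpha})$ of $E/\mathbf{Cat}$, and put $\mathcal R_E=\Xi_E^{\downarrow}$, $\mathcal L_E=\Xi_E^{\downarrow\uparrow}$; this is an orthogonal factorization system on $E/\mathbf{Cat}$, with a chosen functorial factorization. Applied to the unique morphism $!$ in $E/\mathbf{Cat}$ from the initial object $(E,\mathrm{id}_E)$ to the terminal object (the terminal category $*$), it gives $E\xrightarrow{L_E(!)}\mathrm{Fib}_E(!)\to *$ with first map in $\mathcal L_E$ and second in $\mathcal R_E$. *)

theory Defs
  imports Main "HOL-Library.FuncSet" "HOL-Library.Equipollence"
begin

text \<open>
  Small sets are the subsets of a type \<open>'u\<close> of smaller cardinality than \<open>'u\<close> itself.
  \<open>universe TYPE('u)\<close> says that the cardinality of \<open>'u\<close> is an uncountable strongly inaccessible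
  cardinal, so that the small sets form, up to bijection, a Grothendieck universe that
  contains an infinite set.
\<close>

definition small :: "'u set \<Rightarrow> bool" where
  "small A \<longleftrightarrow> A \<prec> (UNIV :: 'u set)"

definition universe :: "'u itself \<Rightarrow> bool" where
  "universe _ \<longleftrightarrow>
     (\<exists>A :: 'u set. small A \<and> infinite A) \<and>
     (\<forall>A :: 'u set. small A \<longrightarrow> Pow A \<prec> (UNIV :: 'u set)) \<and>
     (\<forall>(A :: 'u set) (B :: 'u \<Rightarrow> 'u set).
        small A \<and> (\<forall>a\<in>A. small (B a)) \<longrightarrow> small (\<Union>a\<in>A. B a))"

text \<open>\<open>Comp C g f\<close> is the composite "g after f".\<close>

record ('o, 'm) cat =
  Obj :: "'o set"
  Arr :: "'m set"
  Dom :: "'m \<Rightarrow> 'o"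
  Cod :: "'m \<Rightarrow> 'o"
  Ide :: "'o \<Rightarrow> 'm"
  Comp :: "'m \<Rightarrow> 'm \<Rightarrow> 'm"

definition Hom :: "('o, 'm) cat \<Rightarrow> 'o \<Rightarrow> 'o \<Rightarrow> 'm set" where
  "Hom C x y = {f \<in> Arr C. Dom C f = x \<and> Cod C f = y}"

definition category :: "('o, 'm) cat \<Rightarrow> bool" where
  "category C \<longleftrightarrow>
     (\<forall>f\<in>Arr C. Dom C f \<in> Obj C \<and> Cod C f \<in> Obj C) \<and>
     (\<forall>x\<in>Obj C. Ide C x \<in> Hom C x x) \<and>
     (\<forall>f\<in>Arr C. \<forall>g\<in>Arr C. Cod C f = Dom C g \<longrightarrow> Comp C g f \<in> Hom C (Dom C f) (Cod C g)) \<and>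
     (\<forall>f\<in>Arr C. Comp C f (Ide C (Dom C f)) = f \<and> Comp C (Ide C (Cod C f)) f = f) \<and>
     (\<forall>f\<in>Arr C. \<forall>g\<in>Arr C. \<forall>h\<in>Arr C. Cod C f = Dom C g \<and> Cod C g = Dom C h \<longrightarrow>
        Comp C h (Comp C g f) = Comp C (Comp C h g) f)"

text \<open>
  Small categories, functors and natural transformations take the value \<open>undefined\<close> outside
  their domains. Equality in HOL is then equality of the mathematical objects, as needed for the
  strict equations between cones, 1-cells and 2-cells below.
\<close>

definition small_category :: "('u, 'u) cat \<Rightarrow> bool" where
  "small_category C \<longleftrightarrow> category C \<and> small (Obj C) \<and> small (Arr C) \<and>
     Dom C \<in> extensional (Arr C) \<and> Cod C \<in> extensional (Arr C) \<and>
     Ide C \<in> extensional (Obj C) \<and>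
     (\<forall>g f. \<not> (f \<in> Arr C \<and> g \<in> Arr C \<and> Cod C f = Dom C g) \<longrightarrow> Comp C g f = undefined)"

record 'u func =
  Src :: "('u, 'u) cat"
  Tgt :: "('u, 'u) cat"
  omap :: "'u \<Rightarrow> 'u"
  amap :: "'u \<Rightarrow> 'u"

definition is_functor :: "'u func \<Rightarrow> bool" where
  "is_functor F \<longleftrightarrow> category (Src F) \<and> category (Tgt F) \<and>
     omap F \<in> Obj (Src F) \<rightarrow>\<^sub>E Obj (Tgt F) \<and>
     amap F \<in> Arr (Src F) \<rightarrow>\<^sub>E Arr (Tgt F) \<and>
     (\<forall>f\<in>Arr (Src F). amap F f \<in>
        Hom (Tgt F) (omap F (Dom (Src F) f)) (omap F (Cod (Src F) f))) \<and>
     (\<forall>x\<in>Obj (Src F). amap F (Ide (Src F) x) = Ide (Tgt F) (omap F x)) \<and>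
     (\<forall>f\<in>Arr (Src F). \<forall>g\<in>Arr (Src F). Cod (Src F) f = Dom (Src F) g \<longrightarrow>
        amap F (Comp (Src F) g f) = Comp (Tgt F) (amap F g) (amap F f))"

definition functor_between :: "'u func \<Rightarrow> ('u, 'u) cat \<Rightarrow> ('u, 'u) cat \<Rightarrow> bool" where
  "functor_between F C D \<longleftrightarrow> is_functor F \<and> Src F = C \<and> Tgt F = D"

definition id_func :: "('u, 'u) cat \<Rightarrow> 'u func" where
  "id_func C = \<lparr>Src = C, Tgt = C, omap = (\<lambda>x\<in>Obj C. x), amap = (\<lambda>f\<in>Arr C. f)\<rparr>"

definition comp_func :: "'u func \<Rightarrow> 'u func \<Rightarrow> 'u func" where
  "comp_func G F = \<lparr>Src = Src F, Tgt = Tgt G,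
     omap = compose (Obj (Src F)) (omap G) (omap F),
     amap = compose (Arr (Src F)) (amap G) (amap F)\<rparr>"

definition const_func :: "('u, 'u) cat \<Rightarrow> ('u, 'u) cat \<Rightarrow> 'u \<Rightarrow> 'u func" where
  "const_func I E x =
     \<lparr>Src = I, Tgt = E, omap = (\<lambda>i\<in>Obj I. x), amap = (\<lambda>u\<in>Arr I. Ide E x)\<rparr>"

record 'u nt =
  Fdom :: "'u func"
  Fcod :: "'u func"
  cmp :: "'u \<Rightarrow> 'u"

definition is_nat :: "'u nt \<Rightarrow> 'u func \<Rightarrow> 'u func \<Rightarrow> bool" where
  "is_nat \<tau> F G \<longleftrightarrow> is_functor F \<and> is_functor G \<and> Src F = Src G \<and> Tgt F = Tgt G \<and>
     Fdom \<tau> = F \<and> Fcod \<tau> = G \<and>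
     cmp \<tau> \<in> extensional (Obj (Src F)) \<and>
     (\<forall>x\<in>Obj (Src F). cmp \<tau> x \<in> Hom (Tgt F) (omap F x) (omap G x)) \<and>
     (\<forall>f\<in>Arr (Src F). Comp (Tgt F) (cmp \<tau> (Cod (Src F) f)) (amap F f) =
                       Comp (Tgt F) (amap G f) (cmp \<tau> (Dom (Src F) f)))"

definition whisker :: "'u func \<Rightarrow> 'u nt \<Rightarrow> 'u nt" where
  "whisker H \<tau> = \<lparr>Fdom = comp_func H (Fdom \<tau>), Fcod = comp_func H (Fcod \<tau>),
     cmp = compose (Obj (Src (Fdom \<tau>))) (amap H) (cmp \<tau>)\<rparr>"

definition id_nt :: "'u func \<Rightarrow> 'u nt" where
  "id_nt F = \<lparr>Fdom = F, Fcod = F, cmp = (\<lambda>x\<in>Obj (Src F). Ide (Tgt F) (omap F x))\<rparr>"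

definition vcomp_nt :: "'u nt \<Rightarrow> 'u nt \<Rightarrow> 'u nt" where
  "vcomp_nt \<tau> \<sigma> = \<lparr>Fdom = Fdom \<sigma>, Fcod = Fcod \<tau>,
     cmp = (\<lambda>x\<in>Obj (Src (Fdom \<sigma>)). Comp (Tgt (Fdom \<sigma>)) (cmp \<tau> x) (cmp \<sigma> x))\<rparr>"

definition hcomp_nt :: "'u nt \<Rightarrow> 'u nt \<Rightarrow> 'u nt" where
  "hcomp_nt \<tau> \<sigma> =
     \<lparr>Fdom = comp_func (Fdom \<tau>) (Fdom \<sigma>), Fcod = comp_func (Fcod \<tau>) (Fcod \<sigma>),
     cmp = (\<lambda>x\<in>Obj (Src (Fdom \<sigma>)).
       Comp (Tgt (Fdom \<tau>)) (cmp \<tau> (omap (Fcod \<sigma>) x)) (amap (Fdom \<tau>) (cmp \<sigma> x)))\<rparr>"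

record 'u cone =
  vertex :: 'u
  index :: "('u, 'u) cat"
  diagram :: "'u func"
  legs :: "'u nt"

definition is_cone :: "('u, 'u) cat \<Rightarrow> 'u cone \<Rightarrow> bool" where
  "is_cone E C \<longleftrightarrow> vertex C \<in> Obj E \<and> small_category (index C) \<and>
     functor_between (diagram C) (index C) E \<and>
     is_nat (legs C) (const_func (index C) E (vertex C)) (diagram C)"

definition map_cone :: "'u func \<Rightarrow> 'u cone \<Rightarrow> 'u cone" where
  "map_cone F C = \<lparr>vertex = omap F (vertex C), index = index C,
     diagram = comp_func F (diagram C), legs = whisker F (legs C)\<rparr>"

definition limit_cone :: "('u, 'u) cat \<Rightarrow> 'u cone \<Rightarrow> bool" where
  "limit_cone E C \<longleftrightarrow> is_cone E C \<and>
     (\<forall>D. is_cone E D \<and> index D = index C \<and> diagram D = diagram C \<longrightarrow>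
        (\<exists>!u. u \<in> Hom E (vertex D) (vertex C) \<and>
              (\<forall>i\<in>Obj (index C). Comp E (cmp (legs C) i) u = cmp (legs D) i)))"

record 'u sketch =
  carrier :: "('u, 'u) cat"
  names :: "'u set"
  cones :: "'u \<Rightarrow> 'u cone"

definition limit_sketch :: "'u sketch \<Rightarrow> bool" where
  "limit_sketch S \<longleftrightarrow> small_category (carrier S) \<and> small (names S) \<and>
     cones S \<in> extensional (names S) \<and> (\<forall>\<alpha>\<in>names S. is_cone (carrier S) (cones S \<alpha>))"

definition realized :: "'u sketch \<Rightarrow> bool" where
  "realized S \<longleftrightarrow> (\<forall>\<alpha>\<in>names S. limit_cone (carrier S) (cones S \<alpha>))"

record ('o, 'm, 'c) two_cat =
  Ob :: "'o set"
  One :: "'m set"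
  Two :: "'c set"
  src1 :: "'m \<Rightarrow> 'o"
  tgt1 :: "'m \<Rightarrow> 'o"
  id1 :: "'o \<Rightarrow> 'm"
  comp1 :: "'m \<Rightarrow> 'm \<Rightarrow> 'm"
  src2 :: "'c \<Rightarrow> 'm"
  tgt2 :: "'c \<Rightarrow> 'm"
  id2 :: "'m \<Rightarrow> 'c"
  vcomp :: "'c \<Rightarrow> 'c \<Rightarrow> 'c"
  hcomp :: "'c \<Rightarrow> 'c \<Rightarrow> 'c"

definition one_cells :: "('o, 'm, 'c) two_cat \<Rightarrow> ('o, 'm) cat" where
  "one_cells K = \<lparr>Obj = Ob K, Arr = One K, Dom = src1 K, Cod = tgt1 K, Ide = id1 K, Comp = comp1 K\<rparr>"

definition vertical :: "('o, 'm, 'c) two_cat \<Rightarrow> ('m, 'c) cat" where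
  "vertical K = \<lparr>Obj = One K, Arr = Two K, Dom = src2 K, Cod = tgt2 K, Ide = id2 K, Comp = vcomp K\<rparr>"

definition horizontal :: "('o, 'm, 'c) two_cat \<Rightarrow> ('o, 'c) cat" where
  "horizontal K = \<lparr>Obj = Ob K, Arr = Two K, Dom = (\<lambda>a. src1 K (src2 K a)),
     Cod = (\<lambda>a. tgt1 K (src2 K a)), Ide = (\<lambda>x. id2 K (id1 K x)), Comp = hcomp K\<rparr>"

definition two_category :: "('o, 'm, 'c) two_cat \<Rightarrow> bool" where
  "two_category K \<longleftrightarrow>
     category (one_cells K) \<and> category (vertical K) \<and> category (horizontal K) \<and>
     (\<forall>a\<in>Two K. src1 K (tgt2 K a) = src1 K (src2 K a) \<and> tgt1 K (tgt2 K a) = tgt1 K (src2 K a)) \<and>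
     (\<forall>a\<in>Two K. \<forall>b\<in>Two K. tgt1 K (src2 K a) = src1 K (src2 K b) \<longrightarrow>
        src2 K (hcomp K b a) = comp1 K (src2 K b) (src2 K a) \<and>
        tgt2 K (hcomp K b a) = comp1 K (tgt2 K b) (tgt2 K a)) \<and>
     (\<forall>f\<in>One K. \<forall>g\<in>One K. tgt1 K f = src1 K g \<longrightarrow>
        hcomp K (id2 K g) (id2 K f) = id2 K (comp1 K g f)) \<and>
     (\<forall>a\<in>Two K. \<forall>a'\<in>Two K. \<forall>b\<in>Two K. \<forall>b'\<in>Two K.
        tgt2 K a = src2 K a' \<and> tgt2 K b = src2 K b' \<and> tgt1 K (src2 K a) = src1 K (src2 K b) \<longrightarrow>
        hcomp K (vcomp K b' b) (vcomp K a' a) = vcomp K (hcomp K b' a') (hcomp K b a))"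

definition full_sub_two_cat :: "('o, 'm, 'c) two_cat \<Rightarrow> ('o \<Rightarrow> bool) \<Rightarrow> ('o, 'm, 'c) two_cat" where
  "full_sub_two_cat K P = K\<lparr>
     Ob := {x \<in> Ob K. P x},
     One := {f \<in> One K. P (src1 K f) \<and> P (tgt1 K f)},
     Two := {a \<in> Two K. P (src1 K (src2 K a)) \<and> P (tgt1 K (src2 K a))}\<rparr>"

record ('o, 'm, 'c, 'o2, 'm2, 'c2) two_func =
  map0 :: "'o \<Rightarrow> 'o2"
  map1 :: "'m \<Rightarrow> 'm2"
  map2 :: "'c \<Rightarrow> 'c2"

definition two_functor ::
  "('o, 'm, 'c) two_cat \<Rightarrow> ('o2, 'm2, 'c2) two_cat \<Rightarrow> ('o, 'm, 'c, 'o2, 'm2, 'c2) two_func \<Rightarrow> bool"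
where
  "two_functor K L T \<longleftrightarrow> two_category K \<and> two_category L \<and>
     (\<forall>x\<in>Ob K. map0 T x \<in> Ob L) \<and>
     (\<forall>f\<in>One K. map1 T f \<in> One L \<and>
        src1 L (map1 T f) = map0 T (src1 K f) \<and> tgt1 L (map1 T f) = map0 T (tgt1 K f)) \<and>
     (\<forall>a\<in>Two K. map2 T a \<in> Two L \<and>
        src2 L (map2 T a) = map1 T (src2 K a) \<and> tgt2 L (map2 T a) = map1 T (tgt2 K a)) \<and>
     (\<forall>x\<in>Ob K. map1 T (id1 K x) = id1 L (map0 T x)) \<and>
     (\<forall>f\<in>One K. \<forall>g\<in>One K. tgt1 K f = src1 K g \<longrightarrow>
        map1 T (comp1 K g f) = comp1 L (map1 T g) (map1 T f)) \<and>
     (\<forall>f\<in>One K. map2 T (id2 K f) = id2 L (map1 T f)) \<and>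
     (\<forall>a\<in>Two K. \<forall>b\<in>Two K. tgt2 K a = src2 K b \<longrightarrow>
        map2 T (vcomp K b a) = vcomp L (map2 T b) (map2 T a)) \<and>
     (\<forall>a\<in>Two K. \<forall>b\<in>Two K. tgt1 K (src2 K a) = src1 K (src2 K b) \<longrightarrow>
        map2 T (hcomp K b a) = hcomp L (map2 T b) (map2 T a))"

text \<open>Also serves as the inclusion of a sub-2-category.\<close>

definition id_two_func :: "('o, 'm, 'c, 'o, 'm, 'c) two_func" where
  "id_two_func = \<lparr>map0 = (\<lambda>x. x), map1 = (\<lambda>f. f), map2 = (\<lambda>a. a)\<rparr>"

definition comp_two_func ::
  "('o2, 'm2, 'c2, 'o3, 'm3, 'c3) two_func \<Rightarrow> ('o, 'm, 'c, 'o2, 'm2, 'c2) two_func \<Rightarrow>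
   ('o, 'm, 'c, 'o3, 'm3, 'c3) two_func"
where
  "comp_two_func U T = \<lparr>map0 = map0 U \<circ> map0 T, map1 = map1 U \<circ> map1 T, map2 = map2 U \<circ> map2 T\<rparr>"

definition two_natural ::
  "('o, 'm, 'c) two_cat \<Rightarrow> ('o2, 'm2, 'c2) two_cat \<Rightarrow>
   ('o, 'm, 'c, 'o2, 'm2, 'c2) two_func \<Rightarrow> ('o, 'm, 'c, 'o2, 'm2, 'c2) two_func \<Rightarrow>
   ('o \<Rightarrow> 'm2) \<Rightarrow> bool"
where
  "two_natural K L T T' \<eta> \<longleftrightarrow> two_functor K L T \<and> two_functor K L T' \<and>
     (\<forall>x\<in>Ob K. \<eta> x \<in> One L \<and> src1 L (\<eta> x) = map0 T x \<and> tgt1 L (\<eta> x) = map0 T' x) \<and>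
     (\<forall>f\<in>One K. comp1 L (\<eta> (tgt1 K f)) (map1 T f) = comp1 L (map1 T' f) (\<eta> (src1 K f))) \<and>
     (\<forall>a\<in>Two K. hcomp L (id2 L (\<eta> (tgt1 K (src2 K a)))) (map2 T a) =
                 hcomp L (map2 T' a) (id2 L (\<eta> (src1 K (src2 K a)))))"

record 'u sk_mor =
  sk_dom :: "'u sketch"
  sk_cod :: "'u sketch"
  sk_func :: "'u func"
  sk_names :: "'u \<Rightarrow> 'u"

definition is_sk_mor :: "'u sk_mor \<Rightarrow> bool" where
  "is_sk_mor m \<longleftrightarrow> limit_sketch (sk_dom m) \<and> limit_sketch (sk_cod m) \<and>
     functor_between (sk_func m) (carrier (sk_dom m)) (carrier (sk_cod m)) \<and>
     sk_names m \<in> names (sk_dom m) \<rightarrow>\<^sub>E names (sk_cod m) \<and>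
     (\<forall>\<alpha>\<in>names (sk_dom m).
        map_cone (sk_func m) (cones (sk_dom m) \<alpha>) = cones (sk_cod m) (sk_names m \<alpha>))"

record 'u sk_cell =
  cell_dom :: "'u sk_mor"
  cell_cod :: "'u sk_mor"
  cell_nt :: "'u nt"

definition is_sk_cell :: "'u sk_cell \<Rightarrow> bool" where
  "is_sk_cell a \<longleftrightarrow> is_sk_mor (cell_dom a) \<and> is_sk_mor (cell_cod a) \<and>
     sk_dom (cell_dom a) = sk_dom (cell_cod a) \<and> sk_cod (cell_dom a) = sk_cod (cell_cod a) \<and>
     is_nat (cell_nt a) (sk_func (cell_dom a)) (sk_func (cell_cod a))"

definition id_sk :: "'u sketch \<Rightarrow> 'u sk_mor" where
  "id_sk S = \<lparr>sk_dom = S, sk_cod = S, sk_func = id_func (carrier S), sk_names = (\<lambda>\<alpha>\<in>names S. \<alpha>)\<rparr>"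

definition comp_sk :: "'u sk_mor \<Rightarrow> 'u sk_mor \<Rightarrow> 'u sk_mor" where
  "comp_sk n m = \<lparr>sk_dom = sk_dom m, sk_cod = sk_cod n, sk_func = comp_func (sk_func n) (sk_func m),
     sk_names = compose (names (sk_dom m)) (sk_names n) (sk_names m)\<rparr>"

definition LS :: "('u sketch, 'u sk_mor, 'u sk_cell) two_cat" where
  "LS = \<lparr>Ob = {S. limit_sketch S}, One = {m. is_sk_mor m}, Two = {a. is_sk_cell a},
     src1 = sk_dom, tgt1 = sk_cod, id1 = id_sk, comp1 = comp_sk,
     src2 = cell_dom, tgt2 = cell_cod,
     id2 = (\<lambda>m. \<lparr>cell_dom = m, cell_cod = m, cell_nt = id_nt (sk_func m)\<rparr>),
     vcomp = (\<lambda>b a. \<lparr>cell_dom = cell_dom a, cell_cod = cell_cod b,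
                      cell_nt = vcomp_nt (cell_nt b) (cell_nt a)\<rparr>),
     hcomp = (\<lambda>b a. \<lparr>cell_dom = comp_sk (cell_dom b) (cell_dom a),
                      cell_cod = comp_sk (cell_cod b) (cell_cod a),
                      cell_nt = hcomp_nt (cell_nt b) (cell_nt a)\<rparr>)\<rparr>"

definition RLS :: "('u sketch, 'u sk_mor, 'u sk_cell) two_cat" where
  "RLS = full_sub_two_cat LS realized"

definition initial :: "('o, 'm) cat \<Rightarrow> 'o \<Rightarrow> bool" where
  "initial C x \<longleftrightarrow> x \<in> Obj C \<and> (\<forall>y\<in>Obj C. \<exists>!f. f \<in> Hom C x y)"

text \<open>\<open>comm_square C f g u v\<close>: the square with left side \<open>f\<close>, right side \<open>g\<close>, top \<open>u\<close> and
  bottom \<open>v\<close>.\<close>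

definition comm_square :: "('o, 'm) cat \<Rightarrow> 'm \<Rightarrow> 'm \<Rightarrow> 'm \<Rightarrow> 'm \<Rightarrow> bool" where
  "comm_square C f g u v \<longleftrightarrow> f \<in> Arr C \<and> g \<in> Arr C \<and>
     u \<in> Hom C (Dom C f) (Dom C g) \<and> v \<in> Hom C (Cod C f) (Cod C g) \<and> Comp C v f = Comp C g u"

definition orthogonal :: "('o, 'm) cat \<Rightarrow> 'm \<Rightarrow> 'm \<Rightarrow> bool" where
  "orthogonal C f g \<longleftrightarrow> (\<forall>u v. comm_square C f g u v \<longrightarrow>
     (\<exists>!d. d \<in> Hom C (Cod C f) (Dom C g) \<and> Comp C d f = u \<and> Comp C g d = v))"

definition right_orth :: "('o, 'm) cat \<Rightarrow> 'm set \<Rightarrow> 'm set" where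
  "right_orth C H = {f \<in> Arr C. \<forall>h\<in>H. orthogonal C h f}"

definition left_orth :: "('o, 'm) cat \<Rightarrow> 'm set \<Rightarrow> 'm set" where
  "left_orth C H = {f \<in> Arr C. \<forall>h\<in>H. orthogonal C f h}"

text \<open>The arrow \<open>mid_map T f g u v\<close> is the map between the middle objects of the factorizations of \<open>f\<close> and
  \<open>g\<close> induced by the square \<open>comm_square C f g u v\<close>.\<close>

record ('o, 'm) factorization =
  mid :: "'m \<Rightarrow> 'o"
  lpart :: "'m \<Rightarrow> 'm"
  rpart :: "'m \<Rightarrow> 'm"
  mid_map :: "'m \<Rightarrow> 'm \<Rightarrow> 'm \<Rightarrow> 'm \<Rightarrow> 'm"

definition functorial_factorization ::
  "('o, 'm) cat \<Rightarrow> 'm set \<Rightarrow> 'm set \<Rightarrow> ('o, 'm) factorization \<Rightarrow> bool"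
where
  "functorial_factorization C L R T \<longleftrightarrow>
     (\<forall>f\<in>Arr C. mid T f \<in> Obj C \<and>
        lpart T f \<in> L \<inter> Hom C (Dom C f) (mid T f) \<and>
        rpart T f \<in> R \<inter> Hom C (mid T f) (Cod C f) \<and>
        Comp C (rpart T f) (lpart T f) = f) \<and>
     (\<forall>f g u v. comm_square C f g u v \<longrightarrow>
        mid_map T f g u v \<in> Hom C (mid T f) (mid T g) \<and>
        Comp C (mid_map T f g u v) (lpart T f) = Comp C (lpart T g) u \<and>
        Comp C (rpart T g) (mid_map T f g u v) = Comp C v (rpart T f)) \<and>
     (\<forall>f\<in>Arr C. mid_map T f f (Ide C (Dom C f)) (Ide C (Cod C f)) = Ide C (mid T f)) \<and>
     (\<forall>f g h u v u' v'. comm_square C f g u v \<and> comm_square C g h u' v' \<longrightarrow>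
        mid_map T f h (Comp C u' u) (Comp C v' v) =
        Comp C (mid_map T g h u' v') (mid_map T f g u v))"

text \<open>The category whose objects are the elements \<open>x\<close> of \<open>X\<close>, each with an underlying small
  category \<open>B x\<close>, and whose arrows are the functors satisfying \<open>P\<close> between these.\<close>

definition structured_cat ::
  "'x set \<Rightarrow> ('x \<Rightarrow> ('u, 'u) cat) \<Rightarrow> ('x \<Rightarrow> 'x \<Rightarrow> 'u func \<Rightarrow> bool) \<Rightarrow> ('x, 'x \<times> 'x \<times> 'u func) cat"
where
  "structured_cat X B P = \<lparr>
     Obj = X,
     Arr = {(x, y, H). x \<in> X \<and> y \<in> X \<and> functor_between H (B x) (B y) \<and> P x y H},
     Dom = (\<lambda>(x, y, H). x),
     Cod = (\<lambda>(x, y, H). y),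
     Ide = (\<lambda>x. (x, x, id_func (B x))),
     Comp = (\<lambda>(y', z, K) (x, y, H). (x, z, comp_func K H))\<rparr>"

text \<open>An object (D, F) of the coslice category is represented by the functor F, whose target
  is D.\<close>

type_synonym 'u under_mor = "'u func \<times> 'u func \<times> 'u func"

definition coslice :: "('u, 'u) cat \<Rightarrow> ('u func, 'u under_mor) cat" where
  "coslice E = structured_cat {F. is_functor F \<and> Src F = E \<and> small_category (Tgt F)} Tgt
     (\<lambda>F F' H. comp_func H F = F')"

text \<open>The category of triples \<open>(D, F, \<psi>)\<close>; its initial objects are the \<open>(E[y;\<alpha>], i, \<gamma>)\<close>.\<close>

definition triples :: "'u sketch \<Rightarrow> 'u \<Rightarrow> 'u \<Rightarrow> ('u func \<times> 'u nt, ('u func \<times> 'u nt) \<times> ('u func \<times> 'u nt) \<times> 'u func) cat"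
where
  "triples S y \<alpha> = (let E = carrier S; C = cones S \<alpha> in
     structured_cat
       {(F, \<psi>). F \<in> Obj (coslice E) \<and>
          is_nat \<psi> (comp_func F (const_func (index C) E y)) (comp_func F (diagram C))}
       (\<lambda>(F, \<psi>). Tgt F)
       (\<lambda>(F, \<psi>) (F', \<psi>') H. comp_func H F = F' \<and> whisker H \<psi> = \<psi>'))"

text \<open>The category of functors out of \<open>E[y;\<alpha>]\<close> together with an arrow \<open>f : y \<rightarrow> x\<^sub>\<alpha>\<close> in the
  target such that \<open>\<delta>\<^sub>i \<circ> f = \<gamma>\<^sub>i\<close>; its initial objects are the free adjunctions of such an arrow.\<close>

definition adjunctions :: "'u sketch \<Rightarrow> 'u \<Rightarrow> 'u \<Rightarrow> 'u func \<Rightarrow> 'u nt \<Rightarrow> ('u func \<times> 'u, ('u func \<times> 'u) \<times> ('u func \<times> 'u) \<times> 'u func) cat"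
where
  "adjunctions S y \<alpha> i \<gamma> = (let C = cones S \<alpha> in
     structured_cat
       {(G, f). G \<in> Obj (coslice (Tgt i)) \<and>
          f \<in> Hom (Tgt G) (omap G (omap i y)) (omap G (omap i (vertex C))) \<and>
          (\<forall>j\<in>Obj (index C).
             Comp (Tgt G) (amap G (amap i (cmp (legs C) j))) f = amap G (cmp \<gamma> j))}
       (\<lambda>(G, f). Tgt G)
       (\<lambda>(G, f) (G', f') H. comp_func H G = G' \<and> amap H f = f'))"

text \<open>The maps \<open>r : E[y;\<alpha>] \<rightarrow> E[y;\<alpha>]'\<close> under \<open>E\<close>. Since \<open>E[y;\<alpha>]\<close> and \<open>E[y;\<alpha>]'\<close> are
  only determined up to unique isomorphism by their universal properties, \<open>Xi\<close> contains the maps for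
  all representatives; this does not affect orthogonality.\<close>

definition Xi :: "'u sketch \<Rightarrow> 'u under_mor set" where
  "Xi S = {(i, comp_func r i, r) | i r.
     \<exists>y\<in>Obj (carrier S). \<exists>\<alpha>\<in>names S. \<exists>\<gamma> f.
       initial (triples S y \<alpha>) (i, \<gamma>) \<and> initial (adjunctions S y \<alpha> i \<gamma>) (r, f)}"

definition Rcls :: "'u sketch \<Rightarrow> 'u under_mor set" where
  "Rcls S = right_orth (coslice (carrier S)) (Xi S)"

definition Lcls :: "'u sketch \<Rightarrow> 'u under_mor set" where
  "Lcls S = left_orth (coslice (carrier S)) (Rcls S)"

definition terminal_cat :: "('u, 'u) cat" where
  "terminal_cat = \<lparr>Obj = {undefined}, Arr = {undefined}, Dom = (\<lambda>_. undefined),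
     Cod = (\<lambda>_. undefined), Ide = (\<lambda>_. undefined), Comp = (\<lambda>_ _. undefined)\<rparr>"

text \<open>The unique arrow of the coslice from \<open>(E, id)\<close> to the terminal object.\<close>

definition bang :: "('u, 'u) cat \<Rightarrow> 'u under_mor" where
  "bang E = (let K = const_func E terminal_cat undefined in (id_func E, K, K))"

text \<open>A choice, for every limit sketch, of a functorial factorization on its coslice category.\<close>

type_synonym 'u fact_choice = "'u sketch \<Rightarrow> ('u func, 'u under_mor) factorization"

definition Fib :: "'u fact_choice \<Rightarrow> 'u sketch \<Rightarrow> ('u, 'u) cat" where
  "Fib fac S = Tgt (mid (fac S) (bang (carrier S)))"

text \<open>The functor underlying the left factor of the arrow above.\<close>

definition Lbang :: "'u fact_choice \<Rightarrow> 'u sketch \<Rightarrow> 'u func" where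
  "Lbang fac S = snd (snd (lpart (fac S) (bang (carrier S))))"

definition free_sketch :: "'u fact_choice \<Rightarrow> 'u sketch \<Rightarrow> 'u sketch" where
  "free_sketch fac S = \<lparr>carrier = Fib fac S, names = names S,
     cones = (\<lambda>\<alpha>\<in>names S. map_cone (Lbang fac S) (cones S \<alpha>))\<rparr>"

definition unit_sk :: "'u fact_choice \<Rightarrow> 'u sketch \<Rightarrow> 'u sk_mor" where
  "unit_sk fac S = \<lparr>sk_dom = S, sk_cod = free_sketch fac S, sk_func = Lbang fac S,
     sk_names = (\<lambda>\<alpha>\<in>names S. \<alpha>)\<rparr>"

end

theory Submission
  imports Defs
begin

text \<open>
  Call a functor \<open>F\<close> out of \<open>E\<close> sharp if it sends the specified cones to cones that have the universal
  property of a limit with respect to vertices of the form \<open>F y\<close>. Unwinding the initial objects that define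
  \<open>\<Xi>\<close> shows that the map from a sharp \<open>F\<close> to the terminal object of the coslice lies in \<open>\<R>\<close>, and
  conversely, since these initial objects exist, that \<open>L : E \<rightarrow> Fib(!)\<close> is sharp. So \<open>L\<close> is the universal
  sharp functor. Applied to the codiscrete category on the objects of \<open>E\<close>, this shows that \<open>L\<close> is
  injective on objects; applied to subcategories of \<open>Fib(!)\<close>, it gives an induction principle for the
  arrows of \<open>Fib(!)\<close>, in particular surjectivity on objects. Hence the cones in \<open>Fib(!)\<close> are limits, a morphism of
  sketches extends uniquely to \<open>Fib(!)\<close>, and a 2-cell extends because the arrows at which its
  components are natural form a subcategory to which the induction principle applies. All the 2-functor
  and naturality equations follow from uniqueness.
\<close>

subsection \<open>Small sets\<close>

text \<open>\<open>Xi\<close> ranges over all initial representatives. Without any representative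
  for some pair (y, \<alpha>), orthogonality would say nothing about that pair, and sharpness of L
  could not be derived. So the free categories must really be constructed, with arrows coded in
  \<open>'u\<close>; this is what the cardinality lemmas are for. No explicit description of the
  arrows of Fib(!) is available, so every statement about them goes through the universal property.
  Injectivity of L on objects is needed because a 2-cell prescribes a component for each x of E: if
  L x = L x' for distinct x and x', two different components could be demanded at one object.
  Surjectivity matters twice: sharpness tests only vertices of the form L y, and the extended 2-cell
  must have a component at every object. Equalities of functors, cones and cells are strict, so the
  proof also checks extensionality throughout.\<close>

context
  assumes univ: "universe TYPE('u)"
begin

lemma infinite_universe: "infinite (UNIV :: 'u set)"
proof -
  obtain A :: "'u set" where "infinite A"
    using univ unfolding universe_def by blast
  then show ?thesis by (meson finite_subset subset_UNIV)
qed

text \<open>The given infinite small set is already strictly below the universe, and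
  \<open>nat\<close> embeds in it. This is the uncountability that allows countable unions of stages
  in \<open>lesspoll_generated\<close>.\<close>

lemma nat_lesspoll_universe: "(UNIV :: nat set) \<prec> (UNIV :: 'u set)"
proof -
  obtain A :: "'u set" where "infinite A" "A \<prec> (UNIV :: 'u set)"
    using univ unfolding universe_def small_def by blast
  then show ?thesis
    using infinite_le_lepoll lesspoll_trans1 by blast
qed

lemma lesspoll_image: "A \<prec> (UNIV :: 'u set) \<Longrightarrow> f ` A \<prec> (UNIV :: 'u set)"
  using image_lepoll lesspoll_trans1 by blast

text \<open>Pair coding inside \<open>'u\<close>. It makes unions disjoint in
  \<open>lesspoll_UN\<close> and codes the arrows of the codiscrete category.\<close>

lemma ex_inj_pair: "\<exists>f :: 'u \<times> 'u \<Rightarrow> 'u. inj f"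
proof -
  have "(UNIV :: ('u \<times> 'u) set) \<approx> (UNIV :: 'u set)"
    using card_of_Times_same_infinite[OF infinite_universe] by (simp add: eqpoll_iff_card_of_ordIso)
  then show ?thesis
    by (meson bij_betw_def eqpoll_def)
qed

text \<open>The closure properties in \<open>universe\<close> concern subsets of \<open>'u\<close>
  only. Arrows of free categories live in other types, so sets there are first presented as images
  of small sets.\<close>

lemma lesspoll_transfer:
  assumes "A \<prec> (UNIV :: 'u set)"
  obtains f :: "'u \<Rightarrow> 'a" and B where "A = f ` B" "small B"
proof -
  obtain g :: "'a \<Rightarrow> 'u" where g: "inj_on g A"
    using assms unfolding lesspoll_def lepoll_def by blast
  then have "A = the_inv_into A g ` (g ` A)"
    by (simp add: image_image the_inv_into_f_f)
  moreover have "small (g ` A)"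
    unfolding small_def using assms by (rule lesspoll_image)
  ultimately show ?thesis ..
qed

lemma lesspoll_UN:
  fixes B :: "'i \<Rightarrow> 'a set"
  assumes "I \<prec> (UNIV :: 'u set)" and B: "\<And>i. i \<in> I \<Longrightarrow> B i \<prec> (UNIV :: 'u set)"
  shows "(\<Union>i\<in>I. B i) \<prec> (UNIV :: 'u set)"
proof -
  obtain f :: "'u \<Rightarrow> 'i" and J where J: "I = f ` J" "small J"
    by (rule lesspoll_transfer[OF assms(1)])
  have "\<exists>g C. B (f j) = g ` C \<and> small (C :: 'u set)" if "j \<in> J" for j
    by (rule lesspoll_transfer[OF B[of "f j"]]) (use J that in auto)
  then obtain g C where gC: "\<And>j. j \<in> J \<Longrightarrow> B (f j) = g j ` C j \<and> small (C j :: 'u set)"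
    by metis
  obtain p :: "'u \<times> 'u \<Rightarrow> 'u" where p: "inj p"
    using ex_inj_pair by blast
  \<comment> \<open>Each index j has its own decoding map \<open>g j\<close>, so a code must
    remember j as well as c.\<close>
  have "small ((\<lambda>c. p (j, c)) ` C j)" if "j \<in> J" for j
    using gC[OF that] lesspoll_image[of "C j"] by (simp add: small_def)
  then have "small (\<Union>j\<in>J. (\<lambda>c. p (j, c)) ` C j)"
    using univ J(2) by (simp add: universe_def)
  moreover have "(\<Union>i\<in>I. B i) = (\<lambda>c. case inv p c of (j, c) \<Rightarrow> g j c) ` (\<Union>j\<in>J. (\<lambda>c. p (j, c)) ` C j)"
    using gC by (simp add: J(1) image_UN image_image inv_f_f[OF p])
  ultimately show ?thesis
    unfolding small_def by (simp only: lesspoll_image)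
qed

lemma lesspoll_Times:
  assumes "A \<prec> (UNIV :: 'u set)" "B \<prec> (UNIV :: 'u set)"
  shows "A \<times> B \<prec> (UNIV :: 'u set)"
proof -
  have "A \<times> B = (\<Union>a\<in>A. Pair a ` B)" by auto
  moreover have "(\<Union>a\<in>A. Pair a ` B) \<prec> (UNIV :: 'u set)"
    by (intro lesspoll_UN assms lesspoll_image)
  ultimately show ?thesis by simp
qed

lemma lesspoll_Un:
  assumes "A \<prec> (UNIV :: 'u set)" "B \<prec> (UNIV :: 'u set)"
  shows "A \<union> B \<prec> (UNIV :: 'u set)"
proof -
  have "A \<union> B = (\<Union>b\<in>UNIV. if b then A else B)" by auto
  moreover have "(\<Union>b\<in>UNIV. if b then A else B) \<prec> (UNIV :: 'u set)"
  proof (rule lesspoll_UN)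
    show "(UNIV :: bool set) \<prec> (UNIV :: 'u set)"
      by (simp add: finite_lesspoll_infinite infinite_universe)
  qed (use assms in simp)
  ultimately show ?thesis by simp
qed

text \<open>The operation is binary, so closing the generators under it takes only countably many
  stages, each of them small. The operation \<open>c\<close> is total: for arrows it is applied to
  non-composable pairs as well, which only enlarges the bound.\<close>

lemma lesspoll_generated:
  assumes gens: "A \<prec> (UNIV :: 'u set)"
    and ind: "\<And>S. A \<subseteq> S \<Longrightarrow> (\<And>x y. x \<in> S \<Longrightarrow> y \<in> S \<Longrightarrow> c x y \<in> S) \<Longrightarrow> T \<subseteq> S"
  shows "T \<prec> (UNIV :: 'u set)"
proof -
  define G where "G = rec_nat A (\<lambda>_ S. S \<union> case_prod c ` (S \<times> S))"
  have G0: "G 0 = A" and GS: "G (Suc n) = G n \<union> case_prod c ` (G n \<times> G n)" for n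
    by (simp_all add: G_def)
  have "G n \<prec> (UNIV :: 'u set)" for n
    by (induction n) (simp_all add: G0 GS gens lesspoll_Un lesspoll_image lesspoll_Times)
  then have "(\<Union>n. G n) \<prec> (UNIV :: 'u set)"
    by (intro lesspoll_UN nat_lesspoll_universe)
  moreover have "T \<subseteq> (\<Union>n. G n)"
  proof (rule ind)
    show "A \<subseteq> (\<Union>n. G n)" using G0 by blast
    fix x y assume "x \<in> (\<Union>n. G n)" "y \<in> (\<Union>n. G n)"
    then obtain m n where "x \<in> G m" "y \<in> G n" by blast
    \<comment> \<open>The stages increase, so both arguments lie in a common one and their product
      in the next.\<close>
    moreover have "G i \<subseteq> G j" if "i \<le> j" for i j
      using that by (rule lift_Suc_mono_le[rotated]) (simp add: GS)
    ultimately have "x \<in> G (max m n)" "y \<in> G (max m n)"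
      by (meson max.cobounded1 max.cobounded2 subsetD)+
    then have "c x y \<in> G (Suc (max m n))" unfolding GS by (metis (no_types) UnI2 SigmaI case_prod_conv image_eqI)
    then show "c x y \<in> (\<Union>n. G n)" by blast
  qed
  ultimately show ?thesis
    using subset_imp_lepoll lesspoll_trans1 by blast
qed

end

subsection \<open>Functors and natural transformations\<close>

lemma Hom_iff: "f \<in> Hom C x y \<longleftrightarrow> f \<in> Arr C \<and> Dom C f = x \<and> Cod C f = y"
  by (simp add: Hom_def)

lemma arr_Hom: "f \<in> Arr C \<Longrightarrow> f \<in> Hom C (Dom C f) (Cod C f)"
  by (simp add: Hom_iff)

lemma categoryI:
  assumes "\<And>f x y. f \<in> Hom C x y \<Longrightarrow> x \<in> Obj C \<and> y \<in> Obj C"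
    and "\<And>x. x \<in> Obj C \<Longrightarrow> Ide C x \<in> Hom C x x"
    and "\<And>f g x y z. f \<in> Hom C x y \<Longrightarrow> g \<in> Hom C y z \<Longrightarrow> Comp C g f \<in> Hom C x z"
    and "\<And>f x y. f \<in> Hom C x y \<Longrightarrow> Comp C f (Ide C x) = f \<and> Comp C (Ide C y) f = f"
    and "\<And>f g h x y z w. f \<in> Hom C x y \<Longrightarrow> g \<in> Hom C y z \<Longrightarrow> h \<in> Hom C z w \<Longrightarrow>
      Comp C h (Comp C g f) = Comp C (Comp C h g) f"
  shows "category C"
  using assms unfolding category_def Hom_def by simp

lemma
  assumes "category C"
  shows Hom_dom: "f \<in> Hom C x y \<Longrightarrow> x \<in> Obj C"
    and Hom_cod: "f \<in> Hom C x y \<Longrightarrow> y \<in> Obj C"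
    and Hom_ide: "x \<in> Obj C \<Longrightarrow> Ide C x \<in> Hom C x x"
    and Hom_comp: "f \<in> Hom C x y \<Longrightarrow> g \<in> Hom C y z \<Longrightarrow> Comp C g f \<in> Hom C x z"
    and comp_ide: "f \<in> Hom C x y \<Longrightarrow> Comp C f (Ide C x) = f"
    and ide_comp: "f \<in> Hom C x y \<Longrightarrow> Comp C (Ide C y) f = f"
    and comp_assoc: "f \<in> Hom C x y \<Longrightarrow> g \<in> Hom C y z \<Longrightarrow> h \<in> Hom C z w \<Longrightarrow>
      Comp C h (Comp C g f) = Comp C (Comp C h g) f"
  using assms unfolding category_def Hom_def by auto

lemma small_category_category: "small_category C \<Longrightarrow> category C"
  by (simp add: small_category_def)

lemma functor_betweenI:
  assumes "category C" "category D" "Src F = C" "Tgt F = D"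
    and "omap F \<in> extensional (Obj C)" "amap F \<in> extensional (Arr C)"
    and "\<And>x. x \<in> Obj C \<Longrightarrow> omap F x \<in> Obj D"
    and "\<And>f x y. f \<in> Hom C x y \<Longrightarrow> amap F f \<in> Hom D (omap F x) (omap F y)"
    and "\<And>x. x \<in> Obj C \<Longrightarrow> amap F (Ide C x) = Ide D (omap F x)"
    and "\<And>f g x y z. f \<in> Hom C x y \<Longrightarrow> g \<in> Hom C y z \<Longrightarrow>
      amap F (Comp C g f) = Comp D (amap F g) (amap F f)"
  shows "functor_between F C D"
  using assms unfolding functor_between_def is_functor_def Hom_def PiE_def by simp

lemma
  assumes "functor_between F C D"
  shows functor_Src: "Src F = C"
    and functor_Tgt: "Tgt F = D"
    and functor_Src_cat: "category C"
    and functor_Tgt_cat: "category D"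
    and functor_obj: "x \<in> Obj C \<Longrightarrow> omap F x \<in> Obj D"
    and functor_arr: "f \<in> Arr C \<Longrightarrow> amap F f \<in> Arr D"
    and functor_Hom: "f \<in> Hom C x y \<Longrightarrow> amap F f \<in> Hom D (omap F x) (omap F y)"
    and functor_ide: "x \<in> Obj C \<Longrightarrow> amap F (Ide C x) = Ide D (omap F x)"
    and functor_comp: "f \<in> Hom C x y \<Longrightarrow> g \<in> Hom C y z \<Longrightarrow>
      amap F (Comp C g f) = Comp D (amap F g) (amap F f)"
    and functor_omap_ext: "omap F \<in> extensional (Obj C)"
    and functor_amap_ext: "amap F \<in> extensional (Arr C)"
  using assms unfolding functor_between_def is_functor_def Hom_def PiE_def by auto

text \<open>Extensionality makes agreement on objects and arrows an equality of records. Through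
  this lemma and \<open>nat_eqI\<close>, uniqueness statements become strict equations.\<close>

lemma functor_eqI:
  assumes "functor_between F C D" "functor_between G C D"
    and "\<And>x. x \<in> Obj C \<Longrightarrow> omap F x = omap G x"
    and "\<And>f. f \<in> Arr C \<Longrightarrow> amap F f = amap G f"
  shows "F = G"
proof -
  have "omap F = omap G" "amap F = amap G"
    using assms by (blast intro: extensionalityI functor_omap_ext functor_amap_ext)+
  then show ?thesis
    using functor_Src functor_Tgt assms(1,2) by (metis func.equality old.unit.exhaust)
qed

lemma comp_func_simps [simp]:
  "Src (comp_func G F) = Src F" "Tgt (comp_func G F) = Tgt G"
  "x \<in> Obj (Src F) \<Longrightarrow> omap (comp_func G F) x = omap G (omap F x)"
  "f \<in> Arr (Src F) \<Longrightarrow> amap (comp_func G F) f = amap G (amap F f)"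
  by (simp_all add: comp_func_def compose_def)

lemma
  assumes "functor_between F C D"
  shows comp_func_omap: "x \<in> Obj C \<Longrightarrow> omap (comp_func G F) x = omap G (omap F x)"
    and comp_func_amap: "f \<in> Arr C \<Longrightarrow> amap (comp_func G F) f = amap G (amap F f)"
  using functor_Src[OF assms] by simp_all

lemma comp_func_between:
  assumes F: "functor_between F A B" and G: "functor_between G B C"
  shows "functor_between (comp_func G F) A C"
proof (rule functor_betweenI)
  note [simp] = functor_Src[OF F] functor_Tgt[OF G]
  show "category A" "category C"
    using F G by (auto intro: functor_Src_cat functor_Tgt_cat)
  show "omap (comp_func G F) \<in> extensional (Obj A)" "amap (comp_func G F) \<in> extensional (Arr A)"
    by (simp_all add: comp_func_def)
  show "amap (comp_func G F) f \<in> Hom C (omap (comp_func G F) x) (omap (comp_func G F) y)"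
    if f: "f \<in> Hom A x y" for f x y
    using functor_Hom[OF G functor_Hom[OF F f]] f Hom_dom[OF functor_Src_cat[OF F] f]
      Hom_cod[OF functor_Src_cat[OF F] f] by (simp add: Hom_iff)
  show "amap (comp_func G F) (Ide A x) = Ide C (omap (comp_func G F) x)" if "x \<in> Obj A" for x
    using that Hom_ide[OF functor_Src_cat[OF F] that] functor_ide[OF F that]
      functor_ide[OF G functor_obj[OF F that]] by (simp add: Hom_iff)
  show "amap (comp_func G F) (Comp A g f) =
      Comp C (amap (comp_func G F) g) (amap (comp_func G F) f)"
    if "f \<in> Hom A x y" "g \<in> Hom A y z" for f g x y z
    using that Hom_comp[OF functor_Src_cat[OF F] that] functor_comp[OF F that]
      functor_comp[OF G functor_Hom[OF F that(1)] functor_Hom[OF F that(2)]]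
    by (simp add: Hom_iff)
qed (use F G in \<open>auto simp: functor_Src functor_Tgt functor_obj\<close>)

lemma comp_func_assoc:
  assumes "functor_between F A B" "functor_between G B C" "functor_between H C D"
  shows "comp_func H (comp_func G F) = comp_func (comp_func H G) F"
proof (rule functor_eqI)
  show "functor_between (comp_func H (comp_func G F)) A D"
    "functor_between (comp_func (comp_func H G) F) A D"
    using assms comp_func_between by blast+
qed (use assms in \<open>simp_all add: functor_Src functor_obj functor_arr\<close>)

lemma id_func_simps [simp]:
  "Src (id_func C) = C" "Tgt (id_func C) = C"
  "x \<in> Obj C \<Longrightarrow> omap (id_func C) x = x" "f \<in> Arr C \<Longrightarrow> amap (id_func C) f = f"
  by (simp_all add: id_func_def)

lemma id_func_between:
  assumes C: "category C"
  shows "functor_between (id_func C) C C"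
proof (rule functor_betweenI)
  show "omap (id_func C) \<in> extensional (Obj C)" "amap (id_func C) \<in> extensional (Arr C)"
    by (simp_all add: id_func_def)
  show "amap (id_func C) f \<in> Hom C (omap (id_func C) x) (omap (id_func C) y)"
    if "f \<in> Hom C x y" for f x y
    using that Hom_dom[OF C that] Hom_cod[OF C that] by (simp add: Hom_iff)
  show "amap (id_func C) (Ide C x) = Ide C (omap (id_func C) x)" if "x \<in> Obj C" for x
    using that Hom_ide[OF C that] by (simp add: Hom_iff)
  show "amap (id_func C) (Comp C g f) = Comp C (amap (id_func C) g) (amap (id_func C) f)"
    if "f \<in> Hom C x y" "g \<in> Hom C y z" for f g x y z
    using that Hom_comp[OF C that] by (simp add: Hom_iff)
qed (use C in simp_all)

lemma
  assumes "functor_between F C D"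
  shows comp_func_id: "comp_func F (id_func C) = F"
    and id_comp_func: "comp_func (id_func D) F = F"
proof -
  have "functor_between (comp_func F (id_func C)) C D" "functor_between (comp_func (id_func D) F) C D"
    using assms by (blast intro: comp_func_between id_func_between functor_Src_cat functor_Tgt_cat)+
  then show "comp_func F (id_func C) = F" "comp_func (id_func D) F = F"
    using assms by (auto intro!: functor_eqI simp: functor_Src functor_obj functor_arr)
qed

lemma const_func_simps [simp]:
  "Src (const_func I E x) = I" "Tgt (const_func I E x) = E"
  "i \<in> Obj I \<Longrightarrow> omap (const_func I E x) i = x" "u \<in> Arr I \<Longrightarrow> amap (const_func I E x) u = Ide E x"
  by (simp_all add: const_func_def)

lemma const_func_between:
  assumes "category I" "category E" "x \<in> Obj E"
  shows "functor_between (const_func I E x) I E"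
proof (rule functor_betweenI)
  show "omap (const_func I E x) \<in> extensional (Obj I)" "amap (const_func I E x) \<in> extensional (Arr I)"
    by (simp_all add: const_func_def)
  show "amap (const_func I E x) f \<in> Hom E (omap (const_func I E x) i) (omap (const_func I E x) j)"
    if "f \<in> Hom I i j" for f i j
    using that assms Hom_dom Hom_cod Hom_ide by (metis const_func_simps(3,4) Hom_iff)
  show "amap (const_func I E x) (Ide I i) = Ide E (omap (const_func I E x) i)" if "i \<in> Obj I" for i
    using that assms Hom_ide by (metis const_func_simps(3,4) Hom_iff)
  show "amap (const_func I E x) (Comp I g f) =
      Comp E (amap (const_func I E x) g) (amap (const_func I E x) f)"
    if "f \<in> Hom I i j" "g \<in> Hom I j k" for f g i j k
    using that assms Hom_comp Hom_ide ide_comp by (metis const_func_simps(4) Hom_iff)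
qed (use assms in auto)

text \<open>An image cone has legs starting at a composite with a constant functor, whereas
  \<open>is_cone\<close> asks for the constant functor at the image vertex itself. The two are
  equal, not merely isomorphic.\<close>

lemma comp_const_func:
  assumes I: "category I" and F: "functor_between F E D" and x: "x \<in> Obj E"
  shows "comp_func F (const_func I E x) = const_func I D (omap F x)"
proof (rule functor_eqI)
  show "functor_between (comp_func F (const_func I E x)) I D"
    using const_func_between[OF I functor_Src_cat[OF F] x] F by (rule comp_func_between)
  show "functor_between (const_func I D (omap F x)) I D"
    using I functor_Tgt_cat[OF F] functor_obj[OF F x] by (rule const_func_between)
qed (use functor_ide[OF F x] in simp_all)

lemma natI:
  assumes "functor_between F C D" "functor_between G C D" "Fdom \<tau> = F" "Fcod \<tau> = G"
    and "cmp \<tau> \<in> extensional (Obj C)"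
    and "\<And>x. x \<in> Obj C \<Longrightarrow> cmp \<tau> x \<in> Hom D (omap F x) (omap G x)"
    and "\<And>f x y. f \<in> Hom C x y \<Longrightarrow> Comp D (cmp \<tau> y) (amap F f) = Comp D (amap G f) (cmp \<tau> x)"
  shows "is_nat \<tau> F G"
  using assms unfolding is_nat_def functor_between_def Hom_def by auto

lemma nat_functors:
  assumes "is_nat \<tau> F G"
  shows "functor_between F (Src F) (Tgt F)" "functor_between G (Src F) (Tgt F)"
    "Fdom \<tau> = F" "Fcod \<tau> = G" "cmp \<tau> \<in> extensional (Obj (Src F))"
  using assms unfolding is_nat_def functor_between_def by auto

lemma
  assumes "is_nat \<tau> F G" "functor_between F C D"
  shows nat_cod_functor: "functor_between G C D"
    and nat_Hom: "x \<in> Obj C \<Longrightarrow> cmp \<tau> x \<in> Hom D (omap F x) (omap G x)"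
    and nat_naturality: "f \<in> Hom C x y \<Longrightarrow>
      Comp D (cmp \<tau> y) (amap F f) = Comp D (amap G f) (cmp \<tau> x)"
  using assms unfolding is_nat_def functor_between_def Hom_def by auto

lemma nat_eqI:
  assumes "is_nat \<tau> F G" "is_nat \<sigma> F G" "functor_between F C D"
    and "\<And>x. x \<in> Obj C \<Longrightarrow> cmp \<tau> x = cmp \<sigma> x"
  shows "\<tau> = \<sigma>"
proof -
  have "cmp \<tau> = cmp \<sigma>"
    using nat_functors(5)[OF assms(1)] nat_functors(5)[OF assms(2)] assms(4) functor_Src[OF assms(3)]
    by (metis extensionalityI)
  then show ?thesis
    using nat_functors(3,4) assms(1,2) by (metis nt.equality old.unit.exhaust)
qed

lemma is_nat_whisker:
  assumes \<tau>: "is_nat \<tau> F G" and F: "functor_between F C D" and H: "functor_between H D D'"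
  shows "is_nat (whisker H \<tau>) (comp_func H F) (comp_func H G)"
proof (rule natI)
  note G = nat_cod_functor[OF \<tau> F]
  note [simp] = functor_Src[OF F] functor_Src[OF G] nat_functors(3,4)[OF \<tau>]
  show "functor_between (comp_func H F) C D'" "functor_between (comp_func H G) C D'"
    using F G H comp_func_between by blast+
  show "cmp (whisker H \<tau>) x \<in> Hom D' (omap (comp_func H F) x) (omap (comp_func H G) x)"
    if "x \<in> Obj C" for x
    using that functor_Hom[OF H nat_Hom[OF \<tau> F that]] by (simp add: whisker_def compose_def)
  show "Comp D' (cmp (whisker H \<tau>) y) (amap (comp_func H F) f) =
      Comp D' (amap (comp_func H G) f) (cmp (whisker H \<tau>) x)" if f: "f \<in> Hom C x y" for f x y
  proof -
    have xy: "x \<in> Obj C" "y \<in> Obj C"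
      using Hom_dom[OF functor_Src_cat[OF F] f] Hom_cod[OF functor_Src_cat[OF F] f] by simp_all
    show ?thesis
      using f xy functor_comp[OF H functor_Hom[OF F f] nat_Hom[OF \<tau> F xy(2)]]
        functor_comp[OF H nat_Hom[OF \<tau> F xy(1)] functor_Hom[OF G f]] nat_naturality[OF \<tau> F f]
      by (simp add: whisker_def compose_def Hom_iff)
  qed
qed (use nat_functors(3,4)[OF \<tau>] functor_Src[OF F] in \<open>simp_all add: whisker_def\<close>)

lemma whisker_cmp:
  "\<lbrakk>is_nat \<tau> F G; functor_between F C D; x \<in> Obj C\<rbrakk> \<Longrightarrow> cmp (whisker H \<tau>) x = amap H (cmp \<tau> x)"
  using nat_functors(3) functor_Src by (fastforce simp: whisker_def compose_def)

subsection \<open>Free adjunction of arrows\<close>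

text \<open>
  The category freely generated by \<open>E\<close> and a set \<open>Q\<close> of new arrows among all the models in a class
  \<open>Mo\<close>. It is the subcategory generated by \<open>E\<close> and \<open>Q\<close> of the product of all models: an arrow
  consists of its domain, its codomain and its value in each model. The index set \<open>Mo\<close> of this
  product is large, but the arrows are generated by a small set, hence can be encoded in \<open>'u\<close>.
\<close>

locale adjoining =
  fixes E :: "('u, 'u) cat" and Q :: "'u set" and s t :: "'u \<Rightarrow> 'u"
    and Mo :: "('u func \<times> ('u \<Rightarrow> 'u)) set"
  assumes univ: "universe TYPE('u)"
    and E: "small_category E"
    and Q: "small Q"
    and ends: "\<And>q. q \<in> Q \<Longrightarrow> s q \<in> Obj E \<and> t q \<in> Obj E"
    and model: "\<And>F p. (F, p) \<in> Mo \<Longrightarrow> functor_between F E (Tgt F) \<and>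
      (\<forall>q\<in>Q. p q \<in> Hom (Tgt F) (omap F (s q)) (omap F (t q)))"
begin

type_synonym (in -) 'v arrow = "'v \<times> 'v \<times> ('v func \<times> ('v \<Rightarrow> 'v) \<Rightarrow> 'v)"

abbreviation (in -) source :: "'v arrow \<Rightarrow> 'v" where "source a \<equiv> fst a"
abbreviation (in -) target :: "'v arrow \<Rightarrow> 'v" where "target a \<equiv> fst (snd a)"
abbreviation (in -) val :: "'v arrow \<Rightarrow> 'v func \<times> ('v \<Rightarrow> 'v) \<Rightarrow> 'v" where "val a \<equiv> snd (snd a)"

text \<open>The ends are stored separately, because values in the models do not determine them when
  \<open>Mo\<close> is empty or a model identifies objects.\<close>

definition old :: "'u \<Rightarrow> 'u arrow" where
  "old e = (Dom E e, Cod E e, \<lambda>M\<in>Mo. amap (fst M) e)"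

definition new :: "'u \<Rightarrow> 'u arrow" where
  "new q = (s q, t q, \<lambda>M\<in>Mo. snd M q)"

definition mult :: "'u arrow \<Rightarrow> 'u arrow \<Rightarrow> 'u arrow" where
  "mult b a = (source a, target b, \<lambda>M\<in>Mo. Comp (Tgt (fst M)) (val b M) (val a M))"

inductive_set arrows :: "'u arrow set" where
  old: "e \<in> Arr E \<Longrightarrow> old e \<in> arrows"
| new: "q \<in> Q \<Longrightarrow> new q \<in> arrows"
| mult: "a \<in> arrows \<Longrightarrow> b \<in> arrows \<Longrightarrow> target a = source b \<Longrightarrow> mult b a \<in> arrows"

lemma catE: "category E"
  using E by (rule small_category_category)

lemma model_functor: "M \<in> Mo \<Longrightarrow> functor_between (fst M) E (Tgt (fst M))"
  and model_new: "M \<in> Mo \<Longrightarrow> q \<in> Q \<Longrightarrow>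
    snd M q \<in> Hom (Tgt (fst M)) (omap (fst M) (s q)) (omap (fst M) (t q))"
  using model by (metis prod.collapse)+

lemma arrows_ends: "a \<in> arrows \<Longrightarrow> source a \<in> Obj E \<and> target a \<in> Obj E"
  by (induction rule: arrows.induct)
    (auto simp: old_def new_def mult_def ends dest: Hom_dom[OF catE arr_Hom] Hom_cod[OF catE arr_Hom])

lemma arrows_ext: "a \<in> arrows \<Longrightarrow> val a \<in> extensional Mo"
  by (induction rule: arrows.induct) (auto simp: old_def new_def mult_def extensional_def)

lemma val_Hom:
  assumes M: "M \<in> Mo"
  shows "a \<in> arrows \<Longrightarrow>
    val a M \<in> Hom (Tgt (fst M)) (omap (fst M) (source a)) (omap (fst M) (target a))"
proof (induction rule: arrows.induct)
  case (old e)
  then show ?case using functor_Hom[OF model_functor[OF M] arr_Hom] by (simp add: old_def M)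
next
  case (new q)
  then show ?case using model_new[OF M] by (simp add: new_def M)
next
  case (mult a b)
  then show ?case
    using Hom_comp[OF functor_Tgt_cat[OF model_functor[OF M]]] by (simp add: mult_def M)
qed

lemma arrows_eqI:
  assumes "a \<in> arrows" "b \<in> arrows" "source a = source b" "target a = target b"
    and "\<And>M. M \<in> Mo \<Longrightarrow> val a M = val b M"
  shows "a = b"
proof -
  have "val a = val b"
    using assms arrows_ext by (metis extensionalityI)
  then show ?thesis using assms by (simp add: prod_eq_iff)
qed

lemma mult_simps [simp]: "source (mult b a) = source a" "target (mult b a) = target b"
  "M \<in> Mo \<Longrightarrow> val (mult b a) M = Comp (Tgt (fst M)) (val b M) (val a M)"
  by (simp_all add: mult_def)

lemma old_simps [simp]: "source (old e) = Dom E e" "target (old e) = Cod E e"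
  "M \<in> Mo \<Longrightarrow> val (old e) M = amap (fst M) e"
  by (simp_all add: old_def)

lemma new_simps [simp]: "source (new q) = s q" "target (new q) = t q"
  "M \<in> Mo \<Longrightarrow> val (new q) M = snd M q"
  by (simp_all add: new_def)

text \<open>An arrow is a function on the possibly large \<open>Mo\<close>, so counting such
  functions gives no bound. What is counted instead are the generators and the words in
  them.\<close>

lemma lesspoll_arrows: "arrows \<prec> (UNIV :: 'u set)"
proof (rule lesspoll_generated[OF univ])
  have "Arr E \<prec> (UNIV :: 'u set)" "Q \<prec> (UNIV :: 'u set)"
    using E Q by (simp_all add: small_category_def small_def)
  then show "old ` Arr E \<union> new ` Q \<prec> (UNIV :: 'u set)"
    by (intro lesspoll_Un lesspoll_image univ)
  show "arrows \<subseteq> S" if S: "old ` Arr E \<union> new ` Q \<subseteq> S"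
    "\<And>b a. b \<in> S \<Longrightarrow> a \<in> S \<Longrightarrow> mult b a \<in> S" for S
  proof
    show "a \<in> S" if "a \<in> arrows" for a
      using that by induction (use S in auto)
  qed
qed

text \<open>\<open>small_category\<close> is about categories whose arrows are of type
  \<open>'u\<close>, so the generated arrows need codes there; any injection will do.\<close>

definition enc :: "'u arrow \<Rightarrow> 'u" where
  "enc = (SOME f. inj_on f arrows)"

definition dec :: "'u \<Rightarrow> 'u arrow" where
  "dec = the_inv_into arrows enc"

lemma inj_enc: "inj_on enc arrows"
proof -
  have "\<exists>f :: 'u arrow \<Rightarrow> 'u. inj_on f arrows"
    using lesspoll_arrows by (auto simp: lesspoll_def lepoll_def)
  then show ?thesis unfolding enc_def by (rule someI_ex)
qed

lemma dec_enc [simp]: "a \<in> arrows \<Longrightarrow> dec (enc a) = a"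
  unfolding dec_def using inj_enc by (rule the_inv_into_f_f)

definition ext_cat :: "('u, 'u) cat" where
  "ext_cat = \<lparr>Obj = Obj E, Arr = enc ` arrows,
     Dom = (\<lambda>f\<in>enc ` arrows. source (dec f)), Cod = (\<lambda>f\<in>enc ` arrows. target (dec f)),
     Ide = (\<lambda>x\<in>Obj E. enc (old (Ide E x))),
     Comp = (\<lambda>g f. if f \<in> enc ` arrows \<and> g \<in> enc ` arrows \<and> target (dec f) = source (dec g)
       then enc (mult (dec g) (dec f)) else undefined)\<rparr>"

lemma Obj_ext_cat [simp]: "Obj ext_cat = Obj E"
  by (simp add: ext_cat_def)

lemma Hom_ext_cat:
  "f \<in> Hom ext_cat x y \<longleftrightarrow> (\<exists>a\<in>arrows. f = enc a \<and> source a = x \<and> target a = y)"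
  by (auto simp: Hom_iff ext_cat_def)

lemma Comp_ext_cat:
  "\<lbrakk>a \<in> arrows; b \<in> arrows; target a = source b\<rbrakk> \<Longrightarrow> Comp ext_cat (enc b) (enc a) = enc (mult b a)"
  by (simp add: ext_cat_def)

lemma Ide_ext_cat: "x \<in> Obj E \<Longrightarrow> Ide ext_cat x = enc (old (Ide E x))"
  by (simp add: ext_cat_def)

lemma old_Ide: "x \<in> Obj E \<Longrightarrow>
  old (Ide E x) \<in> arrows \<and> source (old (Ide E x)) = x \<and> target (old (Ide E x)) = x"
  using Hom_ide[OF catE] by (auto simp: Hom_iff intro: arrows.old)

text \<open>The laws hold in the target of every model, and arrows with equal ends are compared
  model by model.\<close>

lemma category_ext_cat: "category ext_cat"
proof (rule categoryI)
  fix f x y assume "f \<in> Hom ext_cat x y"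
  then obtain a where a: "a \<in> arrows" "f = enc a" "source a = x" "target a = y"
    by (auto simp: Hom_ext_cat)
  then show xy: "x \<in> Obj ext_cat \<and> y \<in> Obj ext_cat"
    using arrows_ends[OF a(1)] by simp
  note ide = old_Ide[of x] old_Ide[of y]
  have "val (mult a (old (Ide E x))) M = val a M \<and> val (mult (old (Ide E y)) a) M = val a M"
    if M: "M \<in> Mo" for M
    using a(3,4) xy M functor_ide[OF model_functor[OF M]]
      comp_ide[OF functor_Tgt_cat[OF model_functor[OF M]] val_Hom[OF M a(1)]]
      ide_comp[OF functor_Tgt_cat[OF model_functor[OF M]] val_Hom[OF M a(1)]] by simp
  then have "mult a (old (Ide E x)) = a" "mult (old (Ide E y)) a = a"
    using a xy ide by (auto intro!: arrows_eqI arrows.mult simp del: mult_simps(3))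
  then show "Comp ext_cat f (Ide ext_cat x) = f \<and> Comp ext_cat (Ide ext_cat y) f = f"
    using a xy ide by (simp add: Ide_ext_cat Comp_ext_cat)
next
  show "Ide ext_cat x \<in> Hom ext_cat x x" if "x \<in> Obj ext_cat" for x
    using that old_Ide[of x] by (auto simp: Hom_ext_cat Ide_ext_cat)
next
  fix f g x y z assume "f \<in> Hom ext_cat x y" "g \<in> Hom ext_cat y z"
  then show "Comp ext_cat g f \<in> Hom ext_cat x z"
    by (auto simp: Hom_ext_cat Comp_ext_cat intro!: bexI arrows.mult)
next
  fix f g h x y z w
  assume "f \<in> Hom ext_cat x y" "g \<in> Hom ext_cat y z" "h \<in> Hom ext_cat z w"
  then obtain a b c where *: "a \<in> arrows" "b \<in> arrows" "c \<in> arrows" "f = enc a" "g = enc b"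
    "h = enc c" "target a = source b" "target b = source c"
    by (auto simp: Hom_ext_cat)
  have "mult c (mult b a) = mult (mult c b) a"
  proof (rule arrows_eqI)
    show "val (mult c (mult b a)) M = val (mult (mult c b) a) M" if M: "M \<in> Mo" for M
      using comp_assoc[OF functor_Tgt_cat[OF model_functor[OF M]] val_Hom[OF M *(1), unfolded *(7)]
          val_Hom[OF M *(2), unfolded *(8)] val_Hom[OF M *(3)]] M by simp
  qed (use * in \<open>simp_all add: arrows.mult\<close>)
  then show "Comp ext_cat h (Comp ext_cat g f) = Comp ext_cat (Comp ext_cat h g) f"
    using * by (simp add: Comp_ext_cat arrows.mult)
qed

lemma small_ext_cat: "small_category ext_cat"
proof -
  have "small (enc ` arrows)"
    unfolding small_def by (rule lesspoll_image[OF univ lesspoll_arrows])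
  then show ?thesis
    unfolding small_category_def using category_ext_cat E
    by (auto simp: ext_cat_def small_category_def)
qed

definition incl :: "'u func" where
  "incl = \<lparr>Src = E, Tgt = ext_cat, omap = (\<lambda>x\<in>Obj E. x), amap = (\<lambda>e\<in>Arr E. enc (old e))\<rparr>"

lemma incl_simps [simp]: "Tgt incl = ext_cat" "x \<in> Obj E \<Longrightarrow> omap incl x = x"
  "e \<in> Arr E \<Longrightarrow> amap incl e = enc (old e)"
  by (simp_all add: incl_def)

lemma incl: "functor_between incl E ext_cat"
proof (rule functor_betweenI)
  show "amap incl f \<in> Hom ext_cat (omap incl x) (omap incl y)" if f: "f \<in> Hom E x y" for f x y
    using f Hom_dom[OF catE f] Hom_cod[OF catE f] unfolding Hom_ext_cat
    by (intro bexI[of _ "old f"]) (simp_all add: Hom_iff arrows.old)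
  show "amap incl (Ide E x) = Ide ext_cat (omap incl x)" if "x \<in> Obj E" for x
    using that Hom_ide[OF catE that] by (simp add: Ide_ext_cat Hom_iff)
  show "amap incl (Comp E g f) = Comp ext_cat (amap incl g) (amap incl f)"
    if fg: "f \<in> Hom E x y" "g \<in> Hom E y z" for f g x y z
  proof -
    have *: "f \<in> Arr E" "g \<in> Arr E" "Comp E g f \<in> Arr E" "Cod E f = Dom E g"
      "Dom E (Comp E g f) = Dom E f" "Cod E (Comp E g f) = Cod E g"
      using fg Hom_comp[OF catE fg] by (auto simp: Hom_iff)
    have "old (Comp E g f) = mult (old g) (old f)"
      using * functor_comp[OF model_functor fg]
      by (intro arrows_eqI) (simp_all add: arrows.old arrows.mult)
    then show ?thesis using * by (simp add: Comp_ext_cat arrows.old)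
  qed
qed (use catE category_ext_cat in \<open>auto simp: incl_def\<close>)

lemma new_Hom: "q \<in> Q \<Longrightarrow> enc (new q) \<in> Hom ext_cat (omap incl (s q)) (omap incl (t q))"
  using ends arrows.new by (auto simp: Hom_ext_cat)

section \<open>Universal property of the extended category\<close>

definition eval_at :: "'u func \<times> ('u \<Rightarrow> 'u) \<Rightarrow> 'u func" where
  "eval_at M = \<lparr>Src = ext_cat, Tgt = Tgt (fst M), omap = omap (fst M),
     amap = (\<lambda>f\<in>enc ` arrows. val (dec f) M)\<rparr>"

lemma eval_at_enc [simp]: "a \<in> arrows \<Longrightarrow> amap (eval_at M) (enc a) = val a M"
  by (simp add: eval_at_def)

text \<open>Existence half of the universal property: \<open>eval_at\<close> M is the projection of
  the product onto its factor M, restricted to the generated subcategory.\<close>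

lemma eval_at:
  assumes M: "M \<in> Mo"
  shows "functor_between (eval_at M) ext_cat (Tgt (fst M))" "comp_func (eval_at M) incl = fst M"
    "q \<in> Q \<Longrightarrow> amap (eval_at M) (enc (new q)) = snd M q"
proof -
  note F = model_functor[OF M]
  have [simp]: "omap (eval_at M) = omap (fst M)"
    by (simp add: eval_at_def)
  show *: "functor_between (eval_at M) ext_cat (Tgt (fst M))"
  proof (rule functor_betweenI)
    show "amap (eval_at M) f \<in> Hom (Tgt (fst M)) (omap (eval_at M) x) (omap (eval_at M) y)"
      if "f \<in> Hom ext_cat x y" for f x y
      using that val_Hom[OF M] by (auto simp: Hom_ext_cat)
    show "amap (eval_at M) (Ide ext_cat x) = Ide (Tgt (fst M)) (omap (eval_at M) x)"
      if "x \<in> Obj ext_cat" for x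
      using that old_Ide[of x] functor_ide[OF F] by (simp add: Ide_ext_cat M)
    show "amap (eval_at M) (Comp ext_cat g f) =
        Comp (Tgt (fst M)) (amap (eval_at M) g) (amap (eval_at M) f)"
      if "f \<in> Hom ext_cat x y" "g \<in> Hom ext_cat y z" for f g x y z
      using that by (auto simp: Hom_ext_cat Comp_ext_cat arrows.mult M)
  qed (use F functor_Tgt_cat[OF F] functor_omap_ext[OF F] category_ext_cat in
      \<open>auto simp: eval_at_def functor_obj ext_cat_def\<close>)
  show "comp_func (eval_at M) incl = fst M"
    using comp_func_between[OF incl *] F
    by (rule functor_eqI) (simp_all add: arrows.old M functor_Src[OF incl])
  show "q \<in> Q \<Longrightarrow> amap (eval_at M) (enc (new q)) = snd M q"
    by (simp add: arrows.new M)
qed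

text \<open>Uniqueness half, by induction on the words: a functor is determined by its values on E
  and on the new arrows.\<close>

lemma eval_at_unique:
  assumes "functor_between H ext_cat D" "functor_between H' ext_cat D"
    and eq: "comp_func H incl = comp_func H' incl"
    and new: "\<And>q. q \<in> Q \<Longrightarrow> amap H (enc (new q)) = amap H' (enc (new q))"
  shows "H = H'"
proof (rule functor_eqI[OF assms(1,2)])
  show "omap H x = omap H' x" if "x \<in> Obj ext_cat" for x
    using that eq comp_func_omap[OF incl] by (metis Obj_ext_cat incl_simps(2))
  have "amap H (enc a) = amap H' (enc a)" if "a \<in> arrows" for a
    using that
  proof induction
    case (old e)
    then show ?case using eq comp_func_amap[OF incl] by (metis incl_simps(3))
  next
    case (mult a b)
    then have "enc a \<in> Hom ext_cat (source a) (source b)" "enc b \<in> Hom ext_cat (source b) (target b)"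
      by (auto simp: Hom_ext_cat)
    then show ?case
      using mult functor_comp[OF assms(1)] functor_comp[OF assms(2)] by (metis Comp_ext_cat)
  qed (rule new)
  then show "amap H f = amap H' f" if "f \<in> Arr ext_cat" for f
    using that by (auto simp: ext_cat_def)
qed

text \<open>This replaces generators and relations: no congruence is ever formed, and a relation
  holds among the new arrows as soon as every model satisfies it.\<close>

lemma eval_at_faithful:
  assumes "f \<in> Hom ext_cat x y" "g \<in> Hom ext_cat x y"
    and "\<And>M. M \<in> Mo \<Longrightarrow> amap (eval_at M) f = amap (eval_at M) g"
  shows "f = g"
proof -
  obtain a b where ab: "a \<in> arrows" "f = enc a" "source a = x" "target a = y"
    "b \<in> arrows" "g = enc b" "source b = x" "target b = y"
    using assms(1,2) by (auto simp: Hom_ext_cat)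
  then have "a = b"
    using assms(3) by (intro arrows_eqI) auto
  then show ?thesis using ab by simp
qed

end

subsection \<open>Initial triples and adjunctions\<close>

lemma Hom_structured_cat:
  "f \<in> Hom (structured_cat X B P) x y \<longleftrightarrow>
    (\<exists>H. f = (x, y, H) \<and> x \<in> X \<and> y \<in> X \<and> functor_between H (B x) (B y) \<and> P x y H)"
  by (auto simp: Hom_def structured_cat_def)

text \<open>An arrow of \<open>structured_cat\<close> consists of its ends and a functor, so
  uniqueness of the arrow is uniqueness of the functor.\<close>

lemma initial_structured_cat:
  "initial (structured_cat X B P) x \<longleftrightarrow>
    x \<in> X \<and> (\<forall>y\<in>X. \<exists>!H. functor_between H (B x) (B y) \<and> P x y H)"
proof -
  have "(\<exists>!f. f \<in> Hom (structured_cat X B P) x y) \<longleftrightarrow> (\<exists>!H. functor_between H (B x) (B y) \<and> P x y H)"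
    if "x \<in> X" "y \<in> X" for y
    using that unfolding Hom_structured_cat by (auto 4 4)
  moreover have "Obj (structured_cat X B P) = X"
    by (simp add: structured_cat_def)
  ultimately show ?thesis
    by (simp add: initial_def cong: conj_cong ball_cong)
qed

lemma Obj_coslice: "F \<in> Obj (coslice E) \<longleftrightarrow> functor_between F E (Tgt F) \<and> small_category (Tgt F)"
  by (auto simp: coslice_def structured_cat_def functor_between_def)

lemma Hom_coslice:
  "f \<in> Hom (coslice E) F G \<longleftrightarrow>
    (\<exists>H. f = (F, G, H) \<and> F \<in> Obj (coslice E) \<and> G \<in> Obj (coslice E) \<and>
      functor_between H (Tgt F) (Tgt G) \<and> comp_func H F = G)"
proof -
  have "Obj (coslice E) = {F. is_functor F \<and> Src F = E \<and> small_category (Tgt F)}"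
    by (simp add: coslice_def structured_cat_def)
  then show ?thesis
    by (simp add: coslice_def Hom_structured_cat)
qed

lemma coslice_simps [simp]:
  "Dom (coslice E) (F, G, H) = F" "Cod (coslice E) (F, G, H) = G"
  "Comp (coslice E) (G', G'', K) (F, G, H) = (F, G'', comp_func K H)"
  by (simp_all add: coslice_def structured_cat_def)

subsection \<open>Compatible families\<close>

text \<open>A cone over \<open>F \<circ> \<phi>\<^sub>\<alpha>\<close> with vertex \<open>F y\<close>, given by its legs \<open>p\<close>.\<close>

definition family :: "'u sketch \<Rightarrow> 'u \<Rightarrow> 'u func \<Rightarrow> 'u \<Rightarrow> ('u \<Rightarrow> 'u) \<Rightarrow> bool" where
  "family S \<alpha> F y p \<longleftrightarrow> (let I = index (cones S \<alpha>); \<phi> = diagram (cones S \<alpha>) in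
     (\<forall>j\<in>Obj I. p j \<in> Hom (Tgt F) (omap F y) (omap F (omap \<phi> j))) \<and>
     (\<forall>j k u. u \<in> Hom I j k \<longrightarrow> Comp (Tgt F) (amap F (amap \<phi> u)) (p j) = p k))"

text \<open>The arrow f factors the family p through the image of the specified cone under
  F.\<close>

definition fills :: "'u sketch \<Rightarrow> 'u \<Rightarrow> 'u func \<Rightarrow> 'u \<Rightarrow> ('u \<Rightarrow> 'u) \<Rightarrow> 'u \<Rightarrow> bool" where
  "fills S \<alpha> F y p f \<longleftrightarrow> f \<in> Hom (Tgt F) (omap F y) (omap F (vertex (cones S \<alpha>))) \<and>
     (\<forall>j\<in>Obj (index (cones S \<alpha>)). Comp (Tgt F) (amap F (cmp (legs (cones S \<alpha>)) j)) f = p j)"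

definition sharp :: "'u sketch \<Rightarrow> 'u func \<Rightarrow> bool" where
  "sharp S F \<longleftrightarrow> (\<forall>\<alpha>\<in>names S. \<forall>y\<in>Obj (carrier S). \<forall>p. family S \<alpha> F y p \<longrightarrow> (\<exists>!f. fills S \<alpha> F y p f))"

text \<open>\<open>family\<close> speaks of bare leg functions, the form in which
  \<open>adjoining\<close> takes its new arrows. Together with \<open>is_nat_family\<close> this
  translates to and from the natural transformations in \<open>triples\<close>.\<close>

definition family_nt :: "'u sketch \<Rightarrow> 'u \<Rightarrow> 'u func \<Rightarrow> 'u \<Rightarrow> ('u \<Rightarrow> 'u) \<Rightarrow> 'u nt" where
  "family_nt S \<alpha> F y p = (let C = cones S \<alpha> in
     \<lparr>Fdom = comp_func F (const_func (index C) (carrier S) y), Fcod = comp_func F (diagram C),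
      cmp = (\<lambda>j\<in>Obj (index C). p j)\<rparr>)"

locale sketch_cone =
  fixes S :: "'u sketch" and \<alpha> :: 'u
  assumes S: "limit_sketch S" and \<alpha>: "\<alpha> \<in> names S"
begin

abbreviation "E \<equiv> carrier S"
abbreviation "I \<equiv> index (cones S \<alpha>)"
abbreviation "\<phi> \<equiv> diagram (cones S \<alpha>)"
abbreviation "x \<equiv> vertex (cones S \<alpha>)"
abbreviation "\<delta> \<equiv> cmp (legs (cones S \<alpha>))"

lemma small_E: "small_category E"
  using S by (simp add: limit_sketch_def)

lemma catE: "category E"
  using small_E by (rule small_category_category)

lemma cone: "is_cone E (cones S \<alpha>)"
  using S \<alpha> by (simp add: limit_sketch_def)

lemma x: "x \<in> Obj E" and small_I: "small_category I" and \<phi>: "functor_between \<phi> I E"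
  and legs: "is_nat (legs (cones S \<alpha>)) (const_func I E x) \<phi>"
  using cone by (auto simp: is_cone_def)

lemma catI: "category I"
  using small_I by (rule small_category_category)

lemma \<delta>: "j \<in> Obj I \<Longrightarrow> \<delta> j \<in> Hom E x (omap \<phi> j)"
  using nat_Hom[OF legs const_func_between[OF catI catE x]] by (metis const_func_simps(3))

lemma is_nat_family:
  assumes F: "functor_between F E D" and y: "y \<in> Obj E"
    and \<psi>: "is_nat \<psi> (comp_func F (const_func I E y)) (comp_func F \<phi>)"
  shows "family S \<alpha> F y (cmp \<psi>)"
proof -
  have K: "functor_between (comp_func F (const_func I E y)) I D"
    using const_func_between[OF catI catE y] F by (rule comp_func_between)
  have [simp]: "Tgt F = D" "Src \<phi> = I"
    using F \<phi> by (auto simp: functor_Tgt functor_Src)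
  have h: "cmp \<psi> j \<in> Hom D (omap F y) (omap F (omap \<phi> j))" if "j \<in> Obj I" for j
    using nat_Hom[OF \<psi> K that] that by simp
  moreover have "Comp D (amap F (amap \<phi> u)) (cmp \<psi> j) = cmp \<psi> k" if u: "u \<in> Hom I j k" for u j k
    using nat_naturality[OF \<psi> K u] u functor_ide[OF F y] Hom_cod[OF catI u]
      comp_ide[OF functor_Tgt_cat[OF F] h[OF Hom_cod[OF catI u]]] by (simp add: Hom_iff)
  ultimately show ?thesis by (simp add: family_def Let_def)
qed

lemma is_nat_family_nt:
  assumes F: "functor_between F E D" and y: "y \<in> Obj E" and p: "family S \<alpha> F y p"
  shows "is_nat (family_nt S \<alpha> F y p) (comp_func F (const_func I E y)) (comp_func F \<phi>)"
proof (rule natI)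
  show "functor_between (comp_func F (const_func I E y)) I D"
    using const_func_between[OF catI catE y] F by (rule comp_func_between)
  show "functor_between (comp_func F \<phi>) I D"
    using \<phi> F by (rule comp_func_between)
  have [simp]: "Tgt F = D" "Src \<phi> = I"
    using F \<phi> by (auto simp: functor_Tgt functor_Src)
  have h: "p j \<in> Hom D (omap F y) (omap F (omap \<phi> j))" if "j \<in> Obj I" for j
    using p that by (simp add: family_def Let_def)
  then show "cmp (family_nt S \<alpha> F y p) j \<in>
      Hom D (omap (comp_func F (const_func I E y)) j) (omap (comp_func F \<phi>) j)"
    if "j \<in> Obj I" for j
    using that by (simp add: family_nt_def Let_def)
  show "Comp D (cmp (family_nt S \<alpha> F y p) k) (amap (comp_func F (const_func I E y)) u) =
      Comp D (amap (comp_func F \<phi>) u) (cmp (family_nt S \<alpha> F y p) j)"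
    if u: "u \<in> Hom I j k" for u j k
  proof -
    have "Comp D (amap F (amap \<phi> u)) (p j) = p k"
      using p u by (auto simp: family_def Let_def)
    then show ?thesis
      using u Hom_dom[OF catI u] Hom_cod[OF catI u] functor_ide[OF F y]
        comp_ide[OF functor_Tgt_cat[OF F] h[OF Hom_cod[OF catI u]]]
      by (simp add: family_nt_def Let_def Hom_iff)
  qed
qed (simp_all add: family_nt_def Let_def)

lemma family_whisker:
  assumes F: "functor_between F E D" and y: "y \<in> Obj E" and p: "family S \<alpha> F y p"
    and H: "functor_between H D D'"
  shows "family S \<alpha> (comp_func H F) y (\<lambda>j. amap H (p j))"
proof -
  have [simp]: "Tgt F = D" "Src F = E" "Tgt H = D'"
    using F H by (auto simp: functor_Tgt functor_Src)
  have h: "p j \<in> Hom D (omap F y) (omap F (omap \<phi> j))" if "j \<in> Obj I" for j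
    using p that by (simp add: family_def Let_def)
  have "amap H (p j) \<in> Hom D' (omap H (omap F y)) (omap H (omap F (omap \<phi> j)))" if "j \<in> Obj I" for j
    using functor_Hom[OF H h[OF that]] .
  moreover have "Comp D' (amap H (amap F (amap \<phi> u))) (amap H (p j)) = amap H (p k)"
    if u: "u \<in> Hom I j k" for u j k
    using functor_comp[OF H h functor_Hom[OF F functor_Hom[OF \<phi> u]]] Hom_dom[OF catI u] p u
    by (simp add: family_def Let_def)
  ultimately show ?thesis
    using y functor_obj[OF \<phi>] functor_arr[OF \<phi>] by (simp add: family_def Let_def Hom_iff)
qed

lemma fills_whisker:
  assumes F: "functor_between F E D" and y: "y \<in> Obj E" and f: "fills S \<alpha> F y p f"
    and H: "functor_between H D D'"
  shows "fills S \<alpha> (comp_func H F) y (\<lambda>j. amap H (p j)) (amap H f)"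
proof -
  have [simp]: "Tgt F = D" "Src F = E" "Tgt H = D'"
    using F H by (auto simp: functor_Tgt functor_Src)
  have h: "f \<in> Hom D (omap F y) (omap F x)"
    using f by (simp add: fills_def)
  have "Comp D' (amap H (amap F (\<delta> j))) (amap H f) = amap H (p j)" if j: "j \<in> Obj I" for j
    using functor_comp[OF H h functor_Hom[OF F \<delta>[OF j]]] f j by (simp add: fills_def)
  then show ?thesis
    using functor_Hom[OF H h] \<delta> x y by (simp add: fills_def Hom_iff)
qed

text \<open>The condition on arrows of \<open>triples\<close> becomes a condition on components,
  that is, on the values of H at the adjoined arrows.\<close>

lemma is_nat_whisker_eq:
  assumes F: "functor_between F E D" and y: "y \<in> Obj E"
    and \<gamma>: "is_nat \<gamma> (comp_func F (const_func I E y)) (comp_func F \<phi>)"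
    and H: "functor_between H D D'"
    and \<psi>: "is_nat \<psi> (comp_func (comp_func H F) (const_func I E y)) (comp_func (comp_func H F) \<phi>)"
  shows "whisker H \<gamma> = \<psi> \<longleftrightarrow> (\<forall>j\<in>Obj I. amap H (cmp \<gamma> j) = cmp \<psi> j)"
proof
  have K: "functor_between (comp_func F (const_func I E y)) I D"
    using const_func_between[OF catI catE y] F by (rule comp_func_between)
  show "\<forall>j\<in>Obj I. amap H (cmp \<gamma> j) = cmp \<psi> j" if "whisker H \<gamma> = \<psi>"
    using whisker_cmp[OF \<gamma> K, of _ H] that by simp
  have HK: "comp_func (comp_func H F) (const_func I E y) = comp_func H (comp_func F (const_func I E y))"
    "comp_func (comp_func H F) \<phi> = comp_func H (comp_func F \<phi>)"
    using comp_func_assoc[OF const_func_between[OF catI catE y] F H] comp_func_assoc[OF \<phi> F H]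
    by simp_all
  show "whisker H \<gamma> = \<psi>" if "\<forall>j\<in>Obj I. amap H (cmp \<gamma> j) = cmp \<psi> j"
  proof (rule nat_eqI)
    show "is_nat (whisker H \<gamma>) (comp_func H (comp_func F (const_func I E y))) (comp_func H (comp_func F \<phi>))"
      using \<gamma> K H by (rule is_nat_whisker)
    show "is_nat \<psi> (comp_func H (comp_func F (const_func I E y))) (comp_func H (comp_func F \<phi>))"
      using \<psi> HK by simp
    show "functor_between (comp_func H (comp_func F (const_func I E y))) I D'"
      using K H by (rule comp_func_between)
  qed (use that whisker_cmp[OF \<gamma> K, of _ H] in simp)
qed

section \<open>Universal properties and existence of E[y;\<alpha>] and E[y;\<alpha>]'\<close>

lemma initial_triples:
  "initial (triples S y \<alpha>) (i, \<gamma>) \<longleftrightarrow>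
    i \<in> Obj (coslice E) \<and> is_nat \<gamma> (comp_func i (const_func I E y)) (comp_func i \<phi>) \<and>
    (\<forall>F \<psi>. F \<in> Obj (coslice E) \<and> is_nat \<psi> (comp_func F (const_func I E y)) (comp_func F \<phi>) \<longrightarrow>
      (\<exists>!H. functor_between H (Tgt i) (Tgt F) \<and> comp_func H i = F \<and> whisker H \<gamma> = \<psi>))"
  unfolding triples_def Let_def initial_structured_cat by simp

text \<open>An arrow that completes G to an object of \<open>adjunctions\<close> is a filler, along
  G after i, of the image under G of the universal family \<gamma>. In this form sharpness can be
  compared with orthogonality.\<close>

lemma initial_adjunctions:
  assumes i: "functor_between i E D" and y: "y \<in> Obj E"
  shows "initial (adjunctions S y \<alpha> i \<gamma>) (r, f) \<longleftrightarrow>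
    r \<in> Obj (coslice D) \<and> fills S \<alpha> (comp_func r i) y (\<lambda>j. amap r (cmp \<gamma> j)) f \<and>
    (\<forall>G g. G \<in> Obj (coslice D) \<and> fills S \<alpha> (comp_func G i) y (\<lambda>j. amap G (cmp \<gamma> j)) g \<longrightarrow>
      (\<exists>!H. functor_between H (Tgt r) (Tgt G) \<and> comp_func H r = G \<and> amap H f = g))"
proof -
  have [simp]: "Tgt i = D" "Src i = E"
    using i by (auto simp: functor_Tgt functor_Src)
  have "(g \<in> Hom (Tgt G) (omap G (omap i y)) (omap G (omap i x)) \<and>
      (\<forall>j\<in>Obj I. Comp (Tgt G) (amap G (amap i (\<delta> j))) g = amap G (cmp \<gamma> j))) \<longleftrightarrow>
      fills S \<alpha> (comp_func G i) y (\<lambda>j. amap G (cmp \<gamma> j)) g" for G g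
    using \<delta> x y by (simp add: fills_def Hom_iff)
  then show ?thesis
    unfolding adjunctions_def Let_def initial_structured_cat by simp
qed

text \<open>Adjoin one arrow from y to \<phi> j for each object j of I, with all compatible families
  as models. The compatibility of the new arrows is inherited from the models by
  \<open>eval_at_faithful\<close>.\<close>

lemma ex_initial_triples:
  assumes univ: "universe TYPE('u)" and y: "y \<in> Obj E"
  shows "\<exists>i \<gamma>. initial (triples S y \<alpha>) (i, \<gamma>)"
proof -
  define Mo where "Mo = {(F, p). F \<in> Obj (coslice E) \<and> family S \<alpha> F y p}"
  interpret adjoining E "Obj I" "\<lambda>_. y" "omap \<phi>" Mo
    using univ small_E small_I y functor_obj[OF \<phi>] unfolding Mo_def
    by unfold_locales (auto simp: small_category_def Obj_coslice family_def Let_def)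
  let ?p = "\<lambda>j. enc (new j)"
  have p: "family S \<alpha> incl y ?p"
  proof -
    have new: "?p j \<in> Hom ext_cat (omap incl y) (omap incl (omap \<phi> j))" if "j \<in> Obj I" for j
      using new_Hom[OF that] .
    have "Comp ext_cat (amap incl (amap \<phi> u)) (?p j) = ?p k" if u: "u \<in> Hom I j k" for u j k
    proof (rule eval_at_faithful)
      have jk: "j \<in> Obj I" "k \<in> Obj I"
        using Hom_dom[OF catI u] Hom_cod[OF catI u] by simp_all
      have \<phi>u: "amap incl (amap \<phi> u) \<in> Hom ext_cat (omap incl (omap \<phi> j)) (omap incl (omap \<phi> k))"
        using functor_Hom[OF incl functor_Hom[OF \<phi> u]] .
      show "Comp ext_cat (amap incl (amap \<phi> u)) (?p j) \<in> Hom ext_cat (omap incl y) (omap incl (omap \<phi> k))"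
        using Hom_comp[OF category_ext_cat new[OF jk(1)] \<phi>u] .
      show "?p k \<in> Hom ext_cat (omap incl y) (omap incl (omap \<phi> k))"
        using new[OF jk(2)] .
      show "amap (eval_at M) (Comp ext_cat (amap incl (amap \<phi> u)) (?p j)) = amap (eval_at M) (?p k)"
        if M: "M \<in> Mo" for M
      proof -
        have "amap (eval_at M) (amap incl (amap \<phi> u)) = amap (fst M) (amap \<phi> u)"
          using comp_func_amap[OF incl, of "amap \<phi> u" "eval_at M"] eval_at(2)[OF M]
            functor_Hom[OF \<phi> u] by (simp add: Hom_iff)
        then show ?thesis
          using functor_comp[OF eval_at(1)[OF M] new[OF jk(1)] \<phi>u] eval_at(3)[OF M] jk M u
          by (auto simp: Mo_def family_def Let_def)
      qed
    qed
    then show ?thesis using new by (simp add: family_def Let_def)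
  qed
  note nt = is_nat_family_nt[OF incl y p]
  have "initial (triples S y \<alpha>) (incl, family_nt S \<alpha> incl y ?p)"
    unfolding initial_triples
  proof (intro conjI allI impI)
    show "incl \<in> Obj (coslice E)"
      using incl small_ext_cat by (simp add: Obj_coslice)
    fix F \<psi>
    assume "F \<in> Obj (coslice E) \<and> is_nat \<psi> (comp_func F (const_func I E y)) (comp_func F \<phi>)"
    then have F: "F \<in> Obj (coslice E)" "functor_between F E (Tgt F)"
      and \<psi>: "is_nat \<psi> (comp_func F (const_func I E y)) (comp_func F \<phi>)"
      by (auto simp: Obj_coslice)
    have M: "(F, cmp \<psi>) \<in> Mo"
      using F is_nat_family[OF F(2) y \<psi>] by (simp add: Mo_def)
    have *: "whisker H (family_nt S \<alpha> incl y ?p) = \<psi> \<longleftrightarrow> (\<forall>j\<in>Obj I. amap H (?p j) = cmp \<psi> j)"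
      if "functor_between H ext_cat (Tgt F)" "comp_func H incl = F" for H
      using is_nat_whisker_eq[OF incl y nt that(1)] that(2) \<psi> by (simp add: family_nt_def Let_def)
    let ?K = "eval_at (F, cmp \<psi>)"
    have K: "functor_between ?K ext_cat (Tgt F)" "comp_func ?K incl = F"
      "\<And>j. j \<in> Obj I \<Longrightarrow> amap ?K (?p j) = cmp \<psi> j"
      using eval_at[OF M] by simp_all
    show "\<exists>!H. functor_between H (Tgt incl) (Tgt F) \<and> comp_func H incl = F \<and>
      whisker H (family_nt S \<alpha> incl y ?p) = \<psi>"
    proof (rule ex1I)
      show "functor_between ?K (Tgt incl) (Tgt F) \<and> comp_func ?K incl = F \<and>
          whisker ?K (family_nt S \<alpha> incl y ?p) = \<psi>"
        using K *[OF K(1,2)] by simp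
      fix H
      assume "functor_between H (Tgt incl) (Tgt F) \<and> comp_func H incl = F \<and>
        whisker H (family_nt S \<alpha> incl y ?p) = \<psi>"
      then have H: "functor_between H ext_cat (Tgt F)" "comp_func H incl = F"
        "\<forall>j\<in>Obj I. amap H (?p j) = cmp \<psi> j"
        using *[of H] by auto
      show "H = ?K"
        using H(1) K(1) by (rule eval_at_unique) (simp_all add: H K)
    qed
  qed (rule nt)
  then show ?thesis by blast
qed

text \<open>Same construction with a single new arrow over D. Its equations with the legs hold in
  every model, hence in \<open>ext_cat\<close>.\<close>

lemma ex_initial_adjunctions:
  assumes univ: "universe TYPE('u)" and y: "y \<in> Obj E"
    and i: "functor_between i E D" and D: "small_category D"
    and \<gamma>: "family S \<alpha> i y (cmp \<gamma>)"
  shows "\<exists>r f. initial (adjunctions S y \<alpha> i \<gamma>) (r, f)"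
proof -
  \<comment> \<open>A single arrow is indexed by the singleton of \<open>undefined\<close>, so
    \<open>fills\<close> constrains a model function only at that point. A given filler g is later
    represented by the constant function.\<close>
  define Mo :: "('u func \<times> ('u \<Rightarrow> 'u)) set" where "Mo = {(G, p). G \<in> Obj (coslice D) \<and>
    fills S \<alpha> (comp_func G i) y (\<lambda>j. amap G (cmp \<gamma> j)) (p undefined)}"
  have [simp]: "Src i = E" "Tgt i = D"
    using i by (auto simp: functor_Src functor_Tgt)
  have catD: "category D"
    using D by (rule small_category_category)
  interpret adjoining D "{undefined}" "\<lambda>_. omap i y" "\<lambda>_. omap i x" Mo
  proof
    show "small {undefined :: 'u}"
      unfolding small_def by (simp add: finite_lesspoll_infinite infinite_universe[OF univ])
  qed (use univ D functor_obj[OF i] x y in \<open>auto simp: Mo_def Obj_coslice fills_def\<close>)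
  let ?f = "enc (new undefined)"
  have ri: "functor_between (comp_func incl i) E ext_cat"
    using i incl by (rule comp_func_between)
  have new: "?f \<in> Hom ext_cat (omap incl (omap i y)) (omap incl (omap i x))"
    using new_Hom by simp
  have \<gamma>_Hom: "cmp \<gamma> j \<in> Hom D (omap i y) (omap i (omap \<phi> j))" if "j \<in> Obj I" for j
    using \<gamma> that by (simp add: family_def Let_def)
  have "Comp ext_cat (amap incl (amap i (\<delta> j))) ?f = amap incl (cmp \<gamma> j)" if j: "j \<in> Obj I" for j
  proof (rule eval_at_faithful)
    have i\<delta>: "amap i (\<delta> j) \<in> Hom D (omap i x) (omap i (omap \<phi> j))"
      using functor_Hom[OF i \<delta>[OF j]] .
    show "Comp ext_cat (amap incl (amap i (\<delta> j))) ?f \<in>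
        Hom ext_cat (omap incl (omap i y)) (omap incl (omap i (omap \<phi> j)))"
      using Hom_comp[OF category_ext_cat new functor_Hom[OF incl i\<delta>]] .
    show "amap incl (cmp \<gamma> j) \<in> Hom ext_cat (omap incl (omap i y)) (omap incl (omap i (omap \<phi> j)))"
      using functor_Hom[OF incl \<gamma>_Hom[OF j]] .
    fix M assume M: "M \<in> Mo"
    have *: "amap (eval_at M) (amap incl g) = amap (fst M) g" if "g \<in> Hom D a b" for g a b
      using comp_func_amap[OF incl, of g "eval_at M"] eval_at(2)[OF M] that by (simp add: Hom_iff)
    have "Comp (Tgt (fst M)) (amap (comp_func (fst M) i) (\<delta> j)) (snd M undefined) = amap (fst M) (cmp \<gamma> j)"
      using M j by (auto simp: Mo_def fills_def)
    then show "amap (eval_at M) (Comp ext_cat (amap incl (amap i (\<delta> j))) ?f) =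
        amap (eval_at M) (amap incl (cmp \<gamma> j))"
      using functor_comp[OF eval_at(1)[OF M] new functor_Hom[OF incl i\<delta>]] eval_at(3)[OF M, of undefined]
        *[OF i\<delta>] *[OF \<gamma>_Hom[OF j]] \<delta>[OF j] by (simp add: Hom_iff)
  qed
  then have f: "fills S \<alpha> (comp_func incl i) y (\<lambda>j. amap incl (cmp \<gamma> j)) ?f"
    using new x y \<delta> by (simp add: fills_def Hom_iff)
  have "initial (adjunctions S y \<alpha> i \<gamma>) (incl, ?f)"
    unfolding initial_adjunctions[OF i y]
  proof (intro conjI allI impI)
    show "incl \<in> Obj (coslice D)"
      using incl small_ext_cat by (simp add: Obj_coslice)
    fix G g
    assume "G \<in> Obj (coslice D) \<and> fills S \<alpha> (comp_func G i) y (\<lambda>j. amap G (cmp \<gamma> j)) g"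
    then have M: "(G, \<lambda>_. g) \<in> Mo" by (simp add: Mo_def)
    let ?K = "eval_at (G, \<lambda>_. g)"
    have K: "functor_between ?K ext_cat (Tgt G)" "comp_func ?K incl = G" "amap ?K ?f = g"
      using eval_at(1,2)[OF M] eval_at(3)[OF M, of undefined] by simp_all
    show "\<exists>!H. functor_between H (Tgt incl) (Tgt G) \<and> comp_func H incl = G \<and> amap H ?f = g"
    proof (rule ex1I)
      show "functor_between ?K (Tgt incl) (Tgt G) \<and> comp_func ?K incl = G \<and> amap ?K ?f = g"
        using K by simp
      fix H
      assume "functor_between H (Tgt incl) (Tgt G) \<and> comp_func H incl = G \<and> amap H ?f = g"
      then have H: "functor_between H ext_cat (Tgt G)" "comp_func H incl = G" "amap H ?f = g"
        by auto
      show "H = ?K"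
        using H(1) K(1) by (rule eval_at_unique) (simp_all add: H K)
    qed
  qed (rule f)
  then show ?thesis by blast
qed

end

subsection \<open>The terminal category\<close>

lemma small_finite: "universe TYPE('u) \<Longrightarrow> finite A \<Longrightarrow> small (A :: 'u set)"
  unfolding small_def by (rule finite_lesspoll_infinite[OF infinite_universe])

lemma terminal_cat_simps [simp]: "Obj terminal_cat = {undefined}" "Arr terminal_cat = {undefined}"
  by (simp_all add: terminal_cat_def)

lemma category_terminal_cat: "category terminal_cat"
  by (simp add: category_def Hom_def terminal_cat_def)

lemma small_terminal_cat: "universe TYPE('u) \<Longrightarrow> small_category (terminal_cat :: ('u, 'u) cat)"
  unfolding small_category_def
  by (simp add: category_terminal_cat small_finite) (simp add: terminal_cat_def extensional_def)

text \<open>Disposes of every commutativity condition on a map into the terminal object of the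
  coslice.\<close>

lemma functor_terminal_eq:
  assumes "functor_between F C terminal_cat" "functor_between G C terminal_cat"
  shows "F = G"
  using assms functor_obj[OF assms(1)] functor_obj[OF assms(2)]
    functor_arr[OF assms(1)] functor_arr[OF assms(2)] by (intro functor_eqI) auto

abbreviation to_terminal :: "('u, 'u) cat \<Rightarrow> 'u func" where
  "to_terminal C \<equiv> const_func C terminal_cat undefined"

lemma to_terminal: "category C \<Longrightarrow> functor_between (to_terminal C) C terminal_cat"
  by (rule const_func_between) (simp_all add: category_terminal_cat)

lemma to_terminal_coslice:
  assumes "universe TYPE('u)" and F: "functor_between F E D" and D: "small_category D"
  shows "(F, to_terminal E, to_terminal D) \<in>
    Hom (coslice E) F (to_terminal (E :: ('u, 'u) cat))"
proof -
  have "comp_func (to_terminal D) F = to_terminal E"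
    using comp_func_between[OF F to_terminal] to_terminal F D
    by (blast intro: functor_terminal_eq small_category_category functor_Src_cat)
  then show ?thesis
    using F D small_terminal_cat[OF assms(1)] to_terminal[OF functor_Src_cat[OF F]]
      to_terminal[OF functor_Tgt_cat[OF F]] functor_Tgt[OF F]
    by (simp add: Hom_coslice Obj_coslice)
qed

subsection \<open>Subcategories and codiscrete categories\<close>

definition subcat :: "('u, 'u) cat \<Rightarrow> 'u set \<Rightarrow> 'u set \<Rightarrow> ('u, 'u) cat" where
  "subcat C X N = \<lparr>Obj = X, Arr = N, Dom = restrict (Dom C) N, Cod = restrict (Cod C) N,
     Ide = restrict (Ide C) X,
     Comp = (\<lambda>g f. if f \<in> N \<and> g \<in> N \<and> Cod C f = Dom C g then Comp C g f else undefined)\<rparr>"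

locale subcategory =
  fixes C :: "('u, 'u) cat" and X N :: "'u set"
  assumes C: "small_category C" and X: "X \<subseteq> Obj C"
    and N: "\<And>f. f \<in> N \<Longrightarrow> f \<in> Arr C \<and> Dom C f \<in> X \<and> Cod C f \<in> X"
    and N_ide: "\<And>x. x \<in> X \<Longrightarrow> Ide C x \<in> N"
    and N_comp: "\<And>f g. f \<in> N \<Longrightarrow> g \<in> N \<Longrightarrow> Cod C f = Dom C g \<Longrightarrow> Comp C g f \<in> N"
begin

lemma catC: "category C"
  using C by (rule small_category_category)

lemma subcat_simps [simp]: "Obj (subcat C X N) = X" "Arr (subcat C X N) = N"
  "x \<in> X \<Longrightarrow> Ide (subcat C X N) x = Ide C x"
  by (simp_all add: subcat_def)

lemma Hom_subcat: "f \<in> Hom (subcat C X N) x y \<longleftrightarrow> f \<in> N \<and> f \<in> Hom C x y"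
  using N by (auto simp: Hom_iff subcat_def)

lemma Comp_subcat: "f \<in> Hom (subcat C X N) x y \<Longrightarrow> g \<in> Hom (subcat C X N) y z \<Longrightarrow>
    Comp (subcat C X N) g f = Comp C g f"
  by (simp add: Hom_subcat) (simp add: subcat_def Hom_iff)

lemma category_subcat: "category (subcat C X N)"
proof (rule categoryI)
  show comp: "Comp (subcat C X N) g f \<in> Hom (subcat C X N) x z"
    if "f \<in> Hom (subcat C X N) x y" "g \<in> Hom (subcat C X N) y z" for f g x y z
    unfolding Comp_subcat[OF that]
    using that Hom_comp[OF catC, of f x y g z] N_comp[of f g] by (simp add: Hom_subcat) (simp add: Hom_iff)
  show ob: "x \<in> Obj (subcat C X N) \<and> y \<in> Obj (subcat C X N)"
    if "f \<in> Hom (subcat C X N) x y" for f x y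
    using that N by (simp add: Hom_subcat) (auto simp: Hom_iff)
  show ide: "Ide (subcat C X N) x \<in> Hom (subcat C X N) x x" if "x \<in> Obj (subcat C X N)" for x
    using that Hom_ide[OF catC] N_ide X by (auto simp: Hom_subcat)
  show "Comp (subcat C X N) f (Ide (subcat C X N) x) = f \<and>
      Comp (subcat C X N) (Ide (subcat C X N) y) f = f" if "f \<in> Hom (subcat C X N) x y" for f x y
    using ob[OF that] Comp_subcat[OF ide that] Comp_subcat[OF that ide] that
      comp_ide[OF catC, of f x y] ide_comp[OF catC, of f x y] by (simp add: Hom_subcat)
  show "Comp (subcat C X N) h (Comp (subcat C X N) g f) = Comp (subcat C X N) (Comp (subcat C X N) h g) f"
    if fgh: "f \<in> Hom (subcat C X N) x y" "g \<in> Hom (subcat C X N) y z" "h \<in> Hom (subcat C X N) z w"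
    for f g h x y z w
    using Comp_subcat[OF fgh(1,2)] Comp_subcat[OF fgh(2,3)] Comp_subcat[OF comp[OF fgh(1,2)] fgh(3)]
      Comp_subcat[OF fgh(1) comp[OF fgh(2,3)]] comp_assoc[OF catC, of f x y g z h w] fgh
    by (simp add: Hom_subcat)
qed

lemma small_subcat: "small_category (subcat C X N)"
proof -
  have "small X" "small N"
    using C X N subset_imp_lepoll lesspoll_trans1 unfolding small_category_def small_def
    by (metis subsetI)+
  then show ?thesis
    using category_subcat by (auto simp: small_category_def subcat_def)
qed

definition inclusion :: "'u func" where
  "inclusion = \<lparr>Src = subcat C X N, Tgt = C, omap = (\<lambda>x\<in>X. x), amap = (\<lambda>f\<in>N. f)\<rparr>"

lemma inclusion_simps [simp]: "x \<in> X \<Longrightarrow> omap inclusion x = x" "f \<in> N \<Longrightarrow> amap inclusion f = f"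
  by (simp_all add: inclusion_def)

lemma inclusion: "functor_between inclusion (subcat C X N) C"
proof (rule functor_betweenI)
  show "amap inclusion f \<in> Hom C (omap inclusion x) (omap inclusion y)"
    if "f \<in> Hom (subcat C X N) x y" for f x y
    using that Hom_dom[OF category_subcat that] Hom_cod[OF category_subcat that]
    by (simp add: Hom_subcat)
  show "amap inclusion (Comp (subcat C X N) g f) = Comp C (amap inclusion g) (amap inclusion f)"
    if "f \<in> Hom (subcat C X N) x y" "g \<in> Hom (subcat C X N) y z" for f g x y z
    using that Hom_comp[OF category_subcat that] by (simp add: Comp_subcat[OF that] Hom_subcat)
qed (use category_subcat catC X N_ide in \<open>auto simp: inclusion_def\<close>)

text \<open>A functor record names its target, so factoring through a subcategory changes the field
  \<open>Tgt\<close> and leaves both maps alone.\<close>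

lemma corestriction:
  assumes F: "functor_between F E C" and obj: "\<And>x. x \<in> Obj E \<Longrightarrow> omap F x \<in> X"
    and arr: "\<And>f. f \<in> Arr E \<Longrightarrow> amap F f \<in> N"
  shows "functor_between (F\<lparr>Tgt := subcat C X N\<rparr>) E (subcat C X N)"
    and "comp_func inclusion (F\<lparr>Tgt := subcat C X N\<rparr>) = F"
proof -
  show *: "functor_between (F\<lparr>Tgt := subcat C X N\<rparr>) E (subcat C X N)"
  proof (rule functor_betweenI)
    show Hom: "amap (F\<lparr>Tgt := subcat C X N\<rparr>) f \<in>
        Hom (subcat C X N) (omap (F\<lparr>Tgt := subcat C X N\<rparr>) x) (omap (F\<lparr>Tgt := subcat C X N\<rparr>) y)"
      if "f \<in> Hom E x y" for f x y
      using that functor_Hom[OF F that] arr by (simp add: Hom_subcat) (simp add: Hom_iff)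
    show "amap (F\<lparr>Tgt := subcat C X N\<rparr>) (Comp E g f) = Comp (subcat C X N)
        (amap (F\<lparr>Tgt := subcat C X N\<rparr>) g) (amap (F\<lparr>Tgt := subcat C X N\<rparr>) f)"
      if "f \<in> Hom E x y" "g \<in> Hom E y z" for f g x y z
      using Comp_subcat[OF Hom[OF that(1)] Hom[OF that(2)]] functor_comp[OF F that] by simp
  qed (use F functor_Src_cat[OF F] category_subcat functor_omap_ext[OF F] functor_amap_ext[OF F] in
      \<open>auto simp: obj functor_Src functor_ide\<close>)
  show "comp_func inclusion (F\<lparr>Tgt := subcat C X N\<rparr>) = F"
    using comp_func_between[OF * inclusion] F
    by (rule functor_eqI) (simp_all add: functor_Src[OF F] obj arr)
qed

end

text \<open>The category on X with exactly one arrow between any two objects: the arrow from x to y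
  is the code of the pair, and \<open>inv c\<close> reads off its ends.\<close>

definition codisc :: "('u \<times> 'u \<Rightarrow> 'u) \<Rightarrow> 'u set \<Rightarrow> ('u, 'u) cat" where
  "codisc c X = \<lparr>Obj = X, Arr = c ` (X \<times> X), Dom = (\<lambda>f\<in>c ` (X \<times> X). fst (inv c f)),
     Cod = (\<lambda>f\<in>c ` (X \<times> X). snd (inv c f)), Ide = (\<lambda>x\<in>X. c (x, x)),
     Comp = (\<lambda>g f. if f \<in> c ` (X \<times> X) \<and> g \<in> c ` (X \<times> X) \<and> snd (inv c f) = fst (inv c g)
       then c (fst (inv c f), snd (inv c g)) else undefined)\<rparr>"

context
  fixes c :: "'u \<times> 'u \<Rightarrow> 'u" and X :: "'u set"
  assumes c: "inj c"
begin

lemma codisc_simps [simp]: "Obj (codisc c X) = X" "x \<in> X \<Longrightarrow> Ide (codisc c X) x = c (x, x)"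
  by (simp_all add: codisc_def)

lemma Hom_codisc: "f \<in> Hom (codisc c X) x y \<longleftrightarrow> x \<in> X \<and> y \<in> X \<and> f = c (x, y)"
  by (auto simp: Hom_iff codisc_def inv_f_f[OF c])

lemma Comp_codisc: "\<lbrakk>x \<in> X; y \<in> X; z \<in> X\<rbrakk> \<Longrightarrow> Comp (codisc c X) (c (y, z)) (c (x, y)) = c (x, z)"
  by (auto simp: codisc_def inv_f_f[OF c])

lemma category_codisc: "category (codisc c X)"
  by (rule categoryI) (auto simp: Hom_codisc Comp_codisc)

lemma small_codisc:
  assumes univ: "universe TYPE('u)" and X: "small X"
  shows "small_category (codisc c X)"
proof -
  have "small (c ` (X \<times> X))"
    using X unfolding small_def by (intro lesspoll_image lesspoll_Times univ)
  then show ?thesis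
    using X category_codisc by (auto simp: small_category_def codisc_def)
qed

end

subsection \<open>Limit cones and compatible families\<close>

lemma (in sketch_cone) is_cone_map_cone:
  assumes F: "functor_between F E D"
  shows "is_cone D (map_cone F (cones S \<alpha>))"
proof -
  have "is_nat (whisker F (legs (cones S \<alpha>))) (comp_func F (const_func I E x)) (comp_func F \<phi>)"
    using legs const_func_between[OF catI catE x] F by (rule is_nat_whisker)
  then show ?thesis
    using comp_func_between[OF \<phi> F] functor_obj[OF F x] comp_const_func[OF catI F x]
    by (simp add: is_cone_def map_cone_def small_I)
qed

lemma (in sketch_cone) fills_iff:
  assumes F: "functor_between F E D"
  shows "fills S \<alpha> F y p f \<longleftrightarrow> f \<in> Hom D (omap F y) (vertex (map_cone F (cones S \<alpha>))) \<and>
    (\<forall>j\<in>Obj (index (map_cone F (cones S \<alpha>))). Comp D (cmp (legs (map_cone F (cones S \<alpha>))) j) f = p j)"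
  using whisker_cmp[OF legs const_func_between[OF catI catE x], of _ F] functor_Tgt[OF F]
  by (simp add: fills_def map_cone_def)

text \<open>A compatible family on F y is in particular a cone over the image diagram. The lemma is
  applied to a sketch morphism followed by the functor L of its target, which thereby qualifies for
  extension.\<close>

lemma limit_sharp:
  assumes S: "limit_sketch S" and F: "functor_between F (carrier S) D"
    and lim: "\<And>\<alpha>. \<alpha> \<in> names S \<Longrightarrow> limit_cone D (map_cone F (cones S \<alpha>))"
  shows "sharp S F"
  unfolding sharp_def
proof (intro ballI allI impI)
  fix \<alpha> y p
  assume \<alpha>: "\<alpha> \<in> names S" and y: "y \<in> Obj (carrier S)" and p: "family S \<alpha> F y p"
  interpret sketch_cone S \<alpha>
    using S \<alpha> by unfold_locales
  let ?D = "\<lparr>vertex = omap F y, index = I, diagram = comp_func F \<phi>, legs = family_nt S \<alpha> F y p\<rparr>"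
  have "is_cone D ?D"
    using is_nat_family_nt[OF F y p] comp_func_between[OF \<phi> F] functor_obj[OF F y]
      comp_const_func[OF catI F y] by (simp add: is_cone_def small_I)
  moreover have "index ?D = index (map_cone F (cones S \<alpha>))" "diagram ?D = diagram (map_cone F (cones S \<alpha>))"
    by (simp_all add: map_cone_def)
  ultimately have "\<exists>!u. u \<in> Hom D (vertex ?D) (vertex (map_cone F (cones S \<alpha>))) \<and>
      (\<forall>j\<in>Obj (index (map_cone F (cones S \<alpha>))).
        Comp D (cmp (legs (map_cone F (cones S \<alpha>))) j) u = cmp (legs ?D) j)"
    using lim[OF \<alpha>] unfolding limit_cone_def by blast
  then show "\<exists>!f. fills S \<alpha> F y p f"
    unfolding fills_iff[OF F] by (simp add: map_cone_def family_nt_def Let_def)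
qed

text \<open>Surjectivity on objects makes every vertex in D one of those that sharpness
  tests.\<close>

lemma sharp_limit:
  assumes S: "limit_sketch S" and F: "functor_between F (carrier S) D"
    and surj: "Obj D \<subseteq> omap F ` Obj (carrier S)" and sharp: "sharp S F" and \<alpha>: "\<alpha> \<in> names S"
  shows "limit_cone D (map_cone F (cones S \<alpha>))"
proof -
  interpret sketch_cone S \<alpha>
    using S \<alpha> by unfold_locales
  have "\<exists>!u. u \<in> Hom D (vertex C) (vertex (map_cone F (cones S \<alpha>))) \<and>
      (\<forall>j\<in>Obj (index (map_cone F (cones S \<alpha>))).
        Comp D (cmp (legs (map_cone F (cones S \<alpha>))) j) u = cmp (legs C) j)"
    if C: "is_cone D C" "index C = index (map_cone F (cones S \<alpha>))"
      "diagram C = diagram (map_cone F (cones S \<alpha>))" for C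
  proof -
    have "vertex C \<in> Obj D"
      using C(1) by (simp add: is_cone_def)
    then obtain y where y: "y \<in> Obj E" "vertex C = omap F y"
      using surj by blast
    have "is_nat (legs C) (comp_func F (const_func I E y)) (comp_func F \<phi>)"
      using C comp_const_func[OF catI F y(1)] y(2) by (simp add: is_cone_def map_cone_def)
    then have "family S \<alpha> F y (cmp (legs C))"
      using F y(1) by (intro is_nat_family)
    then have "\<exists>!f. fills S \<alpha> F y (cmp (legs C)) f"
      using sharp \<alpha> y(1) unfolding sharp_def by blast
    then show ?thesis
      unfolding fills_iff[OF F] y(2) .
  qed
  then show ?thesis
    using is_cone_map_cone[OF F] unfolding limit_cone_def by blast
qed

text \<open>The legs of a limit cone are jointly monic. In \<open>nat_extension\<close> this lets a
  naturality square be checked leg by leg.\<close>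

lemma limit_cone_eqI:
  assumes lim: "limit_cone D C" and D: "category D"
    and u: "u \<in> Hom D z (vertex C)" and v: "v \<in> Hom D z (vertex C)"
    and eq: "\<And>j. j \<in> Obj (index C) \<Longrightarrow> Comp D (cmp (legs C) j) u = Comp D (cmp (legs C) j) v"
  shows "u = v"
proof -
  let ?I = "index C" and ?l = "cmp (legs C)"
  have C: "vertex C \<in> Obj D" "small_category ?I" "functor_between (diagram C) ?I D"
    "is_nat (legs C) (const_func ?I D (vertex C)) (diagram C)"
    using lim by (auto simp: limit_cone_def is_cone_def)
  have I: "category ?I"
    using C(2) by (rule small_category_category)
  have z: "z \<in> Obj D"
    using Hom_dom[OF D u] .
  have l: "?l j \<in> Hom D (vertex C) (omap (diagram C) j)" if "j \<in> Obj ?I" for j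
    using nat_Hom[OF C(4) const_func_between[OF I D C(1)] that] that by simp
  \<comment> \<open>\<open>limit_cone\<close> quantifies over cones, so the composites of the legs
    with u are packaged as one. Both u and v then factor it through C.\<close>
  let ?D = "\<lparr>vertex = z, index = ?I, diagram = diagram C,
    legs = \<lparr>Fdom = const_func ?I D z, Fcod = diagram C, cmp = (\<lambda>j\<in>Obj ?I. Comp D (?l j) u)\<rparr>\<rparr>"
  have "is_nat (legs ?D) (const_func ?I D z) (diagram C)"
  proof (rule natI[OF const_func_between[OF I D z] C(3)])
    show "cmp (legs ?D) j \<in> Hom D (omap (const_func ?I D z) j) (omap (diagram C) j)"
      if "j \<in> Obj ?I" for j
      using that Hom_comp[OF D u l] by simp
    show "Comp D (cmp (legs ?D) k) (amap (const_func ?I D z) a) =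
        Comp D (amap (diagram C) a) (cmp (legs ?D) j)" if a: "a \<in> Hom ?I j k" for a j k
    proof -
      have jk: "j \<in> Obj ?I" "k \<in> Obj ?I"
        using Hom_dom[OF I a] Hom_cod[OF I a] .
      have "Comp D (amap (diagram C) a) (?l j) = ?l k"
        using nat_naturality[OF C(4) const_func_between[OF I D C(1)] a] comp_ide[OF D l[OF jk(2)]] a
        by (simp add: Hom_iff)
      then show ?thesis
        using comp_assoc[OF D u l[OF jk(1)] functor_Hom[OF C(3) a]] jk a
          comp_ide[OF D Hom_comp[OF D u l[OF jk(2)]]] by (simp add: Hom_iff)
    qed
  qed simp_all
  then have "is_cone D ?D"
    using z C by (simp add: is_cone_def)
  moreover have "\<forall>C'. is_cone D C' \<and> index C' = ?I \<and> diagram C' = diagram C \<longrightarrow>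
      (\<exists>!u. u \<in> Hom D (vertex C') (vertex C) \<and> (\<forall>j\<in>Obj ?I. Comp D (?l j) u = cmp (legs C') j))"
    using lim unfolding limit_cone_def by (elim conjE)
  ultimately have "\<exists>!w. w \<in> Hom D (vertex ?D) (vertex C) \<and> (\<forall>j\<in>Obj ?I. Comp D (?l j) w = cmp (legs ?D) j)"
    by (elim allE[of _ ?D]) (elim impE, simp_all only: cone.simps simp_thms)
  moreover define P where "P w \<longleftrightarrow> w \<in> Hom D (vertex ?D) (vertex C) \<and>
    (\<forall>j\<in>Obj ?I. Comp D (?l j) w = cmp (legs ?D) j)" for w
  ultimately have "\<exists>!w. P w" by simp
  moreover have "P u" "P v"
    using u v eq by (simp_all add: P_def)
  ultimately show ?thesis by blast
qed

subsection \<open>The universal property of the factorization\<close>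

locale realization =
  fixes fac :: "'u fact_choice" and S :: "'u sketch"
  assumes univ: "universe TYPE('u)" and S: "limit_sketch S"
    and fac: "functorial_factorization (coslice (carrier S)) (Lcls S) (Rcls S) (fac S)"
begin

abbreviation "E \<equiv> carrier S"
abbreviation "P \<equiv> Fib fac S"
abbreviation "L \<equiv> Lbang fac S"

lemma small_E: "small_category E"
  using S by (simp add: limit_sketch_def)

lemma catE: "category E"
  using small_E by (rule small_category_category)

lemma Hom_bang: "bang E \<in> Hom (coslice E) (id_func E) (to_terminal E)"
  using to_terminal_coslice[OF univ id_func_between[OF catE] small_E] by (simp add: bang_def Let_def)

text \<open>A coslice arrow H from (E, id) to an object F satisfies H after id = F, so H is F
  itself. Hence the middle object of the factorization and the functor in its left factor are the
  same functor L. The right factor is forced because its target is terminal.\<close>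

lemma
  shows L: "functor_between L E P" and small_P: "small_category P"
    and L_left: "(id_func E, L, L) \<in> Lcls S"
    and P_right: "(L, to_terminal E, to_terminal P) \<in> Rcls S"
proof -
  let ?b = "bang E"
  have b: "?b \<in> Arr (coslice E)" "Dom (coslice E) ?b = id_func E" "Cod (coslice E) ?b = to_terminal E"
    using Hom_bang by (auto simp: Hom_iff)
  have l: "lpart (fac S) ?b \<in> Lcls S" "lpart (fac S) ?b \<in> Hom (coslice E) (id_func E) (mid (fac S) ?b)"
    and r: "rpart (fac S) ?b \<in> Rcls S"
      "rpart (fac S) ?b \<in> Hom (coslice E) (mid (fac S) ?b) (to_terminal E)"
    using fac b unfolding functorial_factorization_def by auto
  obtain H where H: "lpart (fac S) ?b = (id_func E, mid (fac S) ?b, H)"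
      "mid (fac S) ?b \<in> Obj (coslice E)" "functor_between H E (Tgt (mid (fac S) ?b))"
      "comp_func H (id_func E) = mid (fac S) ?b"
    using l(2) by (auto simp: Hom_coslice)
  have HL: "H = L"
    using H(1) by (simp add: Lbang_def)
  have m: "mid (fac S) ?b = L"
    using H(4) comp_func_id[OF H(3)] HL by simp
  then have TL: "Tgt L = P"
    by (simp add: Fib_def)
  show "functor_between L E P" "small_category P"
    using H(2) m TL by (auto simp: Obj_coslice)
  show "(id_func E, L, L) \<in> Lcls S"
    using l(1) unfolding H(1) m HL .
  obtain K where K: "rpart (fac S) ?b = (L, to_terminal E, K)" "functor_between K P terminal_cat"
    using r(2) m TL by (auto simp: Hom_coslice)
  have "K = to_terminal P"
    using K(2) to_terminal[OF functor_Src_cat[OF K(2)]] by (rule functor_terminal_eq)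
  then show "(L, to_terminal E, to_terminal P) \<in> Rcls S"
    using r(1) K by simp
qed

lemma catP: "category P"
  using small_P by (rule small_category_category)

section \<open>Sharpness, the right class and extension along L\<close>

lemma XiE:
  assumes "h \<in> Xi S"
  obtains y \<alpha> i r \<gamma> f where "h = (i, comp_func r i, r)" "y \<in> Obj E" "\<alpha> \<in> names S"
    "initial (triples S y \<alpha>) (i, \<gamma>)" "initial (adjunctions S y \<alpha> i \<gamma>) (r, f)"
  using assms by (auto simp: Xi_def)

text \<open>The top of a square from r to the terminal map is a functor U on E[y;\<alpha>], which
  carries the universal \<gamma> to a compatible family for F. Diagonals are extensions of U along
  r, hence correspond to fillers of that family. The bottom of the square imposes nothing
  more.\<close>

lemma sharp_right:
  assumes F: "functor_between F E D" and D: "small_category D" and sharp: "sharp S F"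
  shows "(F, to_terminal E, to_terminal D) \<in> Rcls S"
  unfolding Rcls_def right_orth_def
proof (intro CollectI conjI ballI)
  let ?g = "(F, to_terminal E, to_terminal D)"
  have g: "?g \<in> Hom (coslice E) F (to_terminal E)"
    using univ F D by (rule to_terminal_coslice)
  then show "?g \<in> Arr (coslice E)"
    by (simp add: Hom_iff)
  have F_obj: "F \<in> Obj (coslice E)" and TF [simp]: "Tgt F = D"
    using F D by (simp_all add: Obj_coslice functor_Tgt)
  fix h assume "h \<in> Xi S"
  then obtain y \<alpha> i r \<gamma> f where h: "h = (i, comp_func r i, r)" and y: "y \<in> Obj E" and \<alpha>: "\<alpha> \<in> names S"
    and i: "initial (triples S y \<alpha>) (i, \<gamma>)" and r: "initial (adjunctions S y \<alpha> i \<gamma>) (r, f)"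
    by (rule XiE)
  interpret c: sketch_cone S \<alpha>
    using S \<alpha> by unfold_locales
  have i_fun: "functor_between i E (Tgt i)" and \<gamma>: "is_nat \<gamma> (comp_func i (const_func c.I E y)) (comp_func i c.\<phi>)"
    using i by (auto simp: c.initial_triples Obj_coslice)
  note r = r[unfolded c.initial_adjunctions[OF i_fun y]]
  have r_fun: "functor_between r (Tgt i) (Tgt r)"
    and f: "fills S \<alpha> (comp_func r i) y (\<lambda>j. amap r (cmp \<gamma> j)) f"
    using r by (auto simp: Obj_coslice)
  have ri_fun: "functor_between (comp_func r i) E (Tgt r)"
    using i_fun r_fun by (rule comp_func_between)
  show "orthogonal (coslice E) h ?g"
    unfolding orthogonal_def
  proof (intro allI impI)
    fix u v assume sq: "comm_square (coslice E) h ?g u v"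
    then have u: "u \<in> Hom (coslice E) i F" and v: "v \<in> Hom (coslice E) (comp_func r i) (to_terminal E)"
      by (auto simp: comm_square_def h)
    obtain U where U: "u = (i, F, U)" "functor_between U (Tgt i) D" "comp_func U i = F"
      using u by (auto simp: Hom_coslice)
    obtain V where V: "v = (comp_func r i, to_terminal E, V)" "functor_between V (Tgt r) terminal_cat"
      using v by (auto simp: Hom_coslice)
    have ri: "comp_func r i \<in> Obj (coslice E)"
      using v by (auto simp: Hom_coslice)
    let ?p = "\<lambda>j. amap U (cmp \<gamma> j)"
    have "family S \<alpha> F y ?p"
      using c.family_whisker[OF i_fun y c.is_nat_family[OF i_fun y \<gamma>] U(2)] U(3) by simp
    then have ex1: "\<exists>!g. fills S \<alpha> F y ?p g"
      using sharp \<alpha> y unfolding sharp_def by blast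
    then obtain g where g: "fills S \<alpha> F y ?p g" by blast
    have "U \<in> Obj (coslice (Tgt i)) \<and> fills S \<alpha> (comp_func U i) y ?p g"
      using U g D by (simp add: Obj_coslice functor_Tgt[OF U(2)])
    then have "\<exists>!H. functor_between H (Tgt r) (Tgt U) \<and> comp_func H r = U \<and> amap H f = g"
      using r by blast
    then have ex1H: "\<exists>!H. functor_between H (Tgt r) D \<and> comp_func H r = U \<and> amap H f = g"
      by (simp add: functor_Tgt[OF U(2)])
    have *: "amap H f = g" if H: "functor_between H (Tgt r) D" "comp_func H r = U" for H
    proof -
      have "comp_func H (comp_func r i) = F"
        using comp_func_assoc[OF i_fun r_fun H(1)] H(2) U(3) by simp
      then have "fills S \<alpha> F y (\<lambda>j. amap H (amap r (cmp \<gamma> j))) (amap H f)"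
        using c.fills_whisker[OF ri_fun y f H(1)] by simp
      moreover have "amap H (amap r (cmp \<gamma> j)) = ?p j" if "j \<in> Obj c.I" for j
        using c.is_nat_family[OF i_fun y \<gamma>] that comp_func_amap[OF r_fun, of "cmp \<gamma> j" H] H(2)
        by (simp add: family_def Let_def Hom_iff)
      ultimately have "fills S \<alpha> F y ?p (amap H f)"
        by (simp add: fills_def)
      then show ?thesis
        using ex1 g by blast
    qed
    have d_iff: "d \<in> Hom (coslice E) (comp_func r i) F \<and> Comp (coslice E) d h = u \<and>
        Comp (coslice E) ?g d = v \<longleftrightarrow>
        (\<exists>H. d = (comp_func r i, F, H) \<and> functor_between H (Tgt r) D \<and> comp_func H r = U)" for d
    proof
      assume d: "d \<in> Hom (coslice E) (comp_func r i) F \<and> Comp (coslice E) d h = u \<and> Comp (coslice E) ?g d = v"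
      then obtain H where "d = (comp_func r i, F, H)" "functor_between H (Tgt r) D"
        by (auto simp: Hom_coslice)
      then show "\<exists>H. d = (comp_func r i, F, H) \<and> functor_between H (Tgt r) D \<and> comp_func H r = U"
        using d by (auto simp: h U(1))
    next
      assume "\<exists>H. d = (comp_func r i, F, H) \<and> functor_between H (Tgt r) D \<and> comp_func H r = U"
      then obtain H where H: "d = (comp_func r i, F, H)" "functor_between H (Tgt r) D" "comp_func H r = U"
        by blast
      have "comp_func H (comp_func r i) = F"
        using comp_func_assoc[OF i_fun r_fun H(2)] H(3) U(3) by simp
      moreover have "comp_func (to_terminal D) H = V"
        using comp_func_between[OF H(2) to_terminal[OF functor_Tgt_cat[OF F]]] V(2)
        by (rule functor_terminal_eq)
      ultimately show "d \<in> Hom (coslice E) (comp_func r i) F \<and> Comp (coslice E) d h = u \<and>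
          Comp (coslice E) ?g d = v"
        using H ri F_obj by (simp add: Hom_coslice h U(1) V(1))
    qed
    show "\<exists>!d. d \<in> Hom (coslice E) (Cod (coslice E) h) (Dom (coslice E) ?g) \<and>
        Comp (coslice E) d h = u \<and> Comp (coslice E) ?g d = v"
      using ex1H * unfolding h coslice_simps(1,2) d_iff[unfolded h] by blast
  qed
qed

text \<open>Orthogonality of L to the terminal map of F, applied to the square with top F, has
  exactly the extensions of F along L as diagonals.\<close>

lemma right_lift:
  assumes F: "functor_between F E D" and D: "small_category D"
    and right: "(F, to_terminal E, to_terminal D) \<in> Rcls S"
  shows "\<exists>!H. functor_between H P D \<and> comp_func H L = F"
proof -
  let ?C = "coslice E" and ?l = "(id_func E, L, L)" and ?g = "(F, to_terminal E, to_terminal D)"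
  have objs: "id_func E \<in> Obj ?C" "F \<in> Obj ?C" "L \<in> Obj ?C" and T: "Tgt F = D" "Tgt L = P"
    using F D L small_P id_func_between[OF catE] small_E
    by (simp_all add: Obj_coslice functor_Tgt)
  have P: "(L, to_terminal E, to_terminal P) \<in> Hom ?C L (to_terminal E)"
    and g: "?g \<in> Hom ?C F (to_terminal E)"
    using to_terminal_coslice[OF univ] L F D small_P by simp_all
  have "comp_func (to_terminal P) L = comp_func (to_terminal D) F"
    using comp_func_between[OF L to_terminal[OF catP]]
      comp_func_between[OF F to_terminal[OF functor_Tgt_cat[OF F]]] by (rule functor_terminal_eq)
  moreover have "?l \<in> Hom ?C (id_func E) L" "(id_func E, F, F) \<in> Hom ?C (id_func E) F"
    using objs L F T comp_func_id by (auto simp: Hom_coslice)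
  ultimately have "comm_square ?C ?l ?g (id_func E, F, F) (L, to_terminal E, to_terminal P)"
    using P g by (simp add: comm_square_def Hom_iff)
  moreover have "orthogonal ?C ?l ?g"
    using L_left right by (simp add: Lcls_def left_orth_def)
  ultimately have ex1: "\<exists>!d. d \<in> Hom ?C L F \<and> Comp ?C d ?l = (id_func E, F, F) \<and>
      Comp ?C ?g d = (L, to_terminal E, to_terminal P)"
    unfolding orthogonal_def by (simp only: coslice_simps)
  have d_iff: "d \<in> Hom ?C L F \<and> Comp ?C d ?l = (id_func E, F, F) \<and>
      Comp ?C ?g d = (L, to_terminal E, to_terminal P) \<longleftrightarrow>
      (\<exists>H. d = (L, F, H) \<and> functor_between H P D \<and> comp_func H L = F)" for d
  proof -
    have "comp_func (to_terminal D) H = to_terminal P" if "functor_between H P D" for H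
      using comp_func_between[OF that to_terminal[OF functor_Tgt_cat[OF F]]] to_terminal[OF catP]
      by (rule functor_terminal_eq)
    then show ?thesis
      using objs T by (auto simp: Hom_coslice)
  qed
  show ?thesis
    using ex1 unfolding d_iff by blast
qed

theorem universal_property:
  assumes "functor_between F E D" "small_category D" "sharp S F"
  shows "\<exists>!H. functor_between H P D \<and> comp_func H L = F"
  using assms by (intro right_lift sharp_right)

text \<open>The argument of \<open>sharp_right\<close> read backwards: p determines U by initiality
  of E[y;\<alpha>], and orthogonality of r to the terminal map of L gives exactly one extension of U
  along r.\<close>

lemma sharp_L: "sharp S L"
  unfolding sharp_def
proof (intro ballI allI impI)
  fix \<alpha> y p assume \<alpha>: "\<alpha> \<in> names S" and y: "y \<in> Obj E" and p: "family S \<alpha> L y p"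
  interpret c: sketch_cone S \<alpha>
    using S \<alpha> by unfold_locales
  have L_obj: "L \<in> Obj (coslice E)" and TL: "Tgt L = P"
    using L small_P by (simp_all add: Obj_coslice functor_Tgt)
  obtain i \<gamma> where i: "initial (triples S y \<alpha>) (i, \<gamma>)"
    using c.ex_initial_triples[OF univ y] by blast
  have i_fun: "functor_between i E (Tgt i)" and small_i: "small_category (Tgt i)"
    and i_obj: "i \<in> Obj (coslice E)"
    and \<gamma>: "is_nat \<gamma> (comp_func i (const_func c.I E y)) (comp_func i c.\<phi>)"
    using i by (auto simp: c.initial_triples Obj_coslice)
  note \<gamma>_fam = c.is_nat_family[OF i_fun y \<gamma>]
  obtain r f where r: "initial (adjunctions S y \<alpha> i \<gamma>) (r, f)"
    using c.ex_initial_adjunctions[OF univ y i_fun small_i \<gamma>_fam] by blast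
  note r' = r[unfolded c.initial_adjunctions[OF i_fun y]]
  have r_fun: "functor_between r (Tgt i) (Tgt r)" and small_r: "small_category (Tgt r)"
    and f: "fills S \<alpha> (comp_func r i) y (\<lambda>j. amap r (cmp \<gamma> j)) f"
    using r' by (auto simp: Obj_coslice)
  have ri_fun: "functor_between (comp_func r i) E (Tgt r)"
    using i_fun r_fun by (rule comp_func_between)
  have ri_obj: "comp_func r i \<in> Obj (coslice E)"
    using ri_fun small_r by (simp add: Obj_coslice)
  note nt = c.is_nat_family_nt[OF L y p]
  \<comment> \<open>U classifies the given family: it sends the universal \<gamma> to p.\<close>
  obtain U where U: "functor_between U (Tgt i) P" "comp_func U i = L"
      "whisker U \<gamma> = family_nt S \<alpha> L y p"
    using i L_obj nt TL unfolding c.initial_triples by metis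
  have Up: "amap U (cmp \<gamma> j) = p j" if "j \<in> Obj c.I" for j
  proof -
    have "\<forall>j\<in>Obj c.I. amap U (cmp \<gamma> j) = cmp (family_nt S \<alpha> L y p) j"
      using c.is_nat_whisker_eq[OF i_fun y \<gamma> U(1), unfolded U(2), OF nt] U(3) by blast
    then show ?thesis using that by (simp add: family_nt_def Let_def)
  qed
  let ?C = "coslice E" and ?g = "(L, to_terminal E, to_terminal P)"
  let ?h = "(i, comp_func r i, r)"
  have "?h \<in> Xi S"
    unfolding Xi_def using y \<alpha> i r by blast
  then have orth: "orthogonal ?C ?h ?g"
    using P_right by (auto simp: Rcls_def right_orth_def)
  let ?u = "(i, L, U)" and ?v = "(comp_func r i, to_terminal E, to_terminal (Tgt r))"
  have "?h \<in> Hom ?C i (comp_func r i)" "?u \<in> Hom ?C i L"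
    using i_obj ri_obj r_fun L_obj U TL by (simp_all add: Hom_coslice)
  moreover have "?g \<in> Hom ?C L (to_terminal E)" "?v \<in> Hom ?C (comp_func r i) (to_terminal E)"
    using to_terminal_coslice[OF univ] L small_P ri_fun small_r by simp_all
  moreover have "comp_func (to_terminal (Tgt r)) r = comp_func (to_terminal P) U"
    using comp_func_between[OF r_fun to_terminal[OF functor_Tgt_cat[OF r_fun]]]
      comp_func_between[OF U(1) to_terminal[OF catP]] by (rule functor_terminal_eq)
  ultimately have "comm_square ?C ?h ?g ?u ?v"
    by (simp add: comm_square_def Hom_iff)
  then have ex1: "\<exists>!d. d \<in> Hom ?C (comp_func r i) L \<and> Comp ?C d ?h = ?u \<and> Comp ?C ?g d = ?v"
    using orth unfolding orthogonal_def by (simp only: coslice_simps)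
  have d: "(comp_func r i, L, H) \<in> Hom ?C (comp_func r i) L \<and>
      Comp ?C (comp_func r i, L, H) ?h = ?u \<and> Comp ?C ?g (comp_func r i, L, H) = ?v"
    if H: "functor_between H (Tgt r) P" "comp_func H r = U" for H
  proof -
    have "comp_func H (comp_func r i) = L"
      using comp_func_assoc[OF i_fun r_fun H(1)] H(2) U(2) by simp
    moreover have "comp_func (to_terminal P) H = to_terminal (Tgt r)"
      using comp_func_between[OF H(1) to_terminal[OF catP]] to_terminal[OF functor_Tgt_cat[OF r_fun]]
      by (rule functor_terminal_eq)
    ultimately show ?thesis
      using H ri_obj L_obj TL by (simp add: Hom_coslice)
  qed
  show "\<exists>!g. fills S \<alpha> L y p g"
  proof (rule ex_ex1I)
    obtain d where "d \<in> Hom ?C (comp_func r i) L" "Comp ?C d ?h = ?u"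
      using ex1_implies_ex[OF ex1] by (elim exE conjE)
    then obtain H where H: "functor_between H (Tgt r) P" "comp_func H r = U"
      using TL by (auto simp: Hom_coslice)
    have "comp_func H (comp_func r i) = L"
      using comp_func_assoc[OF i_fun r_fun H(1)] H(2) U(2) by simp
    then have "fills S \<alpha> L y (\<lambda>j. amap H (amap r (cmp \<gamma> j))) (amap H f)"
      using c.fills_whisker[OF ri_fun y f H(1)] by simp
    moreover have "amap H (amap r (cmp \<gamma> j)) = p j" if "j \<in> Obj c.I" for j
      using \<gamma>_fam that comp_func_amap[OF r_fun, of "cmp \<gamma> j" H] H(2) Up[OF that]
      by (simp add: family_def Let_def Hom_iff)
    ultimately have "fills S \<alpha> L y p (amap H f)"
      by (simp add: fills_def)
    then show "\<exists>g. fills S \<alpha> L y p g" by blast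
  next
    fix g g' assume g: "fills S \<alpha> L y p g" and g': "fills S \<alpha> L y p g'"
    \<comment> \<open>Every filler is the value at f of some extension of U, so uniqueness of the
      extension gives uniqueness of the filler.\<close>
    have lift: "\<exists>H. functor_between H (Tgt r) P \<and> comp_func H r = U \<and> amap H f = g"
      if "fills S \<alpha> L y p g" for g
    proof -
      have "fills S \<alpha> (comp_func U i) y (\<lambda>j. amap U (cmp \<gamma> j)) g"
        using that U(2) Up by (simp add: fills_def)
      moreover have "U \<in> Obj (coslice (Tgt i))"
        using U(1) small_P by (simp add: Obj_coslice functor_Tgt)
      ultimately have "\<exists>!H. functor_between H (Tgt r) (Tgt U) \<and> comp_func H r = U \<and> amap H f = g"
        using r' by blast
      then show ?thesis
        unfolding functor_Tgt[OF U(1)] by (rule ex1_implies_ex)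
    qed
    obtain H where H: "functor_between H (Tgt r) P" "comp_func H r = U" "amap H f = g"
      using lift[OF g] by blast
    obtain H' where H': "functor_between H' (Tgt r) P" "comp_func H' r = U" "amap H' f = g'"
      using lift[OF g'] by blast
    have "(comp_func r i, L, H) = (comp_func r i, L, H')"
      using ex1 d[OF H(1,2)] d[OF H'(1,2)] by blast
    then show "g = g'" using H H' by simp
  qed
qed

text \<open>The universal property of \<open>P\<close> provides a section of the inclusion of the subcategory \<open>N\<close>.\<close>

lemma Fib_induct:
  assumes N: "N \<subseteq> Arr P"
    and L_N: "\<And>f. f \<in> Arr E \<Longrightarrow> amap L f \<in> N"
    and comp: "\<And>f g x y z. \<lbrakk>f \<in> N; g \<in> N; f \<in> Hom P x y; g \<in> Hom P y z\<rbrakk> \<Longrightarrow> Comp P g f \<in> N"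
    and fill: "\<And>\<alpha> y u. \<lbrakk>\<alpha> \<in> names S; y \<in> Obj E; u \<in> Hom P (omap L y) (omap L (vertex (cones S \<alpha>)));
      \<And>j. j \<in> Obj (index (cones S \<alpha>)) \<Longrightarrow> Comp P (amap L (cmp (legs (cones S \<alpha>)) j)) u \<in> N\<rbrakk>
      \<Longrightarrow> u \<in> N"
    and f: "f \<in> Arr P"
  shows "f \<in> N" "Dom P f \<in> omap L ` Obj E"
proof -
  let ?X = "omap L ` Obj E"
  \<comment> \<open>Cutting the objects down to the image of L yields the second conclusion, and
    with it surjectivity, from the same argument.\<close>
  let ?N = "{f \<in> N. Dom P f \<in> ?X \<and> Cod P f \<in> ?X}"
  \<comment> \<open>Identities require no closure assumption: on the objects kept, they are images
    of identities of E.\<close>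
  have ide: "Ide P (omap L x) \<in> N" if "x \<in> Obj E" for x
    using L_N[of "Ide E x"] functor_ide[OF L that] Hom_ide[OF catE that] by (simp add: Hom_iff)
  interpret sub: subcategory P ?X ?N
  proof
    show "Comp P g f \<in> ?N" if "f \<in> ?N" "g \<in> ?N" "Cod P f = Dom P g" for f g
    proof -
      have "f \<in> Hom P (Dom P f) (Dom P g)" "g \<in> Hom P (Dom P g) (Cod P g)"
        using that N by (auto simp: Hom_iff)
      then have "Comp P g f \<in> N" "Comp P g f \<in> Hom P (Dom P f) (Cod P g)"
        using comp[of f g] Hom_comp[OF catP, of f _ _ g] that by auto
      then show ?thesis using that by (simp add: Hom_iff)
    qed
    show "Ide P x \<in> ?N" if "x \<in> ?X" for x
      using that ide Hom_ide[OF catP functor_obj[OF L]] by (auto simp: Hom_iff)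
  qed (use small_P N functor_obj[OF L] in auto)
  let ?D = "subcat P ?X ?N" and ?L = "L\<lparr>Tgt := subcat P ?X ?N\<rparr>"
  have arr_N: "amap L f \<in> ?N" if "f \<in> Arr E" for f
    using L_N[OF that] functor_Hom[OF L arr_Hom[OF that]] Hom_dom[OF catE arr_Hom[OF that]]
      Hom_cod[OF catE arr_Hom[OF that]] by (simp add: Hom_iff)
  note core = sub.corestriction[OF L imageI arr_N]
  have "sharp S ?L"
    unfolding sharp_def
  proof (intro ballI allI impI)
    fix \<alpha> y p assume \<alpha>: "\<alpha> \<in> names S" and y: "y \<in> Obj E" and p: "family S \<alpha> ?L y p"
    interpret c: sketch_cone S \<alpha>
      using S \<alpha> by unfold_locales
    have TL [simp]: "Tgt L = P"
      using L by (rule functor_Tgt)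
    have pN: "p j \<in> ?N" if "j \<in> Obj c.I" for j
      using p that by (simp add: family_def Let_def sub.Hom_subcat)
    have L\<delta>: "amap L (c.\<delta> j) \<in> Hom ?D (omap L c.x) (omap L (omap c.\<phi> j))" if "j \<in> Obj c.I" for j
      using functor_Hom[OF core(1) c.\<delta>[OF that]] by simp
    have fills: "fills S \<alpha> ?L y p g \<longleftrightarrow> fills S \<alpha> L y p g" for g
    proof
      assume g: "fills S \<alpha> ?L y p g"
      then have "g \<in> Hom ?D (omap L y) (omap L c.x)" by (simp add: fills_def)
      then show "fills S \<alpha> L y p g"
        using g sub.Comp_subcat[OF _ L\<delta>] by (auto simp: fills_def sub.Hom_subcat)
    next
      assume g: "fills S \<alpha> L y p g"
      then have gP: "g \<in> Hom P (omap L y) (omap L c.x)" by (simp add: fills_def)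
      \<comment> \<open>A filler composed with the legs gives the arrows p j, which lie in N. So
        \<open>fill\<close> keeps the filler in the subcategory, and sharpness there reduces to
        sharpness of L.\<close>
      have "g \<in> N"
        using \<alpha> y gP by (rule fill) (use g pN in \<open>simp add: fills_def\<close>)
      then have gD: "g \<in> Hom ?D (omap L y) (omap L c.x)"
        using gP y c.x by (simp add: sub.Hom_subcat) (simp add: Hom_iff)
      then show "fills S \<alpha> ?L y p g"
        using g sub.Comp_subcat[OF gD L\<delta>] by (simp add: fills_def)
    qed
    have "Comp P (amap L (amap c.\<phi> u)) (p j) = p k" if u: "u \<in> Hom c.I j k" for u j k
    proof -
      have j: "j \<in> Obj c.I"
        using Hom_dom[OF c.catI u] .
      have "amap L (amap c.\<phi> u) \<in> Hom ?D (omap L (omap c.\<phi> j)) (omap L (omap c.\<phi> k))"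
        using functor_Hom[OF core(1) functor_Hom[OF c.\<phi> u]] by simp
      moreover have "p j \<in> Hom ?D (omap L y) (omap L (omap c.\<phi> j))"
        using p j by (simp add: family_def Let_def)
      ultimately show ?thesis
        using sub.Comp_subcat p u by (fastforce simp: family_def Let_def)
    qed
    moreover have "p j \<in> Hom P (omap L y) (omap L (omap c.\<phi> j))" if "j \<in> Obj c.I" for j
      using p that by (simp add: family_def Let_def sub.Hom_subcat)
    ultimately have "family S \<alpha> L y p"
      by (simp add: family_def Let_def)
    then show "\<exists>!g. fills S \<alpha> ?L y p g"
      using sharp_L \<alpha> y unfolding fills sharp_def by blast
  qed
  then obtain H where H: "functor_between H P ?D" "comp_func H L = ?L"
    using universal_property[OF core(1) sub.small_subcat] by blast
  \<comment> \<open>The inclusion after H extends L along itself, as the identity does. Hence they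
    coincide, and f equals its image under H, which lies in the subcategory.\<close>
  have "comp_func (comp_func sub.inclusion H) L = L"
    using comp_func_assoc[OF L H(1) sub.inclusion] H(2) core(2) by simp
  moreover have "functor_between (comp_func sub.inclusion H) P P"
    using H(1) sub.inclusion by (rule comp_func_between)
  ultimately have "comp_func sub.inclusion H = id_func P"
    using universal_property[OF L small_P sharp_L] id_func_between[OF catP] id_comp_func[OF L] by blast
  then have "f = amap sub.inclusion (amap H f)"
    using comp_func_amap[OF H(1) f, of sub.inclusion] f by simp
  moreover have "amap H f \<in> ?N"
    using functor_arr[OF H(1) f] by simp
  ultimately have "f \<in> ?N" by simp
  then show "f \<in> N" "Dom P f \<in> omap L ` Obj E" by simp_all
qed

text \<open>Taking N to be all arrows leaves only the claim on domains, which is then applied to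
  identities.\<close>

lemma L_surj: "omap L ` Obj E = Obj P"
proof
  show "omap L ` Obj E \<subseteq> Obj P"
    using functor_obj[OF L] by blast
  have "Dom P f \<in> omap L ` Obj E" if f: "f \<in> Arr P" for f
    by (rule Fib_induct(2)[of "Arr P"]) (use f functor_arr[OF L] Hom_comp[OF catP] in \<open>auto simp: Hom_iff\<close>)
  then show "Obj P \<subseteq> omap L ` Obj E"
    using Hom_ide[OF catP] by (metis Hom_iff subsetI)
qed

text \<open>Every cone in a codiscrete category is a limit, so the map to the codiscrete category on the
  objects of \<open>E\<close> extends to \<open>P\<close>.\<close>

lemma L_inj: "inj_on (omap L) (Obj E)"
proof -
  obtain c :: "'u \<times> 'u \<Rightarrow> 'u" where c: "inj c"
    using ex_inj_pair[OF univ] by blast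
  let ?D = "codisc c (Obj E)"
  let ?F = "\<lparr>Src = E, Tgt = ?D, omap = (\<lambda>x\<in>Obj E. x), amap = (\<lambda>f\<in>Arr E. c (Dom E f, Cod E f))\<rparr>"
  have F: "functor_between ?F E ?D"
  proof (rule functor_betweenI)
    show "amap ?F f \<in> Hom ?D (omap ?F x) (omap ?F y)" if "f \<in> Hom E x y" for f x y
      using that Hom_dom[OF catE that] Hom_cod[OF catE that]
      by (simp add: Hom_codisc[OF c]) (simp add: Hom_iff)
    show "amap ?F (Ide E x) = Ide ?D (omap ?F x)" if "x \<in> Obj E" for x
      using that Hom_ide[OF catE that] by (simp add: codisc_simps[OF c] Hom_iff)
    show "amap ?F (Comp E g f) = Comp ?D (amap ?F g) (amap ?F f)"
      if "f \<in> Hom E x y" "g \<in> Hom E y z" for f g x y z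
      using Comp_codisc[OF c Hom_dom[OF catE that(1)] Hom_dom[OF catE that(2)] Hom_cod[OF catE that(2)]]
        that Hom_comp[OF catE that] by (simp add: Hom_iff)
  qed (use catE category_codisc[OF c] in \<open>simp_all add: codisc_simps[OF c]\<close>)
  have "sharp S ?F"
    unfolding sharp_def
  proof (intro ballI allI impI)
    fix \<alpha> y p assume \<alpha>: "\<alpha> \<in> names S" and y: "y \<in> Obj E" and p: "family S \<alpha> ?F y p"
    interpret sk: sketch_cone S \<alpha>
      using S \<alpha> by unfold_locales
    have "Comp ?D (c (sk.x, omap sk.\<phi> j)) (c (y, sk.x)) = c (y, omap sk.\<phi> j)" if "j \<in> Obj sk.I" for j
      using Comp_codisc[OF c y sk.x functor_obj[OF sk.\<phi> that]] .
    moreover have "amap ?F (sk.\<delta> j) = c (sk.x, omap sk.\<phi> j)" if "j \<in> Obj sk.I" for j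
      using sk.\<delta>[OF that] by (simp add: Hom_iff)
    moreover have "p j = c (y, omap sk.\<phi> j)" if "j \<in> Obj sk.I" for j
      using p that y functor_obj[OF sk.\<phi> that] by (simp add: family_def Let_def Hom_codisc[OF c])
    \<comment> \<open>Between two objects there is one arrow only, so there is one candidate for a
      filler, and all its equations hold.\<close>
    ultimately have "fills S \<alpha> ?F y p g \<longleftrightarrow> g = c (y, sk.x)" for g
      using y sk.x by (auto simp: fills_def Hom_codisc[OF c] restrict_apply' simp del: restrict_apply)
    then show "\<exists>!g. fills S \<alpha> ?F y p g" by simp
  qed
  moreover have "small_category ?D"
    using small_E by (intro small_codisc[OF c univ]) (simp add: small_category_def)
  ultimately obtain H where "comp_func H L = ?F"
    using universal_property[OF F] by blast
  \<comment> \<open>?F is the identity on objects, so H is a left inverse of L there.\<close>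
  then have "omap H (omap L x) = x" if "x \<in> Obj E" for x
    using comp_func_omap[OF L that, of H] that by simp
  then show ?thesis by (metis inj_onI)
qed

end

subsection \<open>Composition of natural transformations\<close>

lemma is_nat_id_nt:
  assumes F: "functor_between F C D"
  shows "is_nat (id_nt F) F F"
proof (rule natI[OF F F])
  show "cmp (id_nt F) x \<in> Hom D (omap F x) (omap F x)" if "x \<in> Obj C" for x
    using that Hom_ide[OF functor_Tgt_cat[OF F] functor_obj[OF F that]]
    by (simp add: id_nt_def functor_Src[OF F] functor_Tgt[OF F])
  show "Comp D (cmp (id_nt F) y) (amap F f) = Comp D (amap F f) (cmp (id_nt F) x)"
    if f: "f \<in> Hom C x y" for f x y
    using Hom_dom[OF functor_Src_cat[OF F] f] Hom_cod[OF functor_Src_cat[OF F] f]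
      comp_ide[OF functor_Tgt_cat[OF F] functor_Hom[OF F f]]
      ide_comp[OF functor_Tgt_cat[OF F] functor_Hom[OF F f]]
    by (simp add: id_nt_def functor_Src[OF F] functor_Tgt[OF F])
qed (simp_all add: id_nt_def functor_Src[OF F])

lemma cmp_id_nt: "functor_between F C D \<Longrightarrow> x \<in> Obj C \<Longrightarrow> cmp (id_nt F) x = Ide D (omap F x)"
  by (simp add: id_nt_def functor_Src functor_Tgt)

lemma cmp_vcomp_nt:
  "\<lbrakk>is_nat \<sigma> F G; functor_between F C D; x \<in> Obj C\<rbrakk> \<Longrightarrow>
    cmp (vcomp_nt \<tau> \<sigma>) x = Comp D (cmp \<tau> x) (cmp \<sigma> x)"
  by (simp add: vcomp_nt_def nat_functors(3) functor_Src functor_Tgt)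

lemma cmp_hcomp_nt:
  "\<lbrakk>is_nat \<sigma> F G; functor_between F C D; is_nat \<tau> F' G'; functor_between F' D D'; x \<in> Obj C\<rbrakk> \<Longrightarrow>
    cmp (hcomp_nt \<tau> \<sigma>) x = Comp D' (cmp \<tau> (omap G x)) (amap F' (cmp \<sigma> x))"
  by (simp add: hcomp_nt_def nat_functors(3,4) functor_Src functor_Tgt)

lemma is_nat_vcomp_nt:
  assumes \<sigma>: "is_nat \<sigma> F G" and \<tau>: "is_nat \<tau> G H" and F: "functor_between F C D"
  shows "is_nat (vcomp_nt \<tau> \<sigma>) F H"
proof (rule natI)
  note G = nat_cod_functor[OF \<sigma> F]
  note H = nat_cod_functor[OF \<tau> G]
  note D = functor_Tgt_cat[OF F]
  show "functor_between F C D" "functor_between H C D" by fact+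
  show "cmp (vcomp_nt \<tau> \<sigma>) x \<in> Hom D (omap F x) (omap H x)" if "x \<in> Obj C" for x
    using Hom_comp[OF D nat_Hom[OF \<sigma> F that] nat_Hom[OF \<tau> G that]] that
    by (simp add: cmp_vcomp_nt[OF \<sigma> F])
  show "Comp D (cmp (vcomp_nt \<tau> \<sigma>) y) (amap F f) = Comp D (amap H f) (cmp (vcomp_nt \<tau> \<sigma>) x)"
    if f: "f \<in> Hom C x y" for f x y
  proof -
    have xy: "x \<in> Obj C" "y \<in> Obj C"
      using Hom_dom[OF functor_Src_cat[OF F] f] Hom_cod[OF functor_Src_cat[OF F] f] by simp_all
    note h = nat_Hom[OF \<sigma> F xy(1)] nat_Hom[OF \<sigma> F xy(2)] nat_Hom[OF \<tau> G xy(1)] nat_Hom[OF \<tau> G xy(2)]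
    show ?thesis
      using comp_assoc[OF D functor_Hom[OF F f] h(2,4)] nat_naturality[OF \<sigma> F f]
        comp_assoc[OF D h(1) functor_Hom[OF G f] h(4)] nat_naturality[OF \<tau> G f]
        comp_assoc[OF D h(1,3) functor_Hom[OF H f]] xy
      by (simp add: cmp_vcomp_nt[OF \<sigma> F])
  qed
qed (use nat_functors[OF \<sigma>] nat_functors[OF \<tau>] functor_Src[OF F] in \<open>simp_all add: vcomp_nt_def\<close>)

text \<open>Paste the image under F' of the naturality square of \<sigma> at f with the naturality
  square of \<tau> at G f.\<close>

lemma is_nat_hcomp_nt:
  assumes \<sigma>: "is_nat \<sigma> F G" and F: "functor_between F C D"
    and \<tau>: "is_nat \<tau> F' G'" and F': "functor_between F' D D'"
  shows "is_nat (hcomp_nt \<tau> \<sigma>) (comp_func F' F) (comp_func G' G)"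
proof (rule natI)
  note G = nat_cod_functor[OF \<sigma> F]
  note G' = nat_cod_functor[OF \<tau> F']
  note D' = functor_Tgt_cat[OF F']
  show "functor_between (comp_func F' F) C D'" "functor_between (comp_func G' G) C D'"
    using F F' G G' comp_func_between by blast+
  have h: "amap F' (cmp \<sigma> x) \<in> Hom D' (omap F' (omap F x)) (omap F' (omap G x))"
    "cmp \<tau> (omap G x) \<in> Hom D' (omap F' (omap G x)) (omap G' (omap G x))" if "x \<in> Obj C" for x
    using functor_Hom[OF F' nat_Hom[OF \<sigma> F that]] nat_Hom[OF \<tau> F' functor_obj[OF G that]] .
  show "cmp (hcomp_nt \<tau> \<sigma>) x \<in> Hom D' (omap (comp_func F' F) x) (omap (comp_func G' G) x)"
    if "x \<in> Obj C" for x
    using Hom_comp[OF D' h[OF that]] that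
    by (simp add: cmp_hcomp_nt[OF \<sigma> F \<tau> F'] functor_Src[OF F] functor_Src[OF G])
  show "Comp D' (cmp (hcomp_nt \<tau> \<sigma>) y) (amap (comp_func F' F) f) =
      Comp D' (amap (comp_func G' G) f) (cmp (hcomp_nt \<tau> \<sigma>) x)" if f: "f \<in> Hom C x y" for f x y
  proof -
    have xy: "x \<in> Obj C" "y \<in> Obj C"
      using Hom_dom[OF functor_Src_cat[OF F] f] Hom_cod[OF functor_Src_cat[OF F] f] by simp_all
    have F'F: "amap F' (amap F f) \<in> Hom D' (omap F' (omap F x)) (omap F' (omap F y))"
      and F'G: "amap F' (amap G f) \<in> Hom D' (omap F' (omap G x)) (omap F' (omap G y))"
      and G'G: "amap G' (amap G f) \<in> Hom D' (omap G' (omap G x)) (omap G' (omap G y))"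
      using functor_Hom[OF F' functor_Hom[OF F f]] functor_Hom[OF F' functor_Hom[OF G f]]
        functor_Hom[OF G' functor_Hom[OF G f]] .
    have "Comp D' (amap F' (cmp \<sigma> y)) (amap F' (amap F f)) =
        Comp D' (amap F' (amap G f)) (amap F' (cmp \<sigma> x))"
      using functor_comp[OF F' functor_Hom[OF F f] nat_Hom[OF \<sigma> F xy(2)]]
        functor_comp[OF F' nat_Hom[OF \<sigma> F xy(1)] functor_Hom[OF G f]] nat_naturality[OF \<sigma> F f]
      by simp
    moreover have "Comp D' (cmp \<tau> (omap G y)) (amap F' (amap G f)) =
        Comp D' (amap G' (amap G f)) (cmp \<tau> (omap G x))"
      using nat_naturality[OF \<tau> F' functor_Hom[OF G f]] .
    ultimately show ?thesis
      using comp_assoc[OF D' F'F h[OF xy(2)]] comp_assoc[OF D' h(1)[OF xy(1)] F'G h(2)[OF xy(2)]]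
        comp_assoc[OF D' h[OF xy(1)] G'G] xy f
      by (simp add: cmp_hcomp_nt[OF \<sigma> F \<tau> F'] functor_Src[OF F] functor_Src[OF G] Hom_iff)
  qed
qed (use nat_functors[OF \<sigma>] nat_functors[OF \<tau>] functor_Src[OF F] in \<open>simp_all add: hcomp_nt_def\<close>)

lemma vcomp_nt_assoc:
  assumes \<rho>: "is_nat \<rho> F G" and \<sigma>: "is_nat \<sigma> G H" and \<tau>: "is_nat \<tau> H K" and F: "functor_between F C D"
  shows "vcomp_nt \<tau> (vcomp_nt \<sigma> \<rho>) = vcomp_nt (vcomp_nt \<tau> \<sigma>) \<rho>"
proof (rule nat_eqI)
  note G = nat_cod_functor[OF \<rho> F]
  note H = nat_cod_functor[OF \<sigma> G]
  show "is_nat (vcomp_nt \<tau> (vcomp_nt \<sigma> \<rho>)) F K" "is_nat (vcomp_nt (vcomp_nt \<tau> \<sigma>) \<rho>) F K"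
    using \<rho> \<sigma> \<tau> F G is_nat_vcomp_nt by blast+
  show "cmp (vcomp_nt \<tau> (vcomp_nt \<sigma> \<rho>)) x = cmp (vcomp_nt (vcomp_nt \<tau> \<sigma>) \<rho>) x" if x: "x \<in> Obj C" for x
    using comp_assoc[OF functor_Tgt_cat[OF F] nat_Hom[OF \<rho> F x] nat_Hom[OF \<sigma> G x] nat_Hom[OF \<tau> H x]] x
    by (simp add: cmp_vcomp_nt[OF is_nat_vcomp_nt[OF \<rho> \<sigma> F] F] cmp_vcomp_nt[OF \<rho> F] cmp_vcomp_nt[OF \<sigma> G])
qed (rule F)

lemma
  assumes \<sigma>: "is_nat \<sigma> F G" and F: "functor_between F C D"
  shows vcomp_nt_id: "vcomp_nt \<sigma> (id_nt F) = \<sigma>" and id_vcomp_nt: "vcomp_nt (id_nt G) \<sigma> = \<sigma>"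
proof -
  note G = nat_cod_functor[OF \<sigma> F]
  note idF = is_nat_id_nt[OF F]
  have "cmp (vcomp_nt \<sigma> (id_nt F)) x = cmp \<sigma> x" "cmp (vcomp_nt (id_nt G) \<sigma>) x = cmp \<sigma> x"
    if x: "x \<in> Obj C" for x
    using x comp_ide[OF functor_Tgt_cat[OF F] nat_Hom[OF \<sigma> F x]]
      ide_comp[OF functor_Tgt_cat[OF F] nat_Hom[OF \<sigma> F x]]
    by (simp_all add: cmp_vcomp_nt[OF idF F] cmp_vcomp_nt[OF \<sigma> F] cmp_id_nt[OF F] cmp_id_nt[OF G])
  then show "vcomp_nt \<sigma> (id_nt F) = \<sigma>" "vcomp_nt (id_nt G) \<sigma> = \<sigma>"
    using nat_eqI[OF is_nat_vcomp_nt[OF idF \<sigma> F] \<sigma> F]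
      nat_eqI[OF is_nat_vcomp_nt[OF \<sigma> is_nat_id_nt[OF G] F] \<sigma> F] by blast+
qed

text \<open>Besides associativity of composition this uses that F3 preserves the composite occurring
  in a component of the inner cell.\<close>

lemma hcomp_nt_assoc:
  assumes \<rho>: "is_nat \<rho> F1 G1" and F1: "functor_between F1 A B"
    and \<sigma>: "is_nat \<sigma> F2 G2" and F2: "functor_between F2 B C"
    and \<tau>: "is_nat \<tau> F3 G3" and F3: "functor_between F3 C D"
  shows "hcomp_nt \<tau> (hcomp_nt \<sigma> \<rho>) = hcomp_nt (hcomp_nt \<tau> \<sigma>) \<rho>"
proof (rule nat_eqI)
  note G1 = nat_cod_functor[OF \<rho> F1]
  note G2 = nat_cod_functor[OF \<sigma> F2]
  note G3 = nat_cod_functor[OF \<tau> F3]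
  note \<sigma>\<rho> = is_nat_hcomp_nt[OF \<rho> F1 \<sigma> F2]
  note \<tau>\<sigma> = is_nat_hcomp_nt[OF \<sigma> F2 \<tau> F3]
  note F21 = comp_func_between[OF F1 F2]
  note F32 = comp_func_between[OF F2 F3]
  show "is_nat (hcomp_nt \<tau> (hcomp_nt \<sigma> \<rho>)) (comp_func F3 (comp_func F2 F1)) (comp_func G3 (comp_func G2 G1))"
    using is_nat_hcomp_nt[OF \<sigma>\<rho> F21 \<tau> F3] .
  show "is_nat (hcomp_nt (hcomp_nt \<tau> \<sigma>) \<rho>) (comp_func F3 (comp_func F2 F1)) (comp_func G3 (comp_func G2 G1))"
    using is_nat_hcomp_nt[OF \<rho> F1 \<tau>\<sigma> F32] comp_func_assoc[OF F1 F2 F3] comp_func_assoc[OF G1 G2 G3]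
    by simp
  show "functor_between (comp_func F3 (comp_func F2 F1)) A D"
    using F21 F3 by (rule comp_func_between)
  show "cmp (hcomp_nt \<tau> (hcomp_nt \<sigma> \<rho>)) x = cmp (hcomp_nt (hcomp_nt \<tau> \<sigma>) \<rho>) x" if x: "x \<in> Obj A" for x
  proof -
    note G1x = functor_obj[OF G1 x]
    note r = functor_Hom[OF F2 nat_Hom[OF \<rho> F1 x]]
    note s = nat_Hom[OF \<sigma> F2 G1x]
    note t = nat_Hom[OF \<tau> F3 functor_obj[OF G2 G1x]]
    have r': "cmp \<rho> x \<in> Arr B"
      using nat_Hom[OF \<rho> F1 x] by (simp add: Hom_iff)
    show ?thesis
      using x G1x r' functor_comp[OF F3 r s]
        comp_assoc[OF functor_Tgt_cat[OF F3] functor_Hom[OF F3 r] functor_Hom[OF F3 s] t]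
      by (simp add: cmp_hcomp_nt[OF \<sigma>\<rho> F21 \<tau> F3] cmp_hcomp_nt[OF \<rho> F1 \<sigma> F2]
          cmp_hcomp_nt[OF \<rho> F1 \<tau>\<sigma> F32] cmp_hcomp_nt[OF \<sigma> F2 \<tau> F3] functor_Src[OF G1] functor_Src[OF F2])
  qed
qed

lemma hcomp_nt_id_nt:
  assumes F: "functor_between F A B" and G: "functor_between G B C"
  shows "hcomp_nt (id_nt G) (id_nt F) = id_nt (comp_func G F)"
proof (rule nat_eqI)
  note GF = comp_func_between[OF F G]
  show "is_nat (hcomp_nt (id_nt G) (id_nt F)) (comp_func G F) (comp_func G F)"
    using is_nat_hcomp_nt[OF is_nat_id_nt[OF F] F is_nat_id_nt[OF G] G] .
  show "is_nat (id_nt (comp_func G F)) (comp_func G F) (comp_func G F)"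
    using GF by (rule is_nat_id_nt)
  show "functor_between (comp_func G F) A C" by (rule GF)
  show "cmp (hcomp_nt (id_nt G) (id_nt F)) x = cmp (id_nt (comp_func G F)) x" if x: "x \<in> Obj A" for x
    using x functor_obj[OF F x] functor_ide[OF G functor_obj[OF F x]]
      ide_comp[OF functor_Tgt_cat[OF G] Hom_ide[OF functor_Tgt_cat[OF G] functor_obj[OF G functor_obj[OF F x]]]]
    by (simp add: cmp_hcomp_nt[OF is_nat_id_nt[OF F] F is_nat_id_nt[OF G] G]
        cmp_id_nt[OF F] cmp_id_nt[OF G] cmp_id_nt[OF GF] functor_Src[OF F])
qed

lemma
  assumes \<sigma>: "is_nat \<sigma> F G" and F: "functor_between F C D"
  shows hcomp_nt_id: "hcomp_nt \<sigma> (id_nt (id_func C)) = \<sigma>"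
    and id_hcomp_nt: "hcomp_nt (id_nt (id_func D)) \<sigma> = \<sigma>"
proof -
  note G = nat_cod_functor[OF \<sigma> F]
  note C = functor_Src_cat[OF F] and D = functor_Tgt_cat[OF F]
  note iC = id_func_between[OF C] and iD = id_func_between[OF D]
  have 1: "is_nat (hcomp_nt \<sigma> (id_nt (id_func C))) F G"
    using is_nat_hcomp_nt[OF is_nat_id_nt[OF iC] iC \<sigma> F] by (simp add: comp_func_id[OF F] comp_func_id[OF G])
  have 2: "is_nat (hcomp_nt (id_nt (id_func D)) \<sigma>) F G"
    using is_nat_hcomp_nt[OF \<sigma> F is_nat_id_nt[OF iD] iD] by (simp add: id_comp_func[OF F] id_comp_func[OF G])
  have "cmp (hcomp_nt \<sigma> (id_nt (id_func C))) x = cmp \<sigma> x \<and> cmp (hcomp_nt (id_nt (id_func D)) \<sigma>) x = cmp \<sigma> x"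
    if x: "x \<in> Obj C" for x
    using x functor_obj[OF G x] functor_ide[OF F x] comp_ide[OF D nat_Hom[OF \<sigma> F x]]
      ide_comp[OF D nat_Hom[OF \<sigma> F x]] nat_Hom[OF \<sigma> F x]
    by (simp add: cmp_hcomp_nt[OF is_nat_id_nt[OF iC] iC \<sigma> F] cmp_hcomp_nt[OF \<sigma> F is_nat_id_nt[OF iD] iD]
        cmp_id_nt[OF iC] cmp_id_nt[OF iD] Hom_iff)
  then show "hcomp_nt \<sigma> (id_nt (id_func C)) = \<sigma>" "hcomp_nt (id_nt (id_func D)) \<sigma> = \<sigma>"
    using nat_eqI[OF 1 \<sigma> F] nat_eqI[OF 2 \<sigma> F] by blast+
qed

lemma interchange:
  assumes \<sigma>: "is_nat \<sigma> F G" and \<sigma>': "is_nat \<sigma>' G H" and F: "functor_between F C D"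
    and \<tau>: "is_nat \<tau> F' G'" and \<tau>': "is_nat \<tau>' G' H'" and F': "functor_between F' D D'"
  shows "hcomp_nt (vcomp_nt \<tau>' \<tau>) (vcomp_nt \<sigma>' \<sigma>) = vcomp_nt (hcomp_nt \<tau>' \<sigma>') (hcomp_nt \<tau> \<sigma>)"
proof (rule nat_eqI)
  note G = nat_cod_functor[OF \<sigma> F]
  note G' = nat_cod_functor[OF \<tau> F']
  note H = nat_cod_functor[OF \<sigma>' G]
  note v\<sigma> = is_nat_vcomp_nt[OF \<sigma> \<sigma>' F]
  note v\<tau> = is_nat_vcomp_nt[OF \<tau> \<tau>' F']
  note h = is_nat_hcomp_nt[OF \<sigma> F \<tau> F']
  note h' = is_nat_hcomp_nt[OF \<sigma>' G \<tau>' G']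
  note F'F = comp_func_between[OF F F']
  show "is_nat (hcomp_nt (vcomp_nt \<tau>' \<tau>) (vcomp_nt \<sigma>' \<sigma>)) (comp_func F' F) (comp_func H' H)"
    using is_nat_hcomp_nt[OF v\<sigma> F v\<tau> F'] .
  show "is_nat (vcomp_nt (hcomp_nt \<tau>' \<sigma>') (hcomp_nt \<tau> \<sigma>)) (comp_func F' F) (comp_func H' H)"
    using is_nat_vcomp_nt[OF h h' F'F] .
  show "functor_between (comp_func F' F) C D'" by (rule F'F)
  show "cmp (hcomp_nt (vcomp_nt \<tau>' \<tau>) (vcomp_nt \<sigma>' \<sigma>)) x = cmp (vcomp_nt (hcomp_nt \<tau>' \<sigma>') (hcomp_nt \<tau> \<sigma>)) x"
    if x: "x \<in> Obj C" for x
  proof -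
    note D' = functor_Tgt_cat[OF F']
    note Gx = functor_obj[OF G x] and Hx = functor_obj[OF H x]
    note s = nat_Hom[OF \<sigma> F x] and s' = nat_Hom[OF \<sigma>' G x]
    note Fs = functor_Hom[OF F' s] and Fs' = functor_Hom[OF F' s'] and Gs' = functor_Hom[OF G' s']
    note t = nat_Hom[OF \<tau> F' Hx] and t' = nat_Hom[OF \<tau>' G' Hx] and tG = nat_Hom[OF \<tau> F' Gx]
    have "Comp D' (Comp D' (cmp \<tau>' (omap H x)) (cmp \<tau> (omap H x))) (amap F' (Comp D (cmp \<sigma>' x) (cmp \<sigma> x))) =
        Comp D' (Comp D' (cmp \<tau>' (omap H x)) (cmp \<tau> (omap H x))) (Comp D' (amap F' (cmp \<sigma>' x)) (amap F' (cmp \<sigma> x)))"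
      by (simp add: functor_comp[OF F' s s'])
    also have "\<dots> = Comp D' (cmp \<tau>' (omap H x))
        (Comp D' (Comp D' (cmp \<tau> (omap H x)) (amap F' (cmp \<sigma>' x))) (amap F' (cmp \<sigma> x)))"
      using comp_assoc[OF D' Hom_comp[OF D' Fs Fs'] t t'] comp_assoc[OF D' Fs Fs' t] by simp
    \<comment> \<open>The middle exchange is naturality of \<tau> at a component of \<sigma>'; all
      the rest is reassociation.\<close>
    also have "\<dots> = Comp D' (cmp \<tau>' (omap H x))
        (Comp D' (Comp D' (amap G' (cmp \<sigma>' x)) (cmp \<tau> (omap G x))) (amap F' (cmp \<sigma> x)))"
      by (simp add: nat_naturality[OF \<tau> F' s'])
    also have "\<dots> = Comp D' (Comp D' (cmp \<tau>' (omap H x)) (amap G' (cmp \<sigma>' x)))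
        (Comp D' (cmp \<tau> (omap G x)) (amap F' (cmp \<sigma> x)))"
      using comp_assoc[OF D' Fs tG Gs'] comp_assoc[OF D' Hom_comp[OF D' Fs tG] Gs' t'] by simp
    finally show ?thesis
      using x Gx Hx by (simp add: cmp_hcomp_nt[OF v\<sigma> F v\<tau> F'] cmp_vcomp_nt[OF \<sigma> F] cmp_vcomp_nt[OF \<tau> F']
          cmp_vcomp_nt[OF h F'F] cmp_hcomp_nt[OF \<sigma> F \<tau> F'] cmp_hcomp_nt[OF \<sigma>' G \<tau>' G'])
  qed
qed

subsection \<open>The 2-categories of limit sketches\<close>

text \<open>Sketch morphisms match cones by equality, so the image of a cone must be strictly
  functorial, including the functors stored inside its legs.\<close>

lemma map_cone_comp:
  assumes C: "is_cone E C" and F: "functor_between F E D" and G: "functor_between G D D'"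
  shows "map_cone (comp_func G F) C = map_cone G (map_cone F C)"
proof -
  let ?I = "index C"
  have I: "category ?I" and x: "vertex C \<in> Obj E" and \<phi>: "functor_between (diagram C) ?I E"
    and legs: "is_nat (legs C) (const_func ?I E (vertex C)) (diagram C)"
    using C by (auto simp: is_cone_def small_category_category)
  have K: "functor_between (const_func ?I E (vertex C)) ?I E"
    using I functor_Src_cat[OF F] x by (rule const_func_between)
  note GF = comp_func_between[OF F G]
  have "whisker (comp_func G F) (legs C) = whisker G (whisker F (legs C))"
  proof (rule nat_eqI)
    show "is_nat (whisker (comp_func G F) (legs C))
        (comp_func G (comp_func F (const_func ?I E (vertex C)))) (comp_func G (comp_func F (diagram C)))"
      using is_nat_whisker[OF legs K GF] comp_func_assoc[OF K F G] comp_func_assoc[OF \<phi> F G] by simp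
    show "is_nat (whisker G (whisker F (legs C)))
        (comp_func G (comp_func F (const_func ?I E (vertex C)))) (comp_func G (comp_func F (diagram C)))"
      using is_nat_whisker[OF is_nat_whisker[OF legs K F] comp_func_between[OF K F] G] .
    show "functor_between (comp_func G (comp_func F (const_func ?I E (vertex C)))) ?I D'"
      using comp_func_between[OF comp_func_between[OF K F] G] .
    show "cmp (whisker (comp_func G F) (legs C)) j = cmp (whisker G (whisker F (legs C))) j"
      if "j \<in> Obj ?I" for j
      using whisker_cmp[OF legs K that] whisker_cmp[OF is_nat_whisker[OF legs K F] comp_func_between[OF K F] that]
        nat_Hom[OF legs K that] comp_func_amap[OF F, of _ G] by (simp add: Hom_iff)
  qed
  then show ?thesis
    using x comp_func_assoc[OF \<phi> F G] comp_func_omap[OF F] by (simp add: map_cone_def)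
qed

lemma map_cone_id:
  assumes E: "category E" and C: "is_cone E C"
  shows "map_cone (id_func E) C = C"
proof -
  let ?I = "index C"
  have I: "category ?I" and x: "vertex C \<in> Obj E" and \<phi>: "functor_between (diagram C) ?I E"
    and legs: "is_nat (legs C) (const_func ?I E (vertex C)) (diagram C)"
    using C by (auto simp: is_cone_def small_category_category)
  have K: "functor_between (const_func ?I E (vertex C)) ?I E"
    using I E x by (rule const_func_between)
  have "whisker (id_func E) (legs C) = legs C"
  proof (rule nat_eqI[OF _ legs K])
    show "is_nat (whisker (id_func E) (legs C)) (const_func ?I E (vertex C)) (diagram C)"
      using is_nat_whisker[OF legs K id_func_between[OF E]] id_comp_func[OF K] id_comp_func[OF \<phi>] by simp
    show "cmp (whisker (id_func E) (legs C)) j = cmp (legs C) j" if "j \<in> Obj ?I" for j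
      using whisker_cmp[OF legs K that] nat_Hom[OF legs K that] by (simp add: Hom_iff)
  qed
  then show ?thesis
    using x id_comp_func[OF \<phi>] by (simp add: map_cone_def)
qed

section \<open>The 2-category LS and its full sub-2-categories\<close>

lemma LS_simps [simp]:
  "Ob LS = {S. limit_sketch S}" "One LS = {m. is_sk_mor m}" "Two LS = {a. is_sk_cell a}"
  "src1 LS = sk_dom" "tgt1 LS = sk_cod" "id1 LS = id_sk" "comp1 LS = comp_sk"
  "src2 LS = cell_dom" "tgt2 LS = cell_cod"
  "id2 LS m = \<lparr>cell_dom = m, cell_cod = m, cell_nt = id_nt (sk_func m)\<rparr>"
  "vcomp LS b a = \<lparr>cell_dom = cell_dom a, cell_cod = cell_cod b, cell_nt = vcomp_nt (cell_nt b) (cell_nt a)\<rparr>"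
  "hcomp LS b a = \<lparr>cell_dom = comp_sk (cell_dom b) (cell_dom a), cell_cod = comp_sk (cell_cod b) (cell_cod a),
    cell_nt = hcomp_nt (cell_nt b) (cell_nt a)\<rparr>"
  by (simp_all add: LS_def)

lemma
  assumes "limit_sketch S"
  shows sketch_cat: "category (carrier S)"
    and sketch_is_cone: "\<alpha> \<in> names S \<Longrightarrow> is_cone (carrier S) (cones S \<alpha>)"
  using assms by (auto simp: limit_sketch_def small_category_category)

lemma
  assumes "is_sk_mor m"
  shows sk_mor_dom: "limit_sketch (sk_dom m)" and sk_mor_cod: "limit_sketch (sk_cod m)"
    and sk_mor_functor: "functor_between (sk_func m) (carrier (sk_dom m)) (carrier (sk_cod m))"
    and sk_mor_names: "sk_names m \<in> names (sk_dom m) \<rightarrow>\<^sub>E names (sk_cod m)"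
    and sk_mor_cones: "\<alpha> \<in> names (sk_dom m) \<Longrightarrow>
      map_cone (sk_func m) (cones (sk_dom m) \<alpha>) = cones (sk_cod m) (sk_names m \<alpha>)"
  using assms by (auto simp: is_sk_mor_def)

lemma
  assumes "is_sk_cell a"
  shows cell_mor: "is_sk_mor (cell_dom a)" "is_sk_mor (cell_cod a)"
    and cell_ends: "sk_dom (cell_cod a) = sk_dom (cell_dom a)" "sk_cod (cell_cod a) = sk_cod (cell_dom a)"
    and cell_nat: "is_nat (cell_nt a) (sk_func (cell_dom a)) (sk_func (cell_cod a))"
    and cell_functor: "functor_between (sk_func (cell_dom a))
      (carrier (sk_dom (cell_dom a))) (carrier (sk_cod (cell_dom a)))"
  using assms by (auto simp: is_sk_cell_def is_sk_mor_def)

lemma sk_mor_eqI: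
  "\<lbrakk>sk_dom m = sk_dom n; sk_cod m = sk_cod n; sk_func m = sk_func n; sk_names m = sk_names n\<rbrakk> \<Longrightarrow>
    m = (n :: 'u sk_mor)"
  by simp

lemma sk_mor_id_sk:
  assumes S: "limit_sketch S"
  shows "is_sk_mor (id_sk S)"
  using S id_func_between[OF sketch_cat[OF S]] map_cone_id[OF sketch_cat[OF S] sketch_is_cone[OF S]]
  by (simp add: is_sk_mor_def id_sk_def)

lemma sk_mor_comp_sk:
  assumes m: "is_sk_mor m" and n: "is_sk_mor n" and mn: "sk_cod m = sk_dom n"
  shows "is_sk_mor (comp_sk n m)"
proof -
  have F: "functor_between (sk_func m) (carrier (sk_dom m)) (carrier (sk_dom n))"
    and nm: "sk_names m \<in> names (sk_dom m) \<rightarrow>\<^sub>E names (sk_dom n)"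
    using sk_mor_functor[OF m] sk_mor_names[OF m] mn by simp_all
  have "map_cone (comp_func (sk_func n) (sk_func m)) (cones (sk_dom m) \<alpha>) =
      cones (sk_cod n) (compose (names (sk_dom m)) (sk_names n) (sk_names m) \<alpha>)"
    if \<alpha>: "\<alpha> \<in> names (sk_dom m)" for \<alpha>
    using map_cone_comp[OF sketch_is_cone[OF sk_mor_dom[OF m] \<alpha>] F sk_mor_functor[OF n]]
      sk_mor_cones[OF m \<alpha>] sk_mor_cones[OF n, of "sk_names m \<alpha>"] nm \<alpha> mn
    by (auto simp: compose_def)
  moreover have "compose (names (sk_dom m)) (sk_names n) (sk_names m) \<in>
      names (sk_dom m) \<rightarrow>\<^sub>E names (sk_cod n)"
    using nm sk_mor_names[OF n] by (auto simp: compose_def)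
  ultimately show ?thesis
    using comp_func_between[OF F sk_mor_functor[OF n]] sk_mor_dom[OF m] sk_mor_cod[OF n]
    by (simp add: is_sk_mor_def comp_sk_def)
qed

lemma sk_simps [simp]:
  "sk_dom (comp_sk n m) = sk_dom m" "sk_cod (comp_sk n m) = sk_cod n"
  "sk_func (comp_sk n m) = comp_func (sk_func n) (sk_func m)"
  "sk_dom (id_sk S) = S" "sk_cod (id_sk S) = S" "sk_func (id_sk S) = id_func (carrier S)"
  by (simp_all add: comp_sk_def id_sk_def)

lemma
  assumes m: "is_sk_mor m"
  shows comp_id_sk: "comp_sk m (id_sk (sk_dom m)) = m" and id_comp_sk: "comp_sk (id_sk (sk_cod m)) m = m"
proof -
  have "compose (names (sk_dom m)) (sk_names m) (\<lambda>\<alpha>\<in>names (sk_dom m). \<alpha>) = sk_names m"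
    "compose (names (sk_dom m)) (\<lambda>\<alpha>\<in>names (sk_cod m). \<alpha>) (sk_names m) = sk_names m"
    using sk_mor_names[OF m] by (auto simp: compose_def fun_eq_iff PiE_def extensional_def Pi_def)
  then show "comp_sk m (id_sk (sk_dom m)) = m" "comp_sk (id_sk (sk_cod m)) m = m"
    using comp_func_id[OF sk_mor_functor[OF m]] id_comp_func[OF sk_mor_functor[OF m]]
    by (auto intro!: sk_mor_eqI) (simp_all add: comp_sk_def id_sk_def)
qed

lemma comp_sk_assoc:
  assumes "is_sk_mor l" "is_sk_mor m" "is_sk_mor n" "sk_cod l = sk_dom m" "sk_cod m = sk_dom n"
  shows "comp_sk n (comp_sk m l) = comp_sk (comp_sk n m) l"
proof -
  have "compose (names (sk_dom l)) (sk_names n) (compose (names (sk_dom l)) (sk_names m) (sk_names l)) =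
      compose (names (sk_dom l)) (compose (names (sk_dom m)) (sk_names n) (sk_names m)) (sk_names l)"
    using sk_mor_names[OF assms(1)] assms(4) by (auto simp: compose_def fun_eq_iff)
  moreover have "comp_func (sk_func n) (comp_func (sk_func m) (sk_func l)) =
      comp_func (comp_func (sk_func n) (sk_func m)) (sk_func l)"
    using sk_mor_functor assms by (metis comp_func_assoc)
  ultimately show ?thesis
    by (simp add: comp_sk_def)
qed

lemma sk_cell_id: "is_sk_mor m \<Longrightarrow> is_sk_cell \<lparr>cell_dom = m, cell_cod = m, cell_nt = id_nt (sk_func m)\<rparr>"
  using is_nat_id_nt[OF sk_mor_functor] by (simp add: is_sk_cell_def)

lemma sk_cell_vcomp:
  assumes a: "is_sk_cell a" and b: "is_sk_cell b" and ab: "cell_cod a = cell_dom b"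
  shows "is_sk_cell (vcomp LS b a)"
  using is_nat_vcomp_nt[OF cell_nat[OF a] _ cell_functor[OF a]] cell_nat[OF b] ab cell_mor[OF a] cell_mor[OF b]
    cell_ends[OF a] cell_ends[OF b] by (simp add: is_sk_cell_def)

lemma sk_cell_hcomp:
  assumes a: "is_sk_cell a" and b: "is_sk_cell b" and ab: "sk_cod (cell_dom a) = sk_dom (cell_dom b)"
  shows "is_sk_cell (hcomp LS b a)"
  using is_nat_hcomp_nt[OF cell_nat[OF a] cell_functor[OF a] cell_nat[OF b]] cell_functor[OF b] ab
    cell_mor[OF a] cell_mor[OF b] cell_ends[OF a] cell_ends[OF b]
  by (simp add: is_sk_cell_def sk_mor_comp_sk)

lemma category_one_cells_LS: "category (one_cells LS)"
proof -
  have [simp]: "m \<in> Hom (one_cells LS) S T \<longleftrightarrow> is_sk_mor m \<and> sk_dom m = S \<and> sk_cod m = T"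
    "Obj (one_cells LS) = {S. limit_sketch S}" "Ide (one_cells LS) = id_sk" "Comp (one_cells LS) = comp_sk" for m S T
    by (simp_all add: one_cells_def Hom_iff)
  show ?thesis
    by (rule categoryI) (auto simp: sk_mor_dom sk_mor_cod sk_mor_id_sk sk_mor_comp_sk comp_id_sk id_comp_sk
        comp_sk_assoc simp del: sk_simps(3,6))
qed

lemma category_vertical_LS: "category (vertical LS)"
proof -
  have [simp]: "a \<in> Hom (vertical LS) m n \<longleftrightarrow> is_sk_cell a \<and> cell_dom a = m \<and> cell_cod a = n"
    "Obj (vertical LS) = {m. is_sk_mor m}" "Ide (vertical LS) = id2 LS" "Comp (vertical LS) = vcomp LS" for a m n
    by (simp_all add: vertical_def Hom_iff)
  show ?thesis
  proof (rule categoryI)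
    show "Comp (vertical LS) g f \<in> Hom (vertical LS) x z"
      if "f \<in> Hom (vertical LS) x y" "g \<in> Hom (vertical LS) y z" for f g x y z
      using that sk_cell_vcomp[of f g] by simp
    show "Comp (vertical LS) f (Ide (vertical LS) x) = f \<and> Comp (vertical LS) (Ide (vertical LS) y) f = f"
      if f: "f \<in> Hom (vertical LS) x y" for f x y
      using f vcomp_nt_id[OF cell_nat cell_functor, of f] id_vcomp_nt[OF cell_nat cell_functor, of f] by auto
    show "Comp (vertical LS) h (Comp (vertical LS) g f) = Comp (vertical LS) (Comp (vertical LS) h g) f"
      if "f \<in> Hom (vertical LS) x y" "g \<in> Hom (vertical LS) y z" "h \<in> Hom (vertical LS) z w" for f g h x y z w
    proof -
      have c: "is_sk_cell f" "is_sk_cell g" "is_sk_cell h" "cell_cod f = cell_dom g" "cell_cod g = cell_dom h"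
        using that by simp_all
      show ?thesis
        using vcomp_nt_assoc[OF cell_nat[OF c(1), unfolded c(4)] cell_nat[OF c(2), unfolded c(5)]
            cell_nat[OF c(3)] cell_functor[OF c(1)]] by simp
    qed
  qed (auto simp: cell_mor sk_cell_id)
qed

lemma category_horizontal_LS: "category (horizontal LS)"
proof -
  have [simp]: "a \<in> Hom (horizontal LS) S T \<longleftrightarrow> is_sk_cell a \<and> sk_dom (cell_dom a) = S \<and> sk_cod (cell_dom a) = T"
    "Obj (horizontal LS) = {S. limit_sketch S}" "Ide (horizontal LS) S = id2 LS (id_sk S)"
    "Comp (horizontal LS) = hcomp LS" for a S T
    by (simp_all add: horizontal_def Hom_iff)
  show ?thesis
  proof (rule categoryI)
    show "Comp (horizontal LS) g f \<in> Hom (horizontal LS) x z"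
      if "f \<in> Hom (horizontal LS) x y" "g \<in> Hom (horizontal LS) y z" for f g x y z
      using that sk_cell_hcomp[of f g] by simp
    show "Comp (horizontal LS) f (Ide (horizontal LS) x) = f \<and> Comp (horizontal LS) (Ide (horizontal LS) y) f = f"
      if f: "f \<in> Hom (horizontal LS) x y" for f x y
    proof -
      have c: "is_sk_cell f" "sk_dom (cell_dom f) = x" "sk_cod (cell_dom f) = y"
        using f by simp_all
      then show ?thesis
        using hcomp_nt_id[OF cell_nat[OF c(1)] cell_functor[OF c(1)]]
          id_hcomp_nt[OF cell_nat[OF c(1)] cell_functor[OF c(1)]]
          comp_id_sk[OF cell_mor(1)[OF c(1)]] comp_id_sk[OF cell_mor(2)[OF c(1)]]
          id_comp_sk[OF cell_mor(1)[OF c(1)]] id_comp_sk[OF cell_mor(2)[OF c(1)]] cell_ends[OF c(1)]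
        by (simp del: sk_simps(3))
    qed
    show "Comp (horizontal LS) h (Comp (horizontal LS) g f) = Comp (horizontal LS) (Comp (horizontal LS) h g) f"
      if "f \<in> Hom (horizontal LS) x y" "g \<in> Hom (horizontal LS) y z" "h \<in> Hom (horizontal LS) z w" for f g h x y z w
    proof -
      have c: "is_sk_cell f" "is_sk_cell g" "is_sk_cell h"
        "sk_cod (cell_dom f) = sk_dom (cell_dom g)" "sk_cod (cell_dom g) = sk_dom (cell_dom h)"
        using that by simp_all
      show ?thesis
        using hcomp_nt_assoc[OF cell_nat[OF c(1)] cell_functor[OF c(1), unfolded c(4)] cell_nat[OF c(2)]
            cell_functor[OF c(2), unfolded c(5)] cell_nat[OF c(3)] cell_functor[OF c(3)]]
          comp_sk_assoc[of "cell_dom f" "cell_dom g" "cell_dom h"]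
          comp_sk_assoc[of "cell_cod f" "cell_cod g" "cell_cod h"] c(4,5)
          cell_mor[OF c(1)] cell_mor[OF c(2)] cell_mor[OF c(3)]
          cell_ends[OF c(1)] cell_ends[OF c(2)] cell_ends[OF c(3)]
        by simp
    qed
  qed (use sk_cell_id[OF sk_mor_id_sk] in \<open>auto simp: sk_mor_dom sk_mor_cod cell_mor\<close>)
qed

lemma two_category_LS: "two_category (LS :: ('u sketch, 'u sk_mor, 'u sk_cell) two_cat)"
proof -
  have "hcomp_nt (id_nt (sk_func n)) (id_nt (sk_func m)) = id_nt (comp_func (sk_func n) (sk_func m))"
    if "is_sk_mor m" "is_sk_mor n" "sk_cod m = sk_dom n" for m n :: "'u sk_mor"
    using hcomp_nt_id_nt[OF sk_mor_functor[OF that(1), unfolded that(3)] sk_mor_functor[OF that(2)]] .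
  moreover have "hcomp_nt (vcomp_nt (cell_nt b') (cell_nt b)) (vcomp_nt (cell_nt a') (cell_nt a)) =
      vcomp_nt (hcomp_nt (cell_nt b') (cell_nt a')) (hcomp_nt (cell_nt b) (cell_nt a))"
    if c: "is_sk_cell a" "is_sk_cell a'" "is_sk_cell b" "is_sk_cell b'" "cell_cod a = cell_dom a'"
      "cell_cod b = cell_dom b'" "sk_cod (cell_dom a) = sk_dom (cell_dom b)" for a a' b b' :: "'u sk_cell"
    using interchange[OF cell_nat[OF c(1), unfolded c(5)] cell_nat[OF c(2)] cell_functor[OF c(1), unfolded c(7)]
        cell_nat[OF c(3), unfolded c(6)] cell_nat[OF c(4)] cell_functor[OF c(3)]] .
  ultimately show ?thesis
    unfolding two_category_def
    using category_one_cells_LS category_vertical_LS category_horizontal_LS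
    by (intro conjI ballI impI) (simp_all add: cell_ends)
qed

lemma two_category_full_sub:
  assumes "two_category K"
  shows "two_category (full_sub_two_cat K P)"
  using assms unfolding two_category_def category_def
  by (simp add: full_sub_two_cat_def one_cells_def vertical_def horizontal_def Hom_def)

lemma full_sub_simps [simp]:
  "Ob (full_sub_two_cat K P) = {x \<in> Ob K. P x}"
  "One (full_sub_two_cat K P) = {f \<in> One K. P (src1 K f) \<and> P (tgt1 K f)}"
  "Two (full_sub_two_cat K P) = {a \<in> Two K. P (src1 K (src2 K a)) \<and> P (tgt1 K (src2 K a))}"
  "src1 (full_sub_two_cat K P) = src1 K" "tgt1 (full_sub_two_cat K P) = tgt1 K"
  "id1 (full_sub_two_cat K P) = id1 K" "comp1 (full_sub_two_cat K P) = comp1 K"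
  "src2 (full_sub_two_cat K P) = src2 K" "tgt2 (full_sub_two_cat K P) = tgt2 K"
  "id2 (full_sub_two_cat K P) = id2 K" "vcomp (full_sub_two_cat K P) = vcomp K"
  "hcomp (full_sub_two_cat K P) = hcomp K"
  by (simp_all add: full_sub_two_cat_def)

lemma two_functor_inclusion:
  assumes "two_category K"
  shows "two_functor (full_sub_two_cat K P) K id_two_func"
  using assms two_category_full_sub[OF assms] by (simp add: two_functor_def id_two_func_def)

lemma two_functor_id: "two_category K \<Longrightarrow> two_functor K K id_two_func"
  by (simp add: two_functor_def id_two_func_def)

lemma two_functor_comp_inclusion:
  assumes "two_category K" "two_functor C (full_sub_two_cat K P) T"
  shows "two_functor C K (comp_two_func id_two_func T)"
  using assms by (simp add: two_functor_def id_two_func_def comp_two_func_def)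

subsection \<open>Extension of morphisms and 2-cells\<close>

context realization
begin

lemma nat_L_eqI:
  assumes "is_nat \<sigma> F G" "is_nat \<tau> F G" "functor_between F P D"
    and "\<And>x. x \<in> Obj E \<Longrightarrow> cmp \<sigma> (omap L x) = cmp \<tau> (omap L x)"
  shows "\<sigma> = \<tau>"
proof (rule nat_eqI[OF assms(1-3)])
  fix z assume "z \<in> Obj P"
  then obtain x where "x \<in> Obj E" "z = omap L x"
    using L_surj by blast
  then show "cmp \<sigma> z = cmp \<tau> z"
    using assms(4) by simp
qed

text \<open>L is bijective on objects, which fixes the components. Naturality passes to composites
  by pasting. For an arrow u into L of a vertex, both sides of the square end at the vertex of a
  limit cone in D, so it is enough that they agree after each leg. Only the images under the
  codomain functor G have to be limits.\<close>

lemma nat_extension: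
  assumes F: "functor_between F P D" and G: "functor_between G P D"
    and lim: "\<And>\<alpha>. \<alpha> \<in> names S \<Longrightarrow> limit_cone D (map_cone (comp_func G L) (cones S \<alpha>))"
    and \<tau>: "is_nat \<tau> (comp_func F L) (comp_func G L)"
  shows "is_nat \<lparr>Fdom = F, Fcod = G, cmp = (\<lambda>z\<in>Obj P. cmp \<tau> (inv_into (Obj E) (omap L) z))\<rparr> F G"
    and "x \<in> Obj E \<Longrightarrow> (\<lambda>z\<in>Obj P. cmp \<tau> (inv_into (Obj E) (omap L) z)) (omap L x) = cmp \<tau> x"
proof -
  let ?t = "\<lambda>z\<in>Obj P. cmp \<tau> (inv_into (Obj E) (omap L) z)"
  note D = functor_Tgt_cat[OF F]
  note FL = comp_func_between[OF L F] and GL = comp_func_between[OF L G]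
  \<comment> \<open>Injectivity on objects ensures that the chosen preimage of L x is x
    itself.\<close>
  show tL: "?t (omap L x) = cmp \<tau> x" if "x \<in> Obj E" for x
    using that functor_obj[OF L that] inv_into_f_f[OF L_inj that] by simp
  have t: "?t z \<in> Hom D (omap F z) (omap G z)" if z: "z \<in> Obj P" for z
  proof -
    obtain x where x: "x \<in> Obj E" "z = omap L x"
      using z L_surj by blast
    show ?thesis
      using nat_Hom[OF \<tau> FL x(1)] comp_func_omap[OF L x(1)] tL[OF x(1)] x(2) by simp
  qed
  let ?N = "{f \<in> Arr P. Comp D (?t (Cod P f)) (amap F f) = Comp D (amap G f) (?t (Dom P f))}"
  have "f \<in> ?N" if f: "f \<in> Arr P" for f
  proof (rule Fib_induct(1)[OF _ _ _ _ f])
    show "amap L e \<in> ?N" if e: "e \<in> Arr E" for e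
    proof -
      have Le: "amap L e \<in> Hom P (omap L (Dom E e)) (omap L (Cod E e))"
        using functor_Hom[OF L arr_Hom[OF e]] .
      have ends: "Dom E e \<in> Obj E" "Cod E e \<in> Obj E"
        using Hom_dom[OF catE arr_Hom[OF e]] Hom_cod[OF catE arr_Hom[OF e]] .
      have "Comp D (cmp \<tau> (Cod E e)) (amap F (amap L e)) = Comp D (amap G (amap L e)) (cmp \<tau> (Dom E e))"
        using nat_naturality[OF \<tau> FL arr_Hom[OF e]] comp_func_amap[OF L e] by simp
      then show ?thesis
        using Le tL[OF ends(1)] tL[OF ends(2)] by (simp add: Hom_iff del: restrict_apply)
    qed
    show "Comp P h g \<in> ?N" if gh: "g \<in> ?N" "h \<in> ?N" "g \<in> Hom P a b" "h \<in> Hom P b c" for g h a b c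
    proof -
      note hg = Hom_comp[OF catP gh(3,4)]
      note ta = t[OF Hom_dom[OF catP gh(3)]] and tb = t[OF Hom_cod[OF catP gh(3)]]
        and tc = t[OF Hom_cod[OF catP gh(4)]]
      note Fg = functor_Hom[OF F gh(3)] and Fh = functor_Hom[OF F gh(4)]
        and Gg = functor_Hom[OF G gh(3)] and Gh = functor_Hom[OF G gh(4)]
      have g: "Comp D (?t b) (amap F g) = Comp D (amap G g) (?t a)"
        and h: "Comp D (?t c) (amap F h) = Comp D (amap G h) (?t b)"
        using gh by (auto simp: Hom_iff simp del: restrict_apply)
      have "Comp D (?t c) (amap F (Comp P h g)) = Comp D (Comp D (?t c) (amap F h)) (amap F g)"
        using functor_comp[OF F gh(3,4)] comp_assoc[OF D Fg Fh tc] by (simp del: restrict_apply)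
      also have "\<dots> = Comp D (amap G h) (Comp D (?t b) (amap F g))"
        unfolding h using comp_assoc[OF D Fg tb Gh] by (simp del: restrict_apply)
      also have "\<dots> = Comp D (amap G (Comp P h g)) (?t a)"
        unfolding g using functor_comp[OF G gh(3,4)] comp_assoc[OF D ta Gg Gh] by (simp del: restrict_apply)
      finally show ?thesis
        using hg by (simp add: Hom_iff del: restrict_apply)
    qed
    fix \<alpha> y u
    assume \<alpha>: "\<alpha> \<in> names S" and y: "y \<in> Obj E"
      and u: "u \<in> Hom P (omap L y) (omap L (vertex (cones S \<alpha>)))"
      and *: "\<And>j. j \<in> Obj (index (cones S \<alpha>)) \<Longrightarrow> Comp P (amap L (cmp (legs (cones S \<alpha>)) j)) u \<in> ?N"
    interpret c: sketch_cone S \<alpha>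
      using S \<alpha> by unfold_locales
    note Fu = functor_Hom[OF F u] and Gu = functor_Hom[OF G u]
    note ty = t[OF functor_obj[OF L y]] and tx = t[OF functor_obj[OF L c.x]]
    let ?C = "map_cone (comp_func G L) (cones S \<alpha>)"
    have vC: "vertex ?C = omap G (omap L c.x)"
      using comp_func_omap[OF L c.x] by (simp add: map_cone_def)
    have "Comp D (?t (omap L c.x)) (amap F u) = Comp D (amap G u) (?t (omap L y))"
    proof (rule limit_cone_eqI[OF lim[OF \<alpha>] D])
      show "Comp D (?t (omap L c.x)) (amap F u) \<in> Hom D (omap F (omap L y)) (vertex ?C)"
        unfolding vC using Hom_comp[OF D Fu tx] .
      show "Comp D (amap G u) (?t (omap L y)) \<in> Hom D (omap F (omap L y)) (vertex ?C)"
        unfolding vC using Hom_comp[OF D ty Gu] .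
      fix j assume "j \<in> Obj (index ?C)"
      then have j: "j \<in> Obj c.I"
        by (simp add: map_cone_def)
      let ?l = "amap L (c.\<delta> j)"
      note l = functor_Hom[OF L c.\<delta>[OF j]]
      note lu = Hom_comp[OF catP u l]
      note Fl = functor_Hom[OF F l] and Gl = functor_Hom[OF G l]
      note tj = t[OF functor_obj[OF L functor_obj[OF c.\<phi> j]]]
      have leg: "cmp (legs ?C) j = amap G ?l"
        using whisker_cmp[OF c.legs const_func_between[OF c.catI catE c.x] j] comp_func_amap[OF L, of "c.\<delta> j" G]
          c.\<delta>[OF j] by (simp add: map_cone_def Hom_iff)
      \<comment> \<open>Naturality at the leg comes from \<tau>, since the leg is an image under L;
        naturality at the leg after u is the induction hypothesis. Together they give the square at
        u after that leg.\<close>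
      have nat_l: "Comp D (?t (omap L (omap c.\<phi> j))) (amap F ?l) = Comp D (amap G ?l) (?t (omap L c.x))"
        using nat_naturality[OF \<tau> FL c.\<delta>[OF j]] comp_func_amap[OF L, of "c.\<delta> j"] c.\<delta>[OF j]
          tL[OF c.x] tL[OF functor_obj[OF c.\<phi> j]] by (simp add: Hom_iff del: restrict_apply)
      have nat_lu: "Comp D (?t (omap L (omap c.\<phi> j))) (amap F (Comp P ?l u)) =
          Comp D (amap G (Comp P ?l u)) (?t (omap L y))"
        using *[OF j] lu by (simp add: Hom_iff del: restrict_apply)
      have "Comp D (amap G ?l) (Comp D (?t (omap L c.x)) (amap F u)) =
          Comp D (Comp D (?t (omap L (omap c.\<phi> j))) (amap F ?l)) (amap F u)"
        unfolding nat_l by (rule comp_assoc[OF D Fu tx Gl])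
      also have "\<dots> = Comp D (?t (omap L (omap c.\<phi> j))) (amap F (Comp P ?l u))"
        unfolding functor_comp[OF F u l] by (rule comp_assoc[OF D Fu Fl tj, symmetric])
      also have "\<dots> = Comp D (amap G ?l) (Comp D (amap G u) (?t (omap L y)))"
        unfolding nat_lu functor_comp[OF G u l] by (rule comp_assoc[OF D ty Gu Gl, symmetric])
      finally show "Comp D (cmp (legs ?C) j) (Comp D (?t (omap L c.x)) (amap F u)) =
          Comp D (cmp (legs ?C) j) (Comp D (amap G u) (?t (omap L y)))"
        unfolding leg .
    qed
    then show "u \<in> ?N"
      using u by (simp add: Hom_iff del: restrict_apply)
  qed auto
  then show "is_nat \<lparr>Fdom = F, Fcod = G, cmp = ?t\<rparr> F G"
    by (intro natI[OF F G]) (use t in \<open>auto simp: Hom_iff simp del: restrict_apply\<close>)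
qed

lemma limit_sketch_free: "limit_sketch (free_sketch fac S)"
proof -
  have "is_cone P (map_cone L (cones S \<alpha>))" if "\<alpha> \<in> names S" for \<alpha>
  proof -
    interpret c: sketch_cone S \<alpha>
      using S that by unfold_locales
    show ?thesis using L by (rule c.is_cone_map_cone)
  qed
  then show ?thesis
    using S small_P by (simp add: limit_sketch_def free_sketch_def)
qed

lemma limit_cone_L: "\<alpha> \<in> names S \<Longrightarrow> limit_cone P (map_cone L (cones S \<alpha>))"
  using sharp_limit[OF S L _ sharp_L] L_surj by simp

lemma realized_free: "realized (free_sketch fac S)"
  using limit_cone_L by (simp add: realized_def free_sketch_def)

lemma sk_mor_unit: "is_sk_mor (unit_sk fac S)"
  using S limit_sketch_free L by (simp add: is_sk_mor_def unit_sk_def) (simp add: free_sketch_def)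

end

section \<open>The action of Fr on morphisms and 2-cells\<close>

definition free_func :: "'u fact_choice \<Rightarrow> 'u sk_mor \<Rightarrow> 'u func" where
  "free_func fac m = (THE H. functor_between H (Fib fac (sk_dom m)) (Fib fac (sk_cod m)) \<and>
     comp_func H (Lbang fac (sk_dom m)) = comp_func (Lbang fac (sk_cod m)) (sk_func m))"

definition free_mor :: "'u fact_choice \<Rightarrow> 'u sk_mor \<Rightarrow> 'u sk_mor" where
  "free_mor fac m = \<lparr>sk_dom = free_sketch fac (sk_dom m), sk_cod = free_sketch fac (sk_cod m),
     sk_func = free_func fac m, sk_names = sk_names m\<rparr>"

text \<open>On the objects of Fib, \<open>inv_into\<close> is a genuine inverse of L, by
  \<open>L_inj\<close> and \<open>L_surj\<close>. The form is that of the extension in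
  \<open>nat_extension\<close>.\<close>

definition free_nt :: "'u fact_choice \<Rightarrow> 'u sk_cell \<Rightarrow> 'u nt" where
  "free_nt fac a = (let S = sk_dom (cell_dom a); T = sk_cod (cell_dom a) in
     \<lparr>Fdom = free_func fac (cell_dom a), Fcod = free_func fac (cell_cod a),
      cmp = (\<lambda>z\<in>Obj (Fib fac S). cmp (whisker (Lbang fac T) (cell_nt a))
        (inv_into (Obj (carrier S)) (omap (Lbang fac S)) z))\<rparr>)"

definition free_cell :: "'u fact_choice \<Rightarrow> 'u sk_cell \<Rightarrow> 'u sk_cell" where
  "free_cell fac a = \<lparr>cell_dom = free_mor fac (cell_dom a), cell_cod = free_mor fac (cell_cod a),
     cell_nt = free_nt fac a\<rparr>"

lemma free_simps [simp]:
  "sk_dom (free_mor fac m) = free_sketch fac (sk_dom m)" "sk_cod (free_mor fac m) = free_sketch fac (sk_cod m)"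
  "sk_func (free_mor fac m) = free_func fac m" "sk_names (free_mor fac m) = sk_names m"
  "cell_dom (free_cell fac a) = free_mor fac (cell_dom a)" "cell_cod (free_cell fac a) = free_mor fac (cell_cod a)"
  "cell_nt (free_cell fac a) = free_nt fac a"
  "carrier (free_sketch fac S) = Fib fac S" "names (free_sketch fac S) = names S"
  "sk_dom (unit_sk fac S) = S" "sk_cod (unit_sk fac S) = free_sketch fac S"
  "sk_func (unit_sk fac S) = Lbang fac S"
  by (simp_all add: free_mor_def free_cell_def free_sketch_def unit_sk_def)

definition Free :: "'u fact_choice \<Rightarrow> ('u sketch, 'u sk_mor, 'u sk_cell, 'u sketch, 'u sk_mor, 'u sk_cell) two_func" where
  "Free fac = \<lparr>map0 = free_sketch fac, map1 = free_mor fac, map2 = free_cell fac\<rparr>"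

lemma Free_simps [simp]: "map0 (Free fac) = free_sketch fac" "map1 (Free fac) = free_mor fac" "map2 (Free fac) = free_cell fac"
  by (simp_all add: Free_def)

context
  fixes fac :: "'u fact_choice"
  assumes univ: "universe TYPE('u)"
    and fac: "\<And>S. limit_sketch S \<Longrightarrow>
      functorial_factorization (coslice (carrier S)) (Lcls S) (Rcls S) (fac S)"
begin

lemma realization: "limit_sketch S \<Longrightarrow> realization fac S"
  using univ fac by unfold_locales

text \<open>The morphism m sends a specified cone to a specified cone of its codomain, which the
  functor L there turns into a limit.\<close>

lemma limit_cone_L_func:
  assumes m: "is_sk_mor m" and \<alpha>: "\<alpha> \<in> names (sk_dom m)"
  shows "limit_cone (Fib fac (sk_cod m)) (map_cone (comp_func (Lbang fac (sk_cod m)) (sk_func m)) (cones (sk_dom m) \<alpha>))"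
proof -
  interpret T: realization fac "sk_cod m"
    using sk_mor_cod[OF m] by (rule realization)
  show ?thesis
    using map_cone_comp[OF sketch_is_cone[OF sk_mor_dom[OF m] \<alpha>] sk_mor_functor[OF m] T.L]
      sk_mor_cones[OF m \<alpha>] T.limit_cone_L sk_mor_names[OF m] \<alpha> by auto
qed

lemma free_func_ex1:
  assumes m: "is_sk_mor m"
  shows "\<exists>!H. functor_between H (Fib fac (sk_dom m)) (Fib fac (sk_cod m)) \<and>
    comp_func H (Lbang fac (sk_dom m)) = comp_func (Lbang fac (sk_cod m)) (sk_func m)"
proof -
  interpret S: realization fac "sk_dom m"
    using sk_mor_dom[OF m] by (rule realization)
  interpret T: realization fac "sk_cod m"
    using sk_mor_cod[OF m] by (rule realization)
  note F = comp_func_between[OF sk_mor_functor[OF m] T.L]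
  show ?thesis
    using F T.small_P limit_sharp[OF sk_mor_dom[OF m] F limit_cone_L_func[OF m]]
    by (rule S.universal_property)
qed

lemma
  assumes "is_sk_mor m"
  shows free_func: "functor_between (free_func fac m) (Fib fac (sk_dom m)) (Fib fac (sk_cod m))"
    and free_func_L: "comp_func (free_func fac m) (Lbang fac (sk_dom m)) = comp_func (Lbang fac (sk_cod m)) (sk_func m)"
  using theI'[OF free_func_ex1[OF assms]] unfolding free_func_def by blast+

lemma free_func_unique:
  assumes "is_sk_mor m" "functor_between H (Fib fac (sk_dom m)) (Fib fac (sk_cod m))"
    "comp_func H (Lbang fac (sk_dom m)) = comp_func (Lbang fac (sk_cod m)) (sk_func m)"
  shows "free_func fac m = H"
  using free_func_ex1[OF assms(1)] free_func[OF assms(1)] free_func_L[OF assms(1)] assms(2,3) by blast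

lemma free_func_obj:
  assumes m: "is_sk_mor m" and x: "x \<in> Obj (carrier (sk_dom m))"
  shows "omap (free_func fac m) (omap (Lbang fac (sk_dom m)) x) = omap (Lbang fac (sk_cod m)) (omap (sk_func m) x)"
  using comp_func_omap[OF realization.L[OF realization[OF sk_mor_dom[OF m]]] x, of "free_func fac m"]
    comp_func_omap[OF sk_mor_functor[OF m] x, of "Lbang fac (sk_cod m)"] free_func_L[OF m] by simp

lemma free_func_arr:
  assumes m: "is_sk_mor m" and f: "f \<in> Arr (carrier (sk_dom m))"
  shows "amap (free_func fac m) (amap (Lbang fac (sk_dom m)) f) = amap (Lbang fac (sk_cod m)) (amap (sk_func m) f)"
  using comp_func_amap[OF realization.L[OF realization[OF sk_mor_dom[OF m]]] f, of "free_func fac m"]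
    comp_func_amap[OF sk_mor_functor[OF m] f, of "Lbang fac (sk_cod m)"] free_func_L[OF m] by simp

text \<open>With L and L' for the domain and codomain of m, the free functor after L equals L' after
  m. Hence it sends the image under L of a specified cone to the image under L' of the matching
  cone, and the name map is unchanged.\<close>

lemma sk_mor_free:
  assumes m: "is_sk_mor m"
  shows "is_sk_mor (free_mor fac m)"
proof -
  interpret S: realization fac "sk_dom m"
    using sk_mor_dom[OF m] by (rule realization)
  interpret T: realization fac "sk_cod m"
    using sk_mor_cod[OF m] by (rule realization)
  have "map_cone (free_func fac m) (map_cone S.L (cones (sk_dom m) \<alpha>)) = map_cone T.L (cones (sk_cod m) (sk_names m \<alpha>))"
    if \<alpha>: "\<alpha> \<in> names (sk_dom m)" for \<alpha>
    using map_cone_comp[OF sketch_is_cone[OF sk_mor_dom[OF m] \<alpha>] S.L free_func[OF m]]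
      map_cone_comp[OF sketch_is_cone[OF sk_mor_dom[OF m] \<alpha>] sk_mor_functor[OF m] T.L]
      free_func_L[OF m] sk_mor_cones[OF m \<alpha>] by simp
  then show ?thesis
    using S.limit_sketch_free T.limit_sketch_free free_func[OF m] sk_mor_names[OF m]
    by (auto simp: is_sk_mor_def) (auto simp: free_sketch_def)
qed

lemma free_mor_id:
  assumes S: "limit_sketch S"
  shows "free_mor fac (id_sk S) = id_sk (free_sketch fac S)"
proof -
  interpret realization fac S
    using S by (rule realization)
  have "free_func fac (id_sk S) = id_func P"
    using id_func_between[OF catP] comp_func_id[OF L] id_comp_func[OF L]
    by (intro free_func_unique sk_mor_id_sk S) simp_all
  then show ?thesis
    by (intro sk_mor_eqI) (simp_all add: id_sk_def)
qed

lemma free_mor_comp: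
  assumes m: "is_sk_mor m" and n: "is_sk_mor n" and mn: "sk_cod m = sk_dom n"
  shows "free_mor fac (comp_sk n m) = comp_sk (free_mor fac n) (free_mor fac m)"
proof -
  note L = realization.L[OF realization]
  note Fm = free_func[OF m, unfolded mn] and Fn = free_func[OF n]
  note m' = sk_mor_functor[OF m, unfolded mn]
  have "comp_func (comp_func (free_func fac n) (free_func fac m)) (Lbang fac (sk_dom m)) =
      comp_func (free_func fac n) (comp_func (Lbang fac (sk_dom n)) (sk_func m))"
    using comp_func_assoc[OF L[OF sk_mor_dom[OF m]] Fm Fn] free_func_L[OF m] mn by simp
  also have "\<dots> = comp_func (Lbang fac (sk_cod n)) (comp_func (sk_func n) (sk_func m))"
    using comp_func_assoc[OF m' L[OF sk_mor_dom[OF n]] Fn] free_func_L[OF n]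
      comp_func_assoc[OF m' sk_mor_functor[OF n] L[OF sk_mor_cod[OF n]]] by simp
  finally have "free_func fac (comp_sk n m) = comp_func (free_func fac n) (free_func fac m)"
    using comp_func_between[OF Fm Fn] by (intro free_func_unique sk_mor_comp_sk m n mn) simp_all
  then show ?thesis
    by (intro sk_mor_eqI) (simp_all add: comp_sk_def)
qed

text \<open>Whiskering the cell with L of the codomain gives a transformation between L' after m and
  L' after n. By \<open>free_func_L\<close> these are the free functors restricted along L, as
  \<open>nat_extension\<close> requires.\<close>

lemma
  assumes a: "is_sk_cell a"
  shows free_nt: "is_nat (free_nt fac a) (free_func fac (cell_dom a)) (free_func fac (cell_cod a))"
    and free_nt_L: "x \<in> Obj (carrier (sk_dom (cell_dom a))) \<Longrightarrow>
      cmp (free_nt fac a) (omap (Lbang fac (sk_dom (cell_dom a))) x) =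
      amap (Lbang fac (sk_cod (cell_dom a))) (cmp (cell_nt a) x)"
proof -
  let ?m = "cell_dom a" and ?n = "cell_cod a"
  note ends = cell_ends[OF a] and m = cell_mor(1)[OF a] and n = cell_mor(2)[OF a]
  interpret S: realization fac "sk_dom ?m"
    using sk_mor_dom[OF m] by (rule realization)
  interpret T: realization fac "sk_cod ?m"
    using sk_mor_cod[OF m] by (rule realization)
  note Fm = free_func[OF m] and Fn = free_func[OF n, unfolded ends]
  have "is_nat (whisker T.L (cell_nt a)) (comp_func (free_func fac ?m) S.L) (comp_func (free_func fac ?n) S.L)"
    using is_nat_whisker[OF cell_nat[OF a] cell_functor[OF a] T.L] free_func_L[OF m] free_func_L[OF n] ends
    by simp
  moreover have "limit_cone T.P (map_cone (comp_func (free_func fac ?n) S.L) (cones (sk_dom ?m) \<alpha>))"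
    if "\<alpha> \<in> names (sk_dom ?m)" for \<alpha>
    using limit_cone_L_func[OF n] free_func_L[OF n] ends that by simp
  ultimately have *: "is_nat (free_nt fac a) (free_func fac ?m) (free_func fac ?n)"
    "\<And>x. x \<in> Obj S.E \<Longrightarrow> cmp (free_nt fac a) (omap S.L x) = cmp (whisker T.L (cell_nt a)) x"
    using S.nat_extension[OF Fm Fn] by (simp_all add: free_nt_def Let_def del: restrict_apply)
  show "is_nat (free_nt fac a) (free_func fac ?m) (free_func fac ?n)" by fact
  show "x \<in> Obj S.E \<Longrightarrow> cmp (free_nt fac a) (omap S.L x) = amap T.L (cmp (cell_nt a) x)"
    using *(2) whisker_cmp[OF cell_nat[OF a] cell_functor[OF a]] by simp
qed

lemma sk_cell_free:
  assumes a: "is_sk_cell a"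
  shows "is_sk_cell (free_cell fac a)"
  using free_nt[OF a] sk_mor_free[OF cell_mor(1)[OF a]] sk_mor_free[OF cell_mor(2)[OF a]] cell_ends[OF a]
  by (simp add: is_sk_cell_def)

text \<open>A cell between free morphisms is determined by its components at the objects L x. So
  each 2-functor law on cells reduces to one computation in the image of L.\<close>

lemma free_cell_eqI:
  assumes a: "is_sk_cell a" and b: "is_sk_cell b"
    and ends: "cell_dom b = free_mor fac (cell_dom a)" "cell_cod b = free_mor fac (cell_cod a)"
    and eq: "\<And>x. x \<in> Obj (carrier (sk_dom (cell_dom a))) \<Longrightarrow>
      cmp (cell_nt b) (omap (Lbang fac (sk_dom (cell_dom a))) x) =
      amap (Lbang fac (sk_cod (cell_dom a))) (cmp (cell_nt a) x)"
  shows "free_cell fac a = b"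
proof -
  interpret S: realization fac "sk_dom (cell_dom a)"
    using sk_mor_dom[OF cell_mor(1)[OF a]] by (rule realization)
  have "free_nt fac a = cell_nt b"
  proof (rule S.nat_L_eqI[OF free_nt[OF a] _ free_func[OF cell_mor(1)[OF a]]])
    show "is_nat (cell_nt b) (free_func fac (cell_dom a)) (free_func fac (cell_cod a))"
      using cell_nat[OF b] ends by simp
  qed (simp add: free_nt_L[OF a] eq)
  then show ?thesis
    using ends by (simp add: free_cell_def)
qed

lemma free_cell_id:
  assumes m: "is_sk_mor m"
  shows "free_cell fac (id2 LS m) = id2 LS (free_mor fac m)"
proof (rule free_cell_eqI)
  interpret S: realization fac "sk_dom m"
    using sk_mor_dom[OF m] by (rule realization)
  interpret T: realization fac "sk_cod m"
    using sk_mor_cod[OF m] by (rule realization)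
  fix x assume "x \<in> Obj (carrier (sk_dom (cell_dom (id2 LS m))))"
  then have x: "x \<in> Obj S.E" by simp
  show "cmp (cell_nt (id2 LS (free_mor fac m))) (omap (Lbang fac (sk_dom (cell_dom (id2 LS m)))) x) =
      amap (Lbang fac (sk_cod (cell_dom (id2 LS m)))) (cmp (cell_nt (id2 LS m)) x)"
    using cmp_id_nt[OF free_func[OF m] functor_obj[OF S.L x]] cmp_id_nt[OF sk_mor_functor[OF m] x]
      functor_ide[OF T.L functor_obj[OF sk_mor_functor[OF m] x]] free_func_obj[OF m x] by simp
qed (use m sk_cell_id[OF m] sk_cell_id[OF sk_mor_free[OF m]] in simp_all)

lemma free_cell_vcomp:
  assumes a: "is_sk_cell a" and b: "is_sk_cell b" and ab: "cell_cod a = cell_dom b"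
  shows "free_cell fac (vcomp LS b a) = vcomp LS (free_cell fac b) (free_cell fac a)"
proof (rule free_cell_eqI)
  interpret S: realization fac "sk_dom (cell_dom a)"
    using sk_mor_dom[OF cell_mor(1)[OF a]] by (rule realization)
  interpret T: realization fac "sk_cod (cell_dom a)"
    using sk_mor_cod[OF cell_mor(1)[OF a]] by (rule realization)
  show "is_sk_cell (vcomp LS b a)"
    using a b ab by (rule sk_cell_vcomp)
  show "is_sk_cell (vcomp LS (free_cell fac b) (free_cell fac a))"
    using ab by (intro sk_cell_vcomp sk_cell_free a b) simp
  fix x assume "x \<in> Obj (carrier (sk_dom (cell_dom (vcomp LS b a))))"
  then have x: "x \<in> Obj S.E" by simp
  have ends: "sk_dom (cell_dom b) = sk_dom (cell_dom a)" "sk_cod (cell_dom b) = sk_cod (cell_dom a)"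
    using cell_ends[OF a] ab by simp_all
  note a_nat = cell_nat[OF a] cell_functor[OF a]
  note ax = nat_Hom[OF a_nat x]
  note bx = nat_Hom[OF cell_nat[OF b] cell_functor[OF b], unfolded ends, OF x, folded ab]
  show "cmp (cell_nt (vcomp LS (free_cell fac b) (free_cell fac a)))
        (omap (Lbang fac (sk_dom (cell_dom (vcomp LS b a)))) x) =
      amap (Lbang fac (sk_cod (cell_dom (vcomp LS b a)))) (cmp (cell_nt (vcomp LS b a)) x)"
    using cmp_vcomp_nt[OF free_nt[OF a] free_func[OF cell_mor(1)[OF a]] functor_obj[OF S.L x], of "free_nt fac b"]
      cmp_vcomp_nt[OF a_nat x, of "cell_nt b"] free_nt_L[OF a x] free_nt_L[OF b, unfolded ends, OF x]
      functor_comp[OF T.L ax bx] by simp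
qed simp_all

lemma free_cell_hcomp:
  assumes a: "is_sk_cell a" and b: "is_sk_cell b" and ab: "sk_cod (cell_dom a) = sk_dom (cell_dom b)"
  shows "free_cell fac (hcomp LS b a) = hcomp LS (free_cell fac b) (free_cell fac a)"
proof (rule free_cell_eqI)
  note ma = cell_mor[OF a] and mb = cell_mor[OF b]
  interpret S: realization fac "sk_dom (cell_dom a)"
    using sk_mor_dom[OF ma(1)] by (rule realization)
  interpret T: realization fac "sk_dom (cell_dom b)"
    using sk_mor_dom[OF mb(1)] by (rule realization)
  interpret U: realization fac "sk_cod (cell_dom b)"
    using sk_mor_cod[OF mb(1)] by (rule realization)
  show "is_sk_cell (hcomp LS b a)"
    using a b ab by (rule sk_cell_hcomp)
  show "is_sk_cell (hcomp LS (free_cell fac b) (free_cell fac a))"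
    using ab by (intro sk_cell_hcomp sk_cell_free a b) simp
  show "cell_dom (hcomp LS (free_cell fac b) (free_cell fac a)) = free_mor fac (cell_dom (hcomp LS b a))"
    using free_mor_comp[OF ma(1) mb(1) ab] by simp
  show "cell_cod (hcomp LS (free_cell fac b) (free_cell fac a)) = free_mor fac (cell_cod (hcomp LS b a))"
    using free_mor_comp[OF ma(2) mb(2)] ab cell_ends[OF a] cell_ends[OF b] by simp
  fix x assume "x \<in> Obj (carrier (sk_dom (cell_dom (hcomp LS b a))))"
  then have x: "x \<in> Obj S.E" by simp
  note a_nat = cell_nat[OF a] cell_functor[OF a, unfolded ab]
  note b_nat = cell_nat[OF b] cell_functor[OF b]
  note ax = nat_Hom[OF a_nat x]
  have G: "functor_between (sk_func (cell_cod a)) S.E T.E"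
    using nat_cod_functor[OF a_nat] .
  note Gx = functor_obj[OF G x]
  \<comment> \<open>The outer component is taken at the free functor applied to L x. It must be
    recognized as L of an object before \<open>free_nt_L\<close> applies to b.\<close>
  have "omap (free_func fac (cell_cod a)) (omap S.L x) = omap T.L (omap (sk_func (cell_cod a)) x)"
    using free_func_obj[OF ma(2)] cell_ends[OF a] ab x by simp
  moreover have "amap (free_func fac (cell_dom b)) (amap T.L (cmp (cell_nt a) x)) =
      amap U.L (amap (sk_func (cell_dom b)) (cmp (cell_nt a) x))"
    using free_func_arr[OF mb(1)] ax by (simp add: Hom_iff)
  ultimately show "cmp (cell_nt (hcomp LS (free_cell fac b) (free_cell fac a)))
        (omap (Lbang fac (sk_dom (cell_dom (hcomp LS b a)))) x) =
      amap (Lbang fac (sk_cod (cell_dom (hcomp LS b a)))) (cmp (cell_nt (hcomp LS b a)) x)"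
    using cmp_hcomp_nt[OF free_nt[OF a] free_func[OF ma(1), unfolded ab] free_nt[OF b] free_func[OF mb(1)]
        functor_obj[OF S.L x]]
      cmp_hcomp_nt[OF a_nat b_nat x] free_nt_L[OF a x] free_nt_L[OF b Gx] ab
      functor_comp[OF U.L functor_Hom[OF b_nat(2) ax] nat_Hom[OF b_nat Gx]] by simp
qed

lemma two_functor_Free: "two_functor LS RLS (Free fac)"
proof -
  have sk: "limit_sketch (free_sketch fac S) \<and> realized (free_sketch fac S)" if "limit_sketch S" for S
    using realization.limit_sketch_free realization.realized_free realization[OF that] by blast
  show ?thesis
    unfolding two_functor_def RLS_def
  proof (intro conjI ballI impI)
    show "two_category LS" "two_category (full_sub_two_cat LS realized)"
      using two_category_LS two_category_full_sub by blast+
    show "map2 (Free fac) (id2 LS m) = id2 (full_sub_two_cat LS realized) (map1 (Free fac) m)" if "m \<in> One LS" for m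
      using free_cell_id[of m] that by (simp del: LS_simps(10))
    show "map2 (Free fac) (vcomp LS b a) = vcomp (full_sub_two_cat LS realized) (map2 (Free fac) b) (map2 (Free fac) a)"
      if "a \<in> Two LS" "b \<in> Two LS" "tgt2 LS a = src2 LS b" for a b
      using free_cell_vcomp[of a b] that by (simp del: LS_simps(11))
    show "map2 (Free fac) (hcomp LS b a) = hcomp (full_sub_two_cat LS realized) (map2 (Free fac) b) (map2 (Free fac) a)"
      if "a \<in> Two LS" "b \<in> Two LS" "tgt1 LS (src2 LS a) = src1 LS (src2 LS b)" for a b
      using free_cell_hcomp[of a b] that by (simp del: LS_simps(12))
  qed (auto simp: sk sk_mor_dom sk_mor_cod sk_mor_free sk_cell_free cell_mor free_mor_id free_mor_comp)
qed

section \<open>Naturality of the unit\<close>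

lemma unit_square:
  assumes m: "is_sk_mor m"
  shows "comp_sk (unit_sk fac (sk_cod m)) m = comp_sk (free_mor fac m) (unit_sk fac (sk_dom m))"
proof -
  have "compose (names (sk_dom m)) (\<lambda>\<alpha>\<in>names (sk_cod m). \<alpha>) (sk_names m) =
      compose (names (sk_dom m)) (sk_names m) (\<lambda>\<alpha>\<in>names (sk_dom m). \<alpha>)"
    using sk_mor_names[OF m] by (auto simp: compose_def fun_eq_iff)
  then show ?thesis
    using free_func_L[OF m] by (intro sk_mor_eqI) (simp_all add: comp_sk_def unit_sk_def)
qed

lemma two_natural_unit: "two_natural LS LS id_two_func (comp_two_func id_two_func (Free fac)) (unit_sk fac)"
  unfolding two_natural_def
proof (intro conjI ballI)
  show "two_functor LS LS id_two_func"
    using two_category_LS by (rule two_functor_id)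
  show "two_functor LS LS (comp_two_func id_two_func (Free fac))"
    using two_category_LS two_functor_Free[unfolded RLS_def] by (rule two_functor_comp_inclusion)
  show "unit_sk fac S \<in> One LS" if "S \<in> Ob LS" for S
    using realization.sk_mor_unit[OF realization] that by simp
  fix m :: "'u sk_mor" assume "m \<in> One LS"
  then have "is_sk_mor m" by simp
  then show "comp1 LS (unit_sk fac (tgt1 LS m)) (map1 id_two_func m) =
      comp1 LS (map1 (comp_two_func id_two_func (Free fac)) m) (unit_sk fac (src1 LS m))"
    using unit_square by (simp add: id_two_func_def comp_two_func_def)
next
  fix a :: "'u sk_cell" assume "a \<in> Two LS"
  then have a: "is_sk_cell a" by simp
  let ?m = "cell_dom a" and ?n = "cell_cod a"
  note m = cell_mor(1)[OF a] and n = cell_mor(2)[OF a] and ends = cell_ends[OF a]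
  interpret S: realization fac "sk_dom ?m"
    using sk_mor_dom[OF m] by (rule realization)
  interpret T: realization fac "sk_cod ?m"
    using sk_mor_cod[OF m] by (rule realization)
  note a_nat = cell_nat[OF a] cell_functor[OF a]
  note Fm = free_func[OF m]
  have "hcomp_nt (id_nt T.L) (cell_nt a) = hcomp_nt (free_nt fac a) (id_nt S.L)"
  proof (rule nat_eqI)
    show "is_nat (hcomp_nt (id_nt T.L) (cell_nt a)) (comp_func T.L (sk_func ?m)) (comp_func T.L (sk_func ?n))"
      using is_nat_hcomp_nt[OF a_nat is_nat_id_nt[OF T.L] T.L] .
    show "is_nat (hcomp_nt (free_nt fac a) (id_nt S.L)) (comp_func T.L (sk_func ?m)) (comp_func T.L (sk_func ?n))"
      using is_nat_hcomp_nt[OF is_nat_id_nt[OF S.L] S.L free_nt[OF a] Fm] free_func_L[OF m] free_func_L[OF n] ends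
      by simp
    show "functor_between (comp_func T.L (sk_func ?m)) S.E T.P"
      using a_nat(2) T.L by (rule comp_func_between)
    \<comment> \<open>Both sides reduce to the image under T.L of the component of a at x: the
      identity factors drop out, and \<open>free_nt_L\<close> evaluates the free cell at S.L
      x.\<close>
    show "cmp (hcomp_nt (id_nt T.L) (cell_nt a)) x = cmp (hcomp_nt (free_nt fac a) (id_nt S.L)) x"
      if x: "x \<in> Obj S.E" for x
    proof -
      have Ta: "amap T.L (cmp (cell_nt a) x) \<in>
          Hom T.P (omap T.L (omap (sk_func ?m) x)) (omap T.L (omap (sk_func ?n) x))"
        using functor_Hom[OF T.L nat_Hom[OF a_nat x]] .
      show ?thesis
        using cmp_hcomp_nt[OF a_nat is_nat_id_nt[OF T.L] T.L x]
          cmp_hcomp_nt[OF is_nat_id_nt[OF S.L] S.L free_nt[OF a] Fm x]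
          cmp_id_nt[OF S.L x] cmp_id_nt[OF T.L functor_obj[OF nat_cod_functor[OF a_nat] x]]
          functor_ide[OF Fm functor_obj[OF S.L x]] free_func_obj[OF m x] free_nt_L[OF a x]
          comp_ide[OF T.catP Ta] ide_comp[OF T.catP Ta] by simp
    qed
  qed
  then show "hcomp LS (id2 LS (unit_sk fac (tgt1 LS (src2 LS a)))) (map2 id_two_func a) =
      hcomp LS (map2 (comp_two_func id_two_func (Free fac)) a) (id2 LS (unit_sk fac (src1 LS (src2 LS a))))"
    using unit_square[OF m] unit_square[OF n] ends by (simp add: id_two_func_def comp_two_func_def)
qed (simp_all add: id_two_func_def comp_two_func_def)

end

theorem lemma6p5:
  fixes fac :: "'u fact_choice"
  assumes univ: "universe TYPE('u)"
    and fac: "\<And>S. limit_sketch S \<Longrightarrow>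
      functorial_factorization (coslice (carrier S)) (Lcls S) (Rcls S) (fac S)"
  shows "\<exists>Fr. two_functor LS RLS Fr \<and>
    (\<forall>S\<in>Ob LS. map0 Fr S = free_sketch fac S) \<and>
    two_functor RLS LS id_two_func \<and>
    two_natural LS LS id_two_func (comp_two_func id_two_func Fr) (unit_sk fac)"
proof (intro exI conjI ballI)
  show "two_functor LS RLS (Free fac)"
    using univ fac by (rule two_functor_Free)
  show "two_natural LS LS id_two_func (comp_two_func id_two_func (Free fac)) (unit_sk fac)"
    using univ fac by (rule two_natural_unit)
  show "two_functor RLS LS id_two_func"
    unfolding RLS_def using two_category_LS by (rule two_functor_inclusion)
qed simp

end
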